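(* For $\alpha,\beta,m,\gamma_1,\dots,\gamma_m\ge1$ let $$R^{\mathrm A}_{\alpha,\beta;\gamma_1,\dots,\gamma_m}:=\frac1{m!}\left.\frac{\partial^{m+2}F_{A_N}}{\partial t_\alpha\,\partial t_\beta\,\partial t_{N+1-\gamma_1}\cdots\partial t_{N+1-\gamma_m}}\right|_{t=0},\qquad N=\alpha+\beta+1,\ \ 1\le\gamma_i\le N .$$ Consider the system of PDEs on $f=f(t_1,t_2,\dots)$ $$\partial_\alpha\partial_\beta f=\sum_{m\ge1}\ \sum_{\gamma_1+\dots+\gamma_m=\alpha+\beta-m}R^{\mathrm A}_{\alpha,\beta;\gamma_1,\dots,\gamma_m}\,\partial_1\partial_{\gamma_1}f\cdots\partial_1\partial_{\gamma_m}f,\qquad\alpha,\beta\ge1.\qquad(\ast)$$ (1) The system $(\ast)$ coincides with the dispersionless KP hierarchy after the change of variables $t_k\mapsto t_k/k$: the function $f(t_1,t_2,t_3,\dots):=F_0(t_1,t_2/2,t_3/3,\dots)$ satisfies $(\ast)$ if and only if $F_0$ satisfies the dispersionless KP hierarchy. (2) The full KP hierarchy is obtained from $(\ast)$ (after the same change of variables) via the substitution $\partial_k\mapsto\partial_k^\hbar$: a function $F$ satisfies the full KP hierarchy in Fay form if and only if for all $i,j\ge1$ $$\frac{\partial_i^\hbar}{i}\frac{\partial_j^\hbar}{j}F=\sum_{m\ge1}\ \sum_{\gamma_1+\dots+\gamma_m=i+j-m}R^{\mathrm A}_{i,j;\gamma_1,\dots,\gamma_m}\prod_{k=1}^m\f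rac{\partial_1\partial^\hbar_{\gamma_k}F}{\gamma_k}.$$
   Context: The $A_N$ Frobenius potential $F_{A_N}$ ($N\ge1$). Let $\Lambda=\frac{x^{N+1}}{N+1}+y^2+\sum_{k=1}^Nv_kx^{k-1}$ with parameters $v=(v_1,\dots,v_N)\in\mathbb{C}^N$, and let $c_{ab}^k(v)$ be the structure constants of the ring $\mathbb{C}[x,y]/(\partial\Lambda/\partial x,\partial\Lambda/\partial y)$ in the basis of classes of $x^{k-1}$, $1\le k\le N$. Define the product $\frac{\partial}{\partial v_a}\circ\frac{\partial}{\partial v_b}=\sum_kc_{ab}^k(v)\frac{\partial}{\partial v_k}$ on vector fields and the pairing $\eta(\frac{\partial}{\partial v_a},\frac{\partial}{\partial v_b})=c_{ab}^N(v)$. The flat coordinates $t_1,\dots,t_N$ are related to $v$ by the invertible polynomial change $$v_\gamma=\sum_{\substack{a_1,\dots,a_N\ge0\\ \sum_k(N+2-k)a_k=N+2-\gamma}}\frac{(|a|+\gamma-2)!}{(\gamma-1)!}\prod_{k=1}^N\frac{t_k^{a_k}}{a_k!},\qquad|a|=\sum_ka_k,$$ and in them $\eta(\frac{\partial}{\partial t_\alpha},\frac{\partial}{\partial t_\beta})=\delta_{\alpha+\beta,N+1}$. $F_{A_N}\in\mathbb{Q}[t_1,\dots,t_N]$ is the unique polynomial without terms of degree $\le2$ such that $\frac{\partial^3F_{A_N}}{\partial t_\alpha\partial t_\beta\partial t_\gamma}=\eta(\frac{\partial}{\partial t_\alpha}\circ\frac{\partial}{\partial t_\beta},\frac{\partial}{\partial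 t_\gamma})$. Notation: $\partial_k=\partial/\partial t_k$. For $i,j,m\ge1$ and $\gamma_1,\dots,\gamma_m\ge1$, $\widehat P_{ij}(\gamma_1,\dots,\gamma_m)$ is the number of pairs of ordered $m$-tuples of positive integers $(i_1,\dots,i_m)$, $(j_1,\dots,j_m)$ with $\sum i_k=i$, $\sum j_k=j$ and $i_k+j_k=\gamma_k+1$ for all $k$. Dispersionless KP hierarchy: the system on $F_0=F_0(t_1,t_2,\dots)$, for all $i,j\ge1$, $$\partial_i\partial_jF_0=\sum_{m\ge1}\frac{(-1)^{m-1}}{m}\sum_{\gamma_1+\dots+\gamma_m=i+j-m}\frac{ij}{\gamma_1\cdots\gamma_m}\widehat P_{ij}(\gamma_1,\dots,\gamma_m)\,\partial_1\partial_{\gamma_1}F_0\cdots\partial_1\partial_{\gamma_m}F_0 .$$ Full KP hierarchy (Fay form): with $D(z)=\sum_{k\ge1}\frac{z^{-k}}k\partial_k$ and $\Delta(z)=\frac{\exp(\hbar D(z))-1}{\hbar}$, the identity of formal power series in $z_1^{-1},z_2^{-1}$ $$\exp(\Delta(z_1)\Delta(z_2)F)=1-\frac{\Delta(z_1)\partial_1F-\Delta(z_2)\partial_1F}{z_1-z_2}$$ for $F=F(t_1,t_2,\dots;\hbar)=\sum_{g\ge0}\hbar^gF_g$ (related to the tau-function by $F=\hbar^2\log\tau$). The operators $\partial_k^\hbar=\partial_k+O(\hbar)$ are defined by $\Delta(z)=\sum_{k\ge1}\frac{z^{-k}}k\partial_k^\hbar$. Functions may be taken to be formal power series in the variables $t_k$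 (and $\hbar$). *)

theory Defs
  imports Complex_Main "HOL-Library.Poly_Mapping" "HOL-Computational_Algebra.Polynomial"
    "HOL-Computational_Algebra.Formal_Power_Series"
begin

notation fps_nth (infixl \<open>$\<close> 75)

abbreviation (input) lookup :: "('a \<Rightarrow>\<^sub>0 'b::zero) \<Rightarrow> 'a \<Rightarrow> 'b" where
  "lookup \<equiv> Poly_Mapping.lookup"

abbreviation (input) keys :: "('a \<Rightarrow>\<^sub>0 'b::zero) \<Rightarrow> 'a set" where
  "keys \<equiv> Poly_Mapping.keys"

section \<open>Formal power series in infinitely many variables\<close>

text \<open>
  A series in \<open>t\<^sub>1, t\<^sub>2, \<dots>\<close> is an arbitrary family of coefficients indexed by monomials.
  In a monomial \<open>\<mu> :: nat \<Rightarrow>\<^sub>0 nat\<close> the key \<open>i\<close> stands for the variable with number \<open>i + 1\<close>, so that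
  there is no variable with number \<open>0\<close>: \<open>lookup \<mu> (k - 1)\<close> is the exponent of \<open>t\<^sub>k\<close> for \<open>k \<ge> 1\<close>.
\<close>

typedef 'a mps = "UNIV :: ((nat \<Rightarrow>\<^sub>0 nat) \<Rightarrow> 'a) set"
  morphisms mcoeff Abs_mps
  by simp

lemma mcoeff_Abs_mps [simp]: "mcoeff (Abs_mps f) = f"
  by (simp add: Abs_mps_inverse)

lemma mps_eqI: "(\<And>\<mu>. mcoeff F \<mu> = mcoeff G \<mu>) \<Longrightarrow> F = G"
  by (metis ext mcoeff_inject)

lemma finite_add_decomp: "finite {(a, b). a + b = (\<mu> :: nat \<Rightarrow>\<^sub>0 nat)}"
proof -
  let ?S = "{(a, b). a + b = \<mu>}"
  let ?g = "\<lambda>(a, b :: nat \<Rightarrow>\<^sub>0 nat). lookup a"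
  let ?B = "{f. \<forall>x. (x \<in> keys \<mu> \<longrightarrow> f x \<in> {..Max (lookup \<mu> ` keys \<mu>)})
      \<and> (x \<notin> keys \<mu> \<longrightarrow> f x = 0)}"
  have "finite ?B"
    by (rule finite_set_of_finite_funs) auto
  moreover have "?g ` ?S \<subseteq> ?B"
  proof clarsimp
    fix a b :: "nat \<Rightarrow>\<^sub>0 nat" and x
    show "(x \<in> keys (a + b) \<longrightarrow> lookup a x \<le> Max (lookup (a + b) ` keys (a + b)))
        \<and> (x \<notin> keys (a + b) \<longrightarrow> lookup a x = 0)"
    proof (intro conjI impI)
      assume "x \<in> keys (a + b)"
      then have "lookup (a + b) x \<le> Max (lookup (a + b) ` keys (a + b))"
        by (intro Max_ge) auto
      then show "lookup a x \<le> Max (lookup (a + b) ` keys (a + b))"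
        by (simp add: lookup_add)
    next
      assume "x \<notin> keys (a + b)"
      then show "lookup a x = 0"
        by (simp add: in_keys_iff lookup_add)
    qed
  qed
  ultimately have "finite (?g ` ?S)"
    by (rule rev_finite_subset)
  moreover have "inj_on ?g ?S"
    by (auto simp: inj_on_def lookup_inject)
  ultimately show ?thesis
    by (rule finite_imageD)
qed

instantiation mps :: (comm_ring_1) comm_ring_1
begin

definition "0 = Abs_mps (\<lambda>_. 0)"
definition "1 = Abs_mps (\<lambda>\<mu>. if \<mu> = 0 then 1 else 0)"
definition "F + G = Abs_mps (\<lambda>\<mu>. mcoeff F \<mu> + mcoeff G \<mu>)"
definition "F - G = Abs_mps (\<lambda>\<mu>. mcoeff F \<mu> - mcoeff G \<mu>)"
definition "- F = Abs_mps (\<lambda>\<mu>. - mcoeff F \<mu>)"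
definition "F * G = Abs_mps (\<lambda>\<mu>. \<Sum>(a, b) \<in> {(a, b). a + b = \<mu>}. mcoeff F a * mcoeff G b)"

lemma mcoeff_simps [simp]:
  "mcoeff 0 \<mu> = 0"
  "mcoeff 1 \<mu> = (if \<mu> = 0 then 1 else 0)"
  "mcoeff (F + G) \<mu> = mcoeff F \<mu> + mcoeff G \<mu>"
  "mcoeff (F - G) \<mu> = mcoeff F \<mu> - mcoeff G \<mu>"
  "mcoeff (- F) \<mu> = - mcoeff F \<mu>"
  by (simp_all add: zero_mps_def one_mps_def plus_mps_def minus_mps_def uminus_mps_def)

lemma mcoeff_mult:
  "mcoeff (F * G) \<mu> = (\<Sum>(a, b) \<in> {(a, b). a + b = \<mu>}. mcoeff F a * mcoeff G b)"
  by (simp add: times_mps_def)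

instance
proof
  fix F G H :: "'a mps"
  show "F * G * H = F * (G * H)"
  proof (rule mps_eqI)
    fix \<mu> :: "nat \<Rightarrow>\<^sub>0 nat"
    let ?D = "\<lambda>\<mu> :: nat \<Rightarrow>\<^sub>0 nat. {(a, b). a + b = \<mu>}"
    have "mcoeff (F * G * H) \<mu>
        = (\<Sum>p \<in> ?D \<mu>. \<Sum>q \<in> ?D (fst p). mcoeff F (fst q) * mcoeff G (snd q) * mcoeff H (snd p))"
      by (simp add: mcoeff_mult sum_distrib_right case_prod_beta)
    also have "\<dots> = (\<Sum>(p, q) \<in> Sigma (?D \<mu>) (\<lambda>p. ?D (fst p)).
        mcoeff F (fst q) * mcoeff G (snd q) * mcoeff H (snd p))"
      by (rule sum.Sigma) (auto simp: finite_add_decomp)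
    also have "\<dots> = (\<Sum>(p, q) \<in> Sigma (?D \<mu>) (\<lambda>p. ?D (snd p)).
        mcoeff F (fst p) * (mcoeff G (fst q) * mcoeff H (snd q)))"
      by (rule sum.reindex_bij_witness[where
            i = "\<lambda>(p, q). ((fst p + fst q, snd q), (fst p, fst q))" and
            j = "\<lambda>(p, q). ((fst q, snd q + snd p), (snd q, snd p))"])
         (auto simp: mult.assoc add.assoc)
    also have "\<dots> = (\<Sum>p \<in> ?D \<mu>. \<Sum>q \<in> ?D (snd p).
        mcoeff F (fst p) * (mcoeff G (fst q) * mcoeff H (snd q)))"
      by (rule sum.Sigma[symmetric]) (auto simp: finite_add_decomp)
    also have "\<dots> = mcoeff (F * (G * H)) \<mu>"
      by (simp add: mcoeff_mult sum_distrib_left case_prod_beta)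
    finally show "mcoeff (F * G * H) \<mu> = mcoeff (F * (G * H)) \<mu>" .
  qed
  show "F * G = G * F"
  proof (rule mps_eqI)
    fix \<mu> :: "nat \<Rightarrow>\<^sub>0 nat"
    show "mcoeff (F * G) \<mu> = mcoeff (G * F) \<mu>"
      unfolding mcoeff_mult
      by (rule sum.reindex_bij_witness[where i = prod.swap and j = prod.swap])
         (auto simp: ac_simps)
  qed
  show "1 * F = F"
  proof (rule mps_eqI)
    fix \<mu> :: "nat \<Rightarrow>\<^sub>0 nat"
    have "mcoeff (1 * F) \<mu> = (\<Sum>(a, b) \<in> {(0, \<mu>)}. mcoeff 1 a * mcoeff F b)"
      unfolding mcoeff_mult
      by (rule sum.mono_neutral_right) (auto simp: finite_add_decomp split: if_splits)
    then show "mcoeff (1 * F) \<mu> = mcoeff F \<mu>"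
      by simp
  qed
  show "(F + G) * H = F * H + G * H"
    by (rule mps_eqI)
       (simp add: mcoeff_mult distrib_right case_prod_beta flip: sum.distrib)
  show "(0 :: 'a mps) \<noteq> 1"
    by (metis mcoeff_simps(1,2) zero_neq_one)
qed (auto intro!: mps_eqI)

end

definition mps_const :: "'a::zero \<Rightarrow> 'a mps" where
  "mps_const c = Abs_mps (\<lambda>\<mu>. if \<mu> = 0 then c else 0)"

text \<open>The partial derivative with respect to \<open>t\<^sub>k\<close>; meaningful for \<open>k \<ge> 1\<close> only.\<close>

definition pdiff :: "nat \<Rightarrow> 'a::comm_ring_1 mps \<Rightarrow> 'a mps" where
  "pdiff k F = Abs_mps (\<lambda>\<mu>. of_nat (lookup \<mu> (k - 1) + 1) * mcoeff F (\<mu> + Poly_Mapping.single (k - 1) 1))"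

text \<open>The substitution \<open>F(t\<^sub>1, t\<^sub>2/2, t\<^sub>3/3, \<dots>)\<close>.\<close>

definition rescale :: "complex mps \<Rightarrow> complex mps" where
  "rescale F = Abs_mps (\<lambda>\<mu>. mcoeff F \<mu> * (\<Prod>i\<in>keys \<mu>. (1 / of_nat (i + 1)) ^ lookup \<mu> i))"

text \<open>Polynomials in \<open>t\<^sub>1, \<dots>, t\<^sub>N\<close>, as series with finite support, and their values.\<close>

definition is_polynomial :: "nat \<Rightarrow> 'a::zero mps \<Rightarrow> bool" where
  "is_polynomial N F \<longleftrightarrow>
     finite {\<mu>. mcoeff F \<mu> \<noteq> 0} \<and> (\<forall>\<mu>. mcoeff F \<mu> \<noteq> 0 \<longrightarrow> keys \<mu> \<subseteq> {..<N})"

definition poly_value :: "'a::comm_ring_1 mps \<Rightarrow> (nat \<Rightarrow> 'a) \<Rightarrow> 'a" where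
  "poly_value F t = (\<Sum>\<mu> | mcoeff F \<mu> \<noteq> 0. mcoeff F \<mu> * (\<Prod>i\<in>keys \<mu>. t (i + 1) ^ lookup \<mu> i))"

definition total_degree :: "(nat \<Rightarrow>\<^sub>0 nat) \<Rightarrow> nat" where
  "total_degree \<mu> = (\<Sum>i\<in>keys \<mu>. lookup \<mu> i)"

section \<open>The Frobenius potential of the singularity \<open>A\<^sub>N\<close>\<close>

text \<open>
  The type \<open>complex poly poly\<close> is \<open>\<complex>[x][y]\<close>. Points \<open>v\<close> and \<open>t\<close> of \<open>\<complex>\<^sup>N\<close> are functions
  \<open>nat \<Rightarrow> complex\<close> of which only the values at \<open>1, \<dots>, N\<close> are used; likewise for the components
  of a tangent vector in the basis \<open>\<partial>/\<partial>v\<^sub>1, \<dots>, \<partial>/\<partial>v\<^sub>N\<close>.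
\<close>

definition xy_const :: "complex \<Rightarrow> complex poly poly" where
  "xy_const c = [:[:c:]:]"

definition var_x :: "complex poly poly" where
  "var_x = [:[:0, 1:]:]"

definition var_y :: "complex poly poly" where
  "var_y = [:0, 1:]"

definition Lambda :: "nat \<Rightarrow> (nat \<Rightarrow> complex) \<Rightarrow> complex poly poly" where
  "Lambda N v = xy_const (1 / of_nat (N + 1)) * var_x ^ (N + 1) + var_y ^ 2
     + (\<Sum>k = 1..N. xy_const (v k) * var_x ^ (k - 1))"

definition diff_x :: "complex poly poly \<Rightarrow> complex poly poly" where
  "diff_x p = map_poly pderiv p"

definition diff_y :: "complex poly poly \<Rightarrow> complex poly poly" where
  "diff_y p = pderiv p"

definition jacobian_ideal :: "nat \<Rightarrow> (nat \<Rightarrow> complex) \<Rightarrow> complex poly poly set" where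
  "jacobian_ideal N v = {p * diff_x (Lambda N v) + q * diff_y (Lambda N v) | p q. True}"

text \<open>
  \<open>struct_const N v a b k\<close> is \<open>c\<^bsub>ab\<^esub>\<^sup>k(v)\<close>: the coordinates of the class of
  \<open>x\<^bsup>a-1\<^esup> x\<^bsup>b-1\<^esup>\<close> in the basis of classes of \<open>x\<^bsup>k-1\<^esup>\<close>, \<open>1 \<le> k \<le> N\<close>, extended by \<open>0\<close> to other \<open>k\<close>.
\<close>

definition struct_const :: "nat \<Rightarrow> (nat \<Rightarrow> complex) \<Rightarrow> nat \<Rightarrow> nat \<Rightarrow> nat \<Rightarrow> complex" where
  "struct_const N v a b = (THE c. (\<forall>k. k \<notin> {1..N} \<longrightarrow> c k = 0) \<and>
     var_x ^ (a - 1) * var_x ^ (b - 1) - (\<Sum>k = 1..N. xy_const (c k) * var_x ^ (k - 1))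
       \<in> jacobian_ideal N v)"

definition vprod :: "nat \<Rightarrow> (nat \<Rightarrow> complex) \<Rightarrow> (nat \<Rightarrow> complex) \<Rightarrow> (nat \<Rightarrow> complex) \<Rightarrow> nat \<Rightarrow> complex" where
  "vprod N v X Y k = (\<Sum>a = 1..N. \<Sum>b = 1..N. X a * Y b * struct_const N v a b k)"

definition eta :: "nat \<Rightarrow> (nat \<Rightarrow> complex) \<Rightarrow> (nat \<Rightarrow> complex) \<Rightarrow> (nat \<Rightarrow> complex) \<Rightarrow> complex" where
  "eta N v X Y = (\<Sum>a = 1..N. \<Sum>b = 1..N. X a * Y b * struct_const N v a b N)"

text \<open>
  The polynomial \<open>v\<^sub>\<gamma>(t\<^sub>1, \<dots>, t\<^sub>N)\<close>. The exponent \<open>a\<^sub>k\<close> is \<open>lookup a (k - 1)\<close>. For \<open>1 \<le> \<gamma> \<le> N\<close> the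
  condition forces \<open>|a| \<ge> 1\<close>, so the subtractions are not truncated.
\<close>

definition v_of_t :: "nat \<Rightarrow> nat \<Rightarrow> complex mps" where
  "v_of_t N \<gamma> = Abs_mps (\<lambda>a.
     if keys a \<subseteq> {..<N} \<and> (\<Sum>k = 1..N. (N + 2 - k) * lookup a (k - 1)) = N + 2 - \<gamma>
     then fact (total_degree a + \<gamma> - 2) / fact (\<gamma> - 1) * (\<Prod>k = 1..N. 1 / fact (lookup a (k - 1)))
     else 0)"

definition v_point :: "nat \<Rightarrow> (nat \<Rightarrow> complex) \<Rightarrow> nat \<Rightarrow> complex" where
  "v_point N t \<gamma> = poly_value (v_of_t N \<gamma>) t"

text \<open>The components of the vector field \<open>\<partial>/\<partial>t\<^sub>\<alpha>\<close> at the point \<open>t\<close> in the basis \<open>\<partial>/\<partial>v\<^sub>\<gamma>\<close>.\<close>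

definition t_frame :: "nat \<Rightarrow> (nat \<Rightarrow> complex) \<Rightarrow> nat \<Rightarrow> nat \<Rightarrow> complex" where
  "t_frame N t \<alpha> \<gamma> = poly_value (pdiff \<alpha> (v_of_t N \<gamma>)) t"

definition is_potential :: "nat \<Rightarrow> complex mps \<Rightarrow> bool" where
  "is_potential N F \<longleftrightarrow>
     is_polynomial N F \<and>
     (\<forall>\<mu>. total_degree \<mu> \<le> 2 \<longrightarrow> mcoeff F \<mu> = 0) \<and>
     (\<forall>\<alpha>\<in>{1..N}. \<forall>\<beta>\<in>{1..N}. \<forall>\<gamma>\<in>{1..N}. \<forall>t.
        poly_value (pdiff \<alpha> (pdiff \<beta> (pdiff \<gamma> F))) t =
          eta N (v_point N t)
            (vprod N (v_point N t) (t_frame N t \<alpha>) (t_frame N t \<beta>)) (t_frame N t \<gamma>))"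

text \<open>
  The conditions determine the polynomial already among those with complex coefficients;
  its coefficients then turn out to be rational.
\<close>

definition F_A :: "nat \<Rightarrow> complex mps" where
  "F_A N = (THE F. is_potential N F)"

section \<open>The hierarchies\<close>

text \<open>
  Tuples \<open>(\<gamma>\<^sub>1, \<dots>, \<gamma>\<^sub>m)\<close> of positive integers of any length \<open>m \<ge> 1\<close> with
  \<open>\<gamma>\<^sub>1 + \<dots> + \<gamma>\<^sub>m = i + j - m\<close>; the sum over this set is the double sum over \<open>m\<close> and \<open>\<gamma>\<close>.
\<close>

definition index_tuples :: "nat \<Rightarrow> nat \<Rightarrow> nat list set" where
  "index_tuples i j =
     {\<gamma>s. length \<gamma>s \<ge> 1 \<and> (\<forall>\<gamma>\<in>set \<gamma>s. \<gamma> \<ge> 1) \<and> sum_list \<gamma>s + length \<gamma>s = i + j}"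

lemma finite_index_tuples: "finite (index_tuples i j)"
proof (rule finite_subset)
  show "index_tuples i j \<subseteq> {xs. set xs \<subseteq> {..i + j} \<and> length xs \<le> i + j}"
  proof (clarsimp simp: index_tuples_def)
    fix \<gamma>s x
    assume "sum_list \<gamma>s + length \<gamma>s = i + j" "x \<in> set \<gamma>s"
    then show "x \<le> i + j"
      using member_le_sum_list[of x \<gamma>s] by linarith
  qed
  show "finite {xs. set xs \<subseteq> {..i + j} \<and> length xs \<le> i + j}"
    by (rule finite_lists_length_le) simp
qed

definition R_A :: "nat \<Rightarrow> nat \<Rightarrow> nat list \<Rightarrow> complex" where
  "R_A \<alpha> \<beta> \<gamma>s = (let N = \<alpha> + \<beta> + 1 in
     1 / fact (length \<gamma>s) *
     mcoeff (pdiff \<alpha> (pdiff \<beta> (foldr pdiff (map (\<lambda>\<gamma>. N + 1 - \<gamma>) \<gamma>s) (F_A N)))) 0)"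

definition A_system :: "complex mps \<Rightarrow> bool" where
  "A_system f \<longleftrightarrow> (\<forall>\<alpha>\<ge>1. \<forall>\<beta>\<ge>1.
     pdiff \<alpha> (pdiff \<beta> f) =
       (\<Sum>\<gamma>s\<in>index_tuples \<alpha> \<beta>. mps_const (R_A \<alpha> \<beta> \<gamma>s) * (\<Prod>\<gamma>\<leftarrow>\<gamma>s. pdiff 1 (pdiff \<gamma> f))))"

definition P_hat :: "nat \<Rightarrow> nat \<Rightarrow> nat list \<Rightarrow> nat" where
  "P_hat i j \<gamma>s = card {(is, js). length is = length \<gamma>s \<and> length js = length \<gamma>s \<and>
     (\<forall>n\<in>set is. n \<ge> 1) \<and> (\<forall>n\<in>set js. n \<ge> 1) \<and> sum_list is = i \<and> sum_list js = j \<and>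
     (\<forall>k<length \<gamma>s. is ! k + js ! k = \<gamma>s ! k + 1)}"

definition dispersionless_KP :: "complex mps \<Rightarrow> bool" where
  "dispersionless_KP F0 \<longleftrightarrow> (\<forall>i\<ge>1. \<forall>j\<ge>1.
     pdiff i (pdiff j F0) =
       (\<Sum>\<gamma>s\<in>index_tuples i j.
          mps_const ((-1) ^ (length \<gamma>s - 1) / of_nat (length \<gamma>s)
            * (of_nat (i * j) / of_nat (prod_list \<gamma>s)) * of_nat (P_hat i j \<gamma>s))
          * (\<Prod>\<gamma>\<leftarrow>\<gamma>s. pdiff 1 (pdiff \<gamma> F0))))"

text \<open>
  A series \<open>F(t\<^sub>1, t\<^sub>2, \<dots>; \<hbar>)\<close> is an element of \<open>complex mps fps\<close>, with \<open>\<hbar>\<close> the variable \<open>fps_X\<close>.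
  Series in \<open>w = z\<^bsup>-1\<^esup>\<close> over this ring have type \<open>complex mps fps fps\<close>.
\<close>

definition hconst :: "complex \<Rightarrow> complex mps fps" where
  "hconst c = fps_const (mps_const c)"

definition hpdiff :: "nat \<Rightarrow> complex mps fps \<Rightarrow> complex mps fps" where
  "hpdiff k F = Abs_fps (\<lambda>g. pdiff k (F $ g))"

text \<open>\<open>D_op G\<close> is \<open>\<Sum>\<^sub>k (w\<^sup>k/k) \<partial>\<^sub>k G\<close>, where \<open>\<partial>\<^sub>k\<close> acts on the coefficients of the series \<open>G\<close> in \<open>w\<close>.\<close>

definition D_op :: "complex mps fps fps \<Rightarrow> complex mps fps fps" where
  "D_op G = Abs_fps (\<lambda>n. \<Sum>k = 1..n. hconst (1 / of_nat k) * hpdiff k (G $ (n - k)))"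

lemma D_op_power_nth: "n < k \<Longrightarrow> (D_op ^^ k) G $ n = 0"
proof (induction k arbitrary: n)
  case (Suc k)
  have "hpdiff l ((D_op ^^ k) G $ (n - l)) = 0" if "l \<in> {1..n}" for l
  proof -
    have "(D_op ^^ k) G $ (n - l) = 0"
      by (rule Suc.IH) (use that Suc.prems in auto)
    then show ?thesis
      by (auto simp: hpdiff_def pdiff_def fps_eq_iff intro!: mps_eqI)
  qed
  then have "(\<Sum>l = 1..n. hconst (1 / of_nat l) * hpdiff l ((D_op ^^ k) G $ (n - l))) = 0"
    by (intro sum.neutral) simp
  moreover have "(D_op ^^ Suc k) G $ n
      = (\<Sum>l = 1..n. hconst (1 / of_nat l) * hpdiff l ((D_op ^^ k) G $ (n - l)))"
    by (subst funpow.simps, subst comp_apply, subst D_op_def, simp)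
  ultimately show ?case
    by simp
qed simp

text \<open>
  \<open>exp(\<hbar>D(z)) F\<close>. The operator \<open>D(z)\<^sup>n\<close> only produces powers of \<open>w\<close> that are at least \<open>n\<close>
 by the lemma above, so that each coefficient of the exponential series is a finite sum.
\<close>

definition exp_hD :: "complex mps fps \<Rightarrow> complex mps fps fps" where
  "exp_hD F = Abs_fps (\<lambda>k. \<Sum>n\<le>k. hconst (1 / fact n) * fps_X ^ n * ((D_op ^^ n) (fps_const F) $ k))"

text \<open>Since \<open>\<hbar>\<close> divides every coefficient of the numerator, the shift is the division by \<open>\<hbar>\<close>.\<close>

definition Delta :: "complex mps fps \<Rightarrow> complex mps fps fps" where
  "Delta F = Abs_fps (\<lambda>k. fps_shift 1 ((exp_hD F - fps_const F) $ k))"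

lemma Delta_nth: "fps_X * (Delta F $ k) = (exp_hD F - fps_const F) $ k"
proof -
  have const: "hconst 1 = 1"
    by (simp add: hconst_def mps_const_def flip: one_mps_def)
  have "(exp_hD F - fps_const F) $ k
      = (\<Sum>n = 1..k. hconst (1 / fact n) * fps_X ^ n * ((D_op ^^ n) (fps_const F) $ k))"
    by (simp add: exp_hD_def const atMost_atLeast0 sum.atLeast_Suc_atMost)
  also have "\<dots> $ 0 = 0"
    by (simp add: fps_sum_nth)
  finally show ?thesis
    by (auto simp: Delta_def fps_eq_iff)
qed

definition hbar_pdiff :: "nat \<Rightarrow> complex mps fps \<Rightarrow> complex mps fps" where
  "hbar_pdiff k F = hconst (of_nat k) * (Delta F $ k)"

text \<open>
  Series in \<open>w\<^sub>1 = z\<^sub>1\<^bsup>-1\<^esup>\<close> and \<open>w\<^sub>2 = z\<^sub>2\<^bsup>-1\<^esup>\<close> are series in \<open>w\<^sub>2\<close> whose coefficients are series in \<open>w\<^sub>1\<close>: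
  \<open>G $ j $ i\<close> is the coefficient of \<open>w\<^sub>1\<^sup>i w\<^sub>2\<^sup>j\<close>.
\<close>

definition w1 :: "complex mps fps fps fps" where
  "w1 = fps_const fps_X"

definition w2 :: "complex mps fps fps fps" where
  "w2 = fps_X"

definition Delta_z1 :: "complex mps fps \<Rightarrow> complex mps fps fps fps" where
  "Delta_z1 F = fps_const (Delta F)"

definition Delta_z2 :: "complex mps fps \<Rightarrow> complex mps fps fps fps" where
  "Delta_z2 F = Abs_fps (\<lambda>j. fps_const (Delta F $ j))"

definition Delta_z1_z2 :: "complex mps fps \<Rightarrow> complex mps fps fps fps" where
  "Delta_z1_z2 F = Abs_fps (\<lambda>j. Delta (Delta F $ j))"

text \<open>The exponential of a series without constant term in \<open>w\<^sub>2\<close>.\<close>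

definition exp_w :: "complex mps fps fps fps \<Rightarrow> complex mps fps fps fps" where
  "exp_w G = Abs_fps (\<lambda>n. fps_const (hconst (1 / fact n))) oo G"

text \<open>
  The series \<open>Q\<close> is the quotient \<open>(\<Delta>(z\<^sub>1)\<partial>\<^sub>1F - \<Delta>(z\<^sub>2)\<partial>\<^sub>1F) / (z\<^sub>1 - z\<^sub>2)\<close>, where
  \<open>z\<^sub>1 - z\<^sub>2 = (w\<^sub>2 - w\<^sub>1) / (w\<^sub>1 w\<^sub>2)\<close>; it is unique because \<open>w\<^sub>2 - w\<^sub>1\<close> is not a zero divisor.
\<close>

definition full_KP :: "complex mps fps \<Rightarrow> bool" where
  "full_KP F \<longleftrightarrow>
     (\<exists>Q. (w2 - w1) * Q = w1 * w2 * (Delta_z1 (hpdiff 1 F) - Delta_z2 (hpdiff 1 F)) \<and>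
          exp_w (Delta_z1_z2 F) = 1 - Q)"

end

theory Submission
  imports Defs "HOL-Computational_Algebra.Formal_Laurent_Series"
begin

text \<open>
  Put \<open>x(U) = U\<^bsup>-1\<^esup> - \<Sum>\<^sub>k t\<^sub>k U\<^bsup>N+1-k\<^esup>\<close>. The given formula for \<open>v(t)\<close> says that the polynomials
  \<open>\<Phi>\<^sub>a(x) = [U\<^sup>a] 1/(x(U) - x)\<close> are \<open>\<partial>\<Lambda>/\<partial>t\<^sub>a\<close> for \<open>1 \<le> a \<le> N\<close> and \<open>\<partial>\<Lambda>/\<partial>x\<close> for \<open>a = N + 1\<close>, so the third
  derivatives of the potential are the residues at infinity of \<open>\<Phi>\<^sub>\<alpha>\<Phi>\<^sub>\<beta>\<Phi>\<^sub>\<gamma>/\<Phi>\<^bsub>N+1\<^esub>\<close>. They form a closed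
  system because \<open>\<partial>\<Phi>\<^sub>a/\<partial>t\<^sub>\<delta>\<close> is the \<open>x\<close>-derivative of \<open>\<Phi>\<^bsub>a+\<delta>-N-1\<^esub>\<close>, the polynomial part of
  \<open>\<Phi>\<^sub>a\<Phi>\<^sub>\<delta>/\<Phi>\<^bsub>N+1\<^esub>\<close>; hence the potential exists. For \<open>\<alpha> + \<beta> \<le> N + 1\<close> the generating function gives
  \<open>\<partial>\<^sub>\<alpha>\<partial>\<^sub>\<beta>F = [U\<^sup>\<alpha> V\<^sup>\<beta>] log (1 + \<Sum>\<^sub>\<gamma> t\<^bsub>N+1-\<gamma>\<^esub> \<Sum>\<^bsub>i+j=\<gamma>+1\<^esub> U\<^sup>i V\<^sup>j)\<close>, so that
  \<open>R\<^sup>A\<close> is \<open>(-1)\<^bsup>m-1\<^esup>/m\<close> times the number \<open>P_hat\<close>. The first claim is then a rescaling, and the second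
  is the logarithm of the Fay identity, with the same series in \<open>U = z\<^sub>1\<^bsup>-1\<^esup>\<close>, \<open>V = z\<^sub>2\<^bsup>-1\<^esup>\<close>.
\<close>

section \<open>Multivariate series\<close>

text \<open>One kernel runs through everything:
  \<open>K = sum_j s_j sum_(i=1..j) U^i V^(j+1-i)\<close> with \<open>s_j = t_(N+1-j)\<close>, for
  which \<open>x(U) - x(V) = (1/U - 1/V) (1 + K)\<close>. With \<open>Phi_a\<close> for
  \<open>flat_poly s N a\<close>, partial fractions turn the product of \<open>1/(x(U) - x)\<close>
  and \<open>1/(x(V) - x)\<close> into \<open>(1 + K)^(-1)\<close> times the sum of the
  \<open>Phi_(a+b-1) U^a V^b\<close>. Against \<open>Phi_c/Phi_(N+1)\<close> the latter have
  constant residues as long as \<open>a + b <= N + 1\<close>, and what is left is the derivative in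
  \<open>t_c\<close> of \<open>log (1 + K)\<close>. The Fay quotient is \<open>-K\<close> with other
  values in place of the \<open>s_j\<close>.

  The definite description \<open>F_A\<close> gives nothing before existence and uniqueness are
  settled, and its condition is pointwise: at each \<open>t\<close> it speaks of division by the
  derivative of \<open>Lambda\<close> over the complex numbers. So the division by
  \<open>Phi_(N+1)\<close>, which is monic, is carried out over the ring of series in
  \<open>t\<close> and specialised afterwards. Residues at infinity make sense over that ring and
  need neither roots of the derivative of \<open>Lambda\<close> nor generic points.\<close>

lemma mcoeff_sum [simp]: "mcoeff (\<Sum>i\<in>I. F i) \<mu> = (\<Sum>i\<in>I. mcoeff (F i) \<mu>)"
  by (induction I rule: infinite_finite_induct) auto

lemma mcoeff_mps_const [simp]: "mcoeff (mps_const c) \<mu> = (if \<mu> = 0 then c else 0)"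
  by (simp add: mps_const_def)

lemma mcoeff_const_mult [simp]:
  "mcoeff (mps_const c * F) \<mu> = c * mcoeff F \<mu>" for c :: "'a::comm_ring_1"
proof -
  have "mcoeff (mps_const c * F) \<mu> = (\<Sum>(a, b) \<in> {(0, \<mu>)}. mcoeff (mps_const c) a * mcoeff F b)"
    unfolding mcoeff_mult
    by (rule sum.mono_neutral_right) (auto simp: finite_add_decomp split: if_splits)
  then show ?thesis
    by simp
qed

lemma mps_const_simps:
  fixes a b :: "'a::comm_ring_1"
  shows "mps_const 0 = (0 :: 'a mps)" "mps_const 1 = (1 :: 'a mps)"
    "mps_const a * mps_const b = mps_const (a * b)" "mps_const a + mps_const b = mps_const (a + b)"
    "mps_const (- a) = - mps_const a" "mps_const (of_nat n) = (of_nat n :: 'a mps)"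
proof -
  have add: "mps_const a + mps_const b = mps_const (a + b)" for a b :: 'a
    by (rule mps_eqI) simp
  show one: "mps_const 1 = (1 :: 'a mps)" "mps_const 0 = (0 :: 'a mps)"
    by (rule mps_eqI, simp)+
  show "mps_const (of_nat n) = (of_nat n :: 'a mps)"
    by (induction n) (simp_all add: one flip: add)
qed (rule mps_eqI, simp)+

lemma mcoeff_mult_0 [simp]: "mcoeff (F * G) 0 = mcoeff F 0 * mcoeff G 0"
proof -
  have "{(a, b). a + b = (0 :: nat \<Rightarrow>\<^sub>0 nat)} = {(0, 0)}"
    by (auto simp: poly_mapping_eq_iff fun_eq_iff lookup_add)
  then show ?thesis
    by (simp add: mcoeff_mult)
qed

lemma single_add_diff:
  fixes \<mu> :: "nat \<Rightarrow>\<^sub>0 nat"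
  assumes "lookup \<mu> i > 0"
  shows "\<mu> - Poly_Mapping.single i 1 + Poly_Mapping.single i 1 = \<mu>"
  by (rule poly_mapping_eqI) (use assms in \<open>auto simp: lookup_add lookup_minus lookup_single when_def\<close>)

text \<open>Reindexing behind the Leibniz rule: once the summand carries the exponent of variable
  \<open>i\<close> in \<open>a\<close> as a factor, pairs without that variable drop out, and the
  others are shifts by one.\<close>

lemma sum_decomp_shift:
  fixes f :: "(nat \<Rightarrow>\<^sub>0 nat) \<Rightarrow> (nat \<Rightarrow>\<^sub>0 nat) \<Rightarrow> 'a::comm_monoid_add"
  assumes "\<And>a b. lookup a i = 0 \<Longrightarrow> f a b = 0"
  shows "(\<Sum>(a, b) \<in> {(a, b). a + b = \<mu> + Poly_Mapping.single i 1}. f a b)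
       = (\<Sum>(a, b) \<in> {(a, b). a + b = \<mu>}. f (a + Poly_Mapping.single i 1) b)"
proof -
  let ?e = "Poly_Mapping.single i (1::nat)"
  have "(\<Sum>(a, b) \<in> {(a, b). a + b = \<mu> + ?e}. f a b)
      = (\<Sum>(a, b) \<in> {(a, b). a + b = \<mu> + ?e \<and> lookup a i > 0}. f a b)"
    by (rule sum.mono_neutral_right) (use assms finite_add_decomp in auto)
  also have "\<dots> = (\<Sum>(a, b) \<in> {(a, b). a + b = \<mu>}. f (a + ?e) b)"
  proof (rule sum.reindex_bij_witness[where i = "\<lambda>(a, b). (a + ?e, b)" and j = "\<lambda>(a, b). (a - ?e, b)"])
    fix p assume "p \<in> {(a, b). a + b = \<mu> + ?e \<and> 0 < lookup a i}"
    then obtain a b where p: "p = (a, b)" "a + b = \<mu> + ?e" "0 < lookup a i"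
      by auto
    have a: "a - ?e + ?e = a"
      by (rule single_add_diff[OF p(3)])
    then have "a - ?e + b + ?e = \<mu> + ?e"
      using p(2) by (metis add.assoc add.commute)
    then show "(case p of (a, b) \<Rightarrow> (a - ?e, b)) \<in> {(a, b). a + b = \<mu>}"
      by (simp add: p)
    show "(case case p of (a, b) \<Rightarrow> (a - ?e, b) of (a, b) \<Rightarrow> (a + ?e, b)) = p"
      using a by (simp add: p)
    show "(case case p of (a, b) \<Rightarrow> (a - ?e, b) of (a, b) \<Rightarrow> f (a + ?e) b) = (case p of (a, b) \<Rightarrow> f a b)"
      using a by (simp add: p)
  qed (auto simp: lookup_add ac_simps)
  finally show ?thesis .
qed

lemma sum_decomp_swap:
  fixes f :: "(nat \<Rightarrow>\<^sub>0 nat) \<Rightarrow> (nat \<Rightarrow>\<^sub>0 nat) \<Rightarrow> 'a::comm_monoid_add"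
  shows "(\<Sum>(a, b) \<in> {(a, b). a + b = \<mu>}. f a b) = (\<Sum>(a, b) \<in> {(a, b). a + b = \<mu>}. f b a)"
  by (rule sum.reindex_bij_witness[where i = prod.swap and j = prod.swap]) (auto simp: ac_simps)

lemma mcoeff_pdiff: "mcoeff (pdiff k F) \<mu>
    = of_nat (lookup \<mu> (k - 1) + 1) * mcoeff F (\<mu> + Poly_Mapping.single (k - 1) 1)"
  by (simp add: pdiff_def)

lemma pdiff_simps [simp]:
  fixes F G :: "'a::comm_ring_1 mps"
  shows "pdiff k 0 = (0 :: 'a mps)" "pdiff k 1 = (0 :: 'a mps)"
    "pdiff k (F + G) = pdiff k F + pdiff k G" "pdiff k (F - G) = pdiff k F - pdiff k G"
    "pdiff k (- F) = - pdiff k F" "pdiff k (mps_const c) = (0 :: 'a mps)"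
proof -
  have "\<mu> + Poly_Mapping.single (k - 1) (1::nat) \<noteq> 0" for \<mu>
    by (metis add_is_0 lookup_add lookup_single_eq lookup_zero zero_neq_one)
  then show "pdiff k 1 = (0 :: 'a mps)" "pdiff k (mps_const c) = (0 :: 'a mps)"
    by (auto intro!: mps_eqI simp: mcoeff_pdiff)
qed (rule mps_eqI, simp add: mcoeff_pdiff algebra_simps)+

lemma pdiff_sum: "pdiff k (\<Sum>i\<in>I. F i) = (\<Sum>i\<in>I. pdiff k (F i))"
  by (induction I rule: infinite_finite_induct) auto

lemma pdiff_mult [simp]: "pdiff k (F * G) = pdiff k F * G + F * pdiff k G"
proof (rule mps_eqI)
  fix \<mu> :: "nat \<Rightarrow>\<^sub>0 nat"
  let ?e = "Poly_Mapping.single (k - 1) (1::nat)"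
  let ?D = "{(a, b). a + b = \<mu> + ?e}"
  have "mcoeff (pdiff k (F * G)) \<mu>
      = (\<Sum>(a, b) \<in> ?D. of_nat (lookup \<mu> (k - 1) + 1) * (mcoeff F a * mcoeff G b))"
    by (simp add: mcoeff_pdiff mcoeff_mult sum_distrib_left case_prod_beta)
  \<comment> \<open>The exponent in the product monomial is the sum of the exponents in
    \<open>a\<close> and \<open>b\<close>, which separates the two Leibniz terms.\<close>
  also have "\<dots> = (\<Sum>(a, b) \<in> ?D. of_nat (lookup a (k - 1)) * (mcoeff F a * mcoeff G b)
      + of_nat (lookup b (k - 1)) * (mcoeff F a * mcoeff G b))"
  proof (rule sum.cong[OF refl], clarify)
    fix a b assume "a + b = \<mu> + ?e"
    then have "lookup a (k - 1) + lookup b (k - 1) = lookup \<mu> (k - 1) + 1"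
      by (metis lookup_add lookup_single_eq)
    then show "of_nat (lookup \<mu> (k - 1) + 1) * (mcoeff F a * mcoeff G b)
        = of_nat (lookup a (k - 1)) * (mcoeff F a * mcoeff G b)
          + of_nat (lookup b (k - 1)) * (mcoeff F a * mcoeff G b)"
      by (metis distrib_right of_nat_add)
  qed
  also have "\<dots> = (\<Sum>(a, b) \<in> ?D. of_nat (lookup a (k - 1)) * (mcoeff F a * mcoeff G b))
      + (\<Sum>(a, b) \<in> ?D. of_nat (lookup b (k - 1)) * (mcoeff F a * mcoeff G b))"
    by (simp add: case_prod_beta sum.distrib)
  also have "(\<Sum>(a, b) \<in> ?D. of_nat (lookup a (k - 1)) * (mcoeff F a * mcoeff G b))
      = mcoeff (pdiff k F * G) \<mu>"
    by (subst sum_decomp_shift) (auto simp: mcoeff_mult mcoeff_pdiff lookup_add mult.assoc)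
  also have "(\<Sum>(a, b) \<in> ?D. of_nat (lookup b (k - 1)) * (mcoeff F a * mcoeff G b))
      = (\<Sum>(a, b) \<in> ?D. of_nat (lookup a (k - 1)) * (mcoeff G a * mcoeff F b))"
    by (subst sum_decomp_swap) (simp add: mult.commute mult.left_commute)
  also have "\<dots> = mcoeff (pdiff k G * F) \<mu>"
    by (subst sum_decomp_shift) (auto simp: mcoeff_mult mcoeff_pdiff lookup_add mult.assoc)
  finally show "mcoeff (pdiff k (F * G)) \<mu> = mcoeff (pdiff k F * G + F * pdiff k G) \<mu>"
    by (simp add: mult.commute)
qed

lemma pdiff_commute: "pdiff j (pdiff k F) = pdiff k (pdiff j F)"
  by (rule mps_eqI) (auto simp: mcoeff_pdiff lookup_add lookup_single when_def algebra_simps)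

definition mvar :: "nat \<Rightarrow> 'a::comm_ring_1 mps" where
  "mvar k = Abs_mps (\<lambda>\<mu>. if \<mu> = Poly_Mapping.single (k - 1) 1 then 1 else 0)"

lemma mcoeff_mvar_mult:
  "mcoeff (mvar k * F) \<mu>
    = (if lookup \<mu> (k - 1) > 0 then mcoeff F (\<mu> - Poly_Mapping.single (k - 1) 1) else 0)"
proof -
  let ?e = "Poly_Mapping.single (k - 1) (1::nat)"
  have "mcoeff (mvar k * F) \<mu>
      = (\<Sum>(a, b) \<in> {(a, b). a + b = \<mu> \<and> a = ?e}. mcoeff F b)"
    unfolding mcoeff_mult
    by (rule sum.mono_neutral_cong_right) (auto simp: finite_add_decomp mvar_def split: if_splits)
  also have "{(a, b). a + b = \<mu> \<and> a = ?e} = (if lookup \<mu> (k - 1) > 0 then {(?e, \<mu> - ?e)} else {})"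
    using single_add_diff[of \<mu> "k - 1"] by (auto simp: lookup_add ac_simps)
  finally show ?thesis
    by (simp split: if_splits)
qed

lemma pdiff_mvar:
  assumes "j \<ge> 1" "k \<ge> 1"
  shows "pdiff j (mvar k) = (if j = k then 1 else 0)"
proof (rule mps_eqI)
  fix \<mu> :: "nat \<Rightarrow>\<^sub>0 nat"
  have "\<mu> + Poly_Mapping.single (j - 1) 1 = Poly_Mapping.single (k - 1) 1 \<longleftrightarrow> j = k \<and> \<mu> = 0"
  proof
    assume *: "\<mu> + Poly_Mapping.single (j - 1) 1 = Poly_Mapping.single (k - 1) 1"
    then have "lookup (\<mu> + Poly_Mapping.single (j - 1) 1) (j - 1) = lookup (Poly_Mapping.single (k - 1) 1) (j - 1)"
      by simp
    then have "j = k"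
      using assms by (auto simp: lookup_add lookup_single when_def split: if_splits)
    with * show "j = k \<and> \<mu> = 0"
      by (metis add_0 add_right_imp_eq)
  qed auto
  then show "mcoeff (pdiff j (mvar k)) \<mu> = mcoeff (if j = k then 1 else 0) \<mu>"
    by (auto simp: mcoeff_pdiff mvar_def)
qed

lemma mcoeff_mvar_0 [simp]: "mcoeff (mvar k) 0 = 0"
  by (auto simp: mvar_def poly_mapping_eq_iff fun_eq_iff lookup_single when_def)

section \<open>Values of polynomials\<close>

definition monom_value :: "(nat \<Rightarrow> 'a::comm_ring_1) \<Rightarrow> (nat \<Rightarrow>\<^sub>0 nat) \<Rightarrow> 'a" where
  "monom_value t \<mu> = (\<Prod>i\<in>keys \<mu>. t (i + 1) ^ lookup \<mu> i)"

lemma monom_value_superset: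
  assumes "finite I" "keys \<mu> \<subseteq> I"
  shows "monom_value t \<mu> = (\<Prod>i\<in>I. t (i + 1) ^ lookup \<mu> i)"
  unfolding monom_value_def
  by (rule prod.mono_neutral_left) (use assms in \<open>auto simp: in_keys_iff\<close>)

lemma monom_value_add: "monom_value t (\<mu> + \<nu>) = monom_value t \<mu> * monom_value t \<nu>"
proof -
  let ?I = "keys \<mu> \<union> keys \<nu>"
  have "keys (\<mu> + \<nu>) \<subseteq> ?I"
    by (rule keys_add)
  then show ?thesis
    by (simp add: monom_value_superset[of ?I] lookup_add power_add prod.distrib)
qed

lemma monom_value_0 [simp]: "monom_value t 0 = 1"
  by (simp add: monom_value_def)

lemma poly_value_superset:
  assumes "finite A" "\<And>\<mu>. mcoeff F \<mu> \<noteq> 0 \<Longrightarrow> \<mu> \<in> A"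
  shows "poly_value F t = (\<Sum>\<mu>\<in>A. mcoeff F \<mu> * monom_value t \<mu>)"
  unfolding poly_value_def monom_value_def
  by (rule sum.mono_neutral_left) (use assms in auto)

lemma is_polynomialD: "is_polynomial N F \<Longrightarrow> finite {\<mu>. mcoeff F \<mu> \<noteq> 0}"
  by (simp add: is_polynomial_def)

lemma is_polynomial_0 [simp]: "is_polynomial N 0"
  by (simp add: is_polynomial_def)

lemma is_polynomial_const [simp]: "is_polynomial N (mps_const c)"
  by (auto simp: is_polynomial_def split: if_splits)

lemma is_polynomial_1 [simp]: "is_polynomial N 1"
  by (metis is_polynomial_const mps_const_simps(2))

lemma is_polynomial_mvar:
  assumes "1 \<le> k" "k \<le> N"
  shows "is_polynomial N (mvar k :: 'a::comm_ring_1 mps)"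
  using assms by (auto simp: is_polynomial_def mvar_def split: if_splits)

lemma is_polynomial_add [intro]:
  assumes "is_polynomial N F" "is_polynomial N (G :: 'a::comm_ring_1 mps)"
  shows "is_polynomial N (F + G)"
proof -
  have *: "mcoeff F \<mu> \<noteq> 0 \<or> mcoeff G \<mu> \<noteq> 0" if "mcoeff F \<mu> + mcoeff G \<mu> \<noteq> 0" for \<mu>
    using that by auto
  have "finite ({\<mu>. mcoeff F \<mu> \<noteq> 0} \<union> {\<mu>. mcoeff G \<mu> \<noteq> 0})"
    using assms by (simp add: is_polynomial_def)
  then have "finite {\<mu>. mcoeff (F + G) \<mu> \<noteq> 0}"
    by (rule rev_finite_subset) (use * in auto)
  then show ?thesis
    using assms * by (fastforce simp: is_polynomial_def)
qed

lemma is_polynomial_uminus [intro]: "is_polynomial N F \<Longrightarrow> is_polynomial N (- F :: 'a::comm_ring_1 mps)"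
  by (auto simp: is_polynomial_def)

lemma is_polynomial_diff [intro]:
  "is_polynomial N F \<Longrightarrow> is_polynomial N G \<Longrightarrow> is_polynomial N (F - G :: 'a::comm_ring_1 mps)"
  using is_polynomial_add[of N F "- G"] is_polynomial_uminus[of N G] by simp

lemma is_polynomial_sum [intro]:
  "(\<And>i. i \<in> I \<Longrightarrow> is_polynomial N (F i)) \<Longrightarrow> is_polynomial N (\<Sum>i\<in>I. F i :: 'a::comm_ring_1 mps)"
  by (induction I rule: infinite_finite_induct) auto

lemma mult_nonzero_decomp:
  assumes "mcoeff (F * G) \<mu> \<noteq> 0"
  shows "\<exists>a b. \<mu> = a + b \<and> mcoeff F a \<noteq> 0 \<and> mcoeff G b \<noteq> 0"
proof (rule ccontr)
  assume "\<not> ?thesis"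
  then have "mcoeff F a * mcoeff G b = 0" if "a + b = \<mu>" for a b
    using that by (metis mult_zero_left mult_zero_right)
  then have "mcoeff (F * G) \<mu> = 0"
    unfolding mcoeff_mult by (intro sum.neutral) auto
  with assms show False by simp
qed

lemma is_polynomial_mult [intro]:
  assumes "is_polynomial N F" "is_polynomial N (G :: 'a::comm_ring_1 mps)"
  shows "is_polynomial N (F * G)"
proof -
  have "finite ((\<lambda>(a, b). a + b) ` ({\<mu>. mcoeff F \<mu> \<noteq> 0} \<times> {\<mu>. mcoeff G \<mu> \<noteq> 0}))"
    using assms by (simp add: is_polynomial_def)
  then have "finite {\<mu>. mcoeff (F * G) \<mu> \<noteq> 0}"
    by (rule rev_finite_subset) (use mult_nonzero_decomp in fastforce)
  moreover have "keys \<mu> \<subseteq> {..<N}" if "mcoeff (F * G) \<mu> \<noteq> 0" for \<mu>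
    using mult_nonzero_decomp[OF that] assms keys_add by (fastforce simp: is_polynomial_def)
  ultimately show ?thesis
    by (simp add: is_polynomial_def)
qed

lemma keys_add_single: "keys (\<mu> + Poly_Mapping.single i (1::nat)) = insert i (keys \<mu>)"
  by (auto simp: in_keys_iff lookup_add lookup_single when_def split: if_splits)

lemma is_polynomial_pdiff [intro]:
  assumes "is_polynomial N F"
  shows "is_polynomial N (pdiff k F)"
proof -
  let ?e = "Poly_Mapping.single (k - 1) (1::nat)"
  have nz: "mcoeff F (\<mu> + ?e) \<noteq> 0" if "mcoeff (pdiff k F) \<mu> \<noteq> 0" for \<mu>
    using that by (auto simp: mcoeff_pdiff)
  have "finite ((\<lambda>\<mu>. \<mu> + ?e) -` {\<mu>. mcoeff F \<mu> \<noteq> 0})"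
    by (rule finite_vimageI) (use assms in \<open>auto simp: is_polynomial_def inj_def\<close>)
  then have "finite {\<mu>. mcoeff (pdiff k F) \<mu> \<noteq> 0}"
    by (rule rev_finite_subset) (use nz in auto)
  moreover have "keys \<mu> \<subseteq> {..<N}" if "mcoeff (pdiff k F) \<mu> \<noteq> 0" for \<mu>
    using nz[OF that] assms keys_add_single[of \<mu> "k - 1"] unfolding is_polynomial_def by blast
  ultimately show ?thesis
    by (simp add: is_polynomial_def)
qed

lemma poly_value_const [simp]: "poly_value (mps_const c) t = c"
  by (subst poly_value_superset[of "{0}"]) (auto split: if_splits)

lemma poly_value_0 [simp]: "poly_value 0 t = 0"
  by (simp add: poly_value_def)

lemma poly_value_1 [simp]: "poly_value 1 t = 1"
  by (metis poly_value_const mps_const_simps(2))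

lemma poly_value_add:
  assumes "is_polynomial N F" "is_polynomial N G"
  shows "poly_value (F + G) t = poly_value F t + poly_value G t"
proof -
  let ?A = "{\<mu>. mcoeff F \<mu> \<noteq> 0} \<union> {\<mu>. mcoeff G \<mu> \<noteq> 0}"
  have "finite ?A"
    using assms by (simp add: is_polynomial_def)
  moreover have "\<mu> \<in> ?A" if "mcoeff (F + G) \<mu> \<noteq> 0" for \<mu>
    using that by auto
  ultimately show ?thesis
    by (subst (1 2 3) poly_value_superset[of ?A]) (auto simp: algebra_simps simp flip: sum.distrib)
qed

lemma poly_value_mult:
  assumes "is_polynomial N F" "is_polynomial N G"
  shows "poly_value (F * G) t = poly_value F t * poly_value G t"
proof -
  let ?A = "{\<mu>. mcoeff F \<mu> \<noteq> 0}" and ?B = "{\<mu>. mcoeff G \<mu> \<noteq> 0}"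
  let ?C = "(\<lambda>(a, b). a + b) ` (?A \<times> ?B)"
  have fin: "finite ?A" "finite ?B"
    using assms by (auto simp: is_polynomial_def)
  then have finC: "finite ?C"
    by simp
  have "poly_value (F * G) t = (\<Sum>\<mu>\<in>?C. mcoeff (F * G) \<mu> * monom_value t \<mu>)"
    by (rule poly_value_superset[OF finC]) (use mult_nonzero_decomp in fastforce)
  also have "\<dots> = (\<Sum>\<mu>\<in>?C. \<Sum>(a, b)\<in>{p \<in> ?A \<times> ?B. fst p + snd p = \<mu>}.
      mcoeff F a * monom_value t a * (mcoeff G b * monom_value t b))"
  proof (rule sum.cong[OF refl])
    fix \<mu> assume "\<mu> \<in> ?C"
    have "mcoeff (F * G) \<mu> * monom_value t \<mu>
        = (\<Sum>(a, b) \<in> {(a, b). a + b = \<mu>}. mcoeff F a * mcoeff G b * monom_value t \<mu>)"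
      by (simp add: mcoeff_mult sum_distrib_right case_prod_beta)
    also have "\<dots> = (\<Sum>(a, b)\<in>{p \<in> ?A \<times> ?B. fst p + snd p = \<mu>}. mcoeff F a * mcoeff G b * monom_value t \<mu>)"
      by (rule sum.mono_neutral_right) (auto simp: finite_add_decomp)
    also have "\<dots> = (\<Sum>(a, b)\<in>{p \<in> ?A \<times> ?B. fst p + snd p = \<mu>}.
        mcoeff F a * monom_value t a * (mcoeff G b * monom_value t b))"
      by (rule sum.cong) (auto simp: monom_value_add algebra_simps)
    finally show "mcoeff (F * G) \<mu> * monom_value t \<mu> = \<dots>" .
  qed
  also have "\<dots> = (\<Sum>(a, b)\<in>?A \<times> ?B. mcoeff F a * monom_value t a * (mcoeff G b * monom_value t b))"
    by (rule sum.group) (use fin in auto)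
  also have "\<dots> = poly_value F t * poly_value G t"
    by (simp add: poly_value_superset[of ?A F] poly_value_superset[of ?B G] fin sum_product sum.cartesian_product)
  finally show ?thesis .
qed

lemma poly_value_sum:
  "(\<And>i. i \<in> I \<Longrightarrow> is_polynomial N (F i)) \<Longrightarrow> poly_value (\<Sum>i\<in>I. F i) t = (\<Sum>i\<in>I. poly_value (F i) t)"
proof (induction I rule: infinite_finite_induct)
  case (insert i I)
  then have "poly_value (F i + (\<Sum>i\<in>I. F i)) t = poly_value (F i) t + poly_value (\<Sum>i\<in>I. F i) t"
    by (intro poly_value_add[of N]) auto
  with insert show ?case by simp
qed auto

text \<open>Distinct monomials are distinct characters of the multiplicative monoid of points, hence
  linearly independent.\<close>

lemma monomials_independent:
  assumes "finite A" "\<And>t. (\<Sum>\<mu>\<in>A. c \<mu> * monom_value t \<mu>) = 0" "\<mu> \<in> A"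
  shows "c \<mu> = (0 :: complex)"
  using assms
proof (induction A arbitrary: c \<mu> rule: finite_induct)
  case (insert \<nu> A)
  have mult: "monom_value (\<lambda>i. u i * t i) \<mu> = monom_value u \<mu> * monom_value t \<mu>" for u t :: "nat \<Rightarrow> complex" and \<mu>
    by (simp add: monom_value_def power_mult_distrib prod.distrib)
  have "c \<mu>' * (monom_value u \<mu>' - monom_value u \<nu>) = 0" if "\<mu>' \<in> A" for \<mu>' u
  proof (rule insert.IH[of "\<lambda>\<mu>. c \<mu> * (monom_value u \<mu> - monom_value u \<nu>)", OF _ that])
    fix t :: "nat \<Rightarrow> complex"
    \<comment> \<open>The relation at the point \<open>u t\<close> minus
      \<open>monom_value u \<nu>\<close> times the relation at \<open>t\<close>: this eliminates the
      term of \<nu>.\<close>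
    have "0 = (\<Sum>\<mu>\<in>insert \<nu> A. c \<mu> * monom_value (\<lambda>i. u i * t i) \<mu>)
        - monom_value u \<nu> * (\<Sum>\<mu>\<in>insert \<nu> A. c \<mu> * monom_value t \<mu>)"
      using insert.prems by simp
    also have "\<dots> = (\<Sum>\<mu>\<in>A. c \<mu> * (monom_value u \<mu> - monom_value u \<nu>) * monom_value t \<mu>)"
      using insert.hyps
      by (simp add: mult sum_distrib_left algebra_simps sum_subtractf)
    finally show "(\<Sum>\<mu>\<in>A. c \<mu> * (monom_value u \<mu> - monom_value u \<nu>) * monom_value t \<mu>) = 0"
      by simp
  qed
  moreover have "\<exists>u :: nat \<Rightarrow> complex. monom_value u \<mu>' \<noteq> monom_value u \<nu>" if "\<mu>' \<in> A" for \<mu>'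
  proof -
    have "\<mu>' \<noteq> \<nu>"
      using that insert.hyps by auto
    then obtain i where i: "lookup \<mu>' i \<noteq> lookup \<nu> i"
      by (meson poly_mapping_eqI)
    \<comment> \<open>A point with value 2 in one variable and 1 elsewhere reads off the exponent of
      that variable.\<close>
    have two: "monom_value (\<lambda>j. if j = i + 1 then 2 else 1) \<mu> = (2::complex) ^ lookup \<mu> i" for \<mu>
    proof -
      let ?I = "insert i (keys \<mu>)"
      have "monom_value (\<lambda>j. if j = i + 1 then 2 else 1) \<mu>
          = (\<Prod>j\<in>?I. if j = i then (2::complex) ^ lookup \<mu> i else 1)"
        unfolding monom_value_superset[OF finite.insertI[OF finite_keys] subset_insertI[of "keys \<mu>" i]]
        by (rule prod.cong) auto
      then show ?thesis
        by (simp add: prod.delta)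
    qed
    then have "monom_value (\<lambda>j. if j = i + 1 then 2 else 1 :: complex) \<mu>' \<noteq> monom_value (\<lambda>j. if j = i + 1 then 2 else 1) \<nu>"
    proof -
      have "(2::complex) ^ m = 2 ^ n \<Longrightarrow> m = n" for m n :: nat
        by (metis norm_numeral norm_power one_less_numeral_iff power_inject_exp semiring_norm(76))
      then show ?thesis
        using i two by metis
    qed
    then show ?thesis by blast
  qed
  ultimately have A: "c \<mu>' = 0" if "\<mu>' \<in> A" for \<mu>'
    using that by (metis mult_eq_0_iff right_minus_eq)
  have "monom_value (\<lambda>_. 1) \<nu> = (1 :: complex)"
    by (simp add: monom_value_def)
  moreover have "(\<Sum>\<mu>\<in>A. c \<mu> * monom_value (\<lambda>_. 1) \<mu>) = 0"
    using A by (intro sum.neutral) auto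
  ultimately have "c \<nu> = 0"
    using insert.prems(1)[of "\<lambda>_. 1"] insert.hyps by simp
  with A insert.prems show ?case by auto
qed simp

text \<open>The Frobenius structure prescribes the third derivatives of the potential only by their
  values at points; this lifts them to polynomials.\<close>

lemma polynomial_eqI:
  fixes F G :: "complex mps"
  assumes "is_polynomial N F" "is_polynomial N G" "\<And>t. poly_value F t = poly_value G t"
  shows "F = G"
proof (rule mps_eqI)
  fix \<mu>
  let ?A = "{\<mu>. mcoeff F \<mu> \<noteq> 0} \<union> {\<mu>. mcoeff G \<mu> \<noteq> 0}"
  have fin: "finite ?A"
    using assms by (simp add: is_polynomial_def)
  have "(\<Sum>\<mu>\<in>?A. (mcoeff F \<mu> - mcoeff G \<mu>) * monom_value t \<mu>) = 0" for t
    using assms(3)[of t] poly_value_superset[OF fin, of F t] poly_value_superset[OF fin, of G t]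
    by (simp add: algebra_simps sum_subtractf)
  from monomials_independent[OF fin this, of \<mu>] show "mcoeff F \<mu> = mcoeff G \<mu>"
    by (cases "\<mu> \<in> ?A") auto
qed

section \<open>The polynomials of the flat frame\<close>

context
  fixes s :: "nat \<Rightarrow> 'a::comm_ring_1" and N :: nat
begin

text \<open>The recurrence compares powers of \<open>U\<close> in
  \<open>(x(U) - x) * sum_a Phi_a U^a = 1\<close>. Truncated subtraction sends negative indices to
  0, where the value 0 is the correct one, since the expansion starts with \<open>U\<close>.\<close>

fun flat_poly :: "nat \<Rightarrow> 'a poly" where
  "flat_poly 0 = 0"
| "flat_poly (Suc 0) = 1"
| "flat_poly (Suc (Suc a)) = pCons 0 (flat_poly (Suc a)) + (\<Sum>j = 1..N. smult (s j) (flat_poly (Suc a - j)))"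

fun flat_prod_top :: "nat \<Rightarrow> 'a poly" where
  "flat_prod_top 0 = 0"
| "flat_prod_top (Suc 0) = 0"
| "flat_prod_top (Suc (Suc m)) =
     flat_poly (Suc m) - (\<Sum>j = 1..N. smult (of_nat j * s j) (flat_prod_top (Suc m - j)))"

lemma flat_poly_Suc:
  "a \<ge> 1 \<Longrightarrow> flat_poly (Suc a) = pCons 0 (flat_poly a) + (\<Sum>j = 1..N. smult (s j) (flat_poly (a - j)))"
  by (cases a) auto

lemma coeff_flat_poly_ge: "n \<ge> a \<Longrightarrow> coeff (flat_poly a) n = 0"
proof (induction a arbitrary: n rule: less_induct)
  case (less a)
  show ?case
  proof (cases a rule: flat_poly.cases)
    case (3 m)
    have "coeff (flat_poly (Suc m - j)) n = 0" for j
      by (rule less.IH) (use less.prems 3 in auto)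
    then show ?thesis
      using less 3 by (auto simp: coeff_sum coeff_pCons split: nat.split)
  qed (use less.prems in auto)
qed

lemma coeff_flat_poly_top: "coeff (flat_poly (Suc a)) a = 1"
proof (induction a)
  case (Suc a)
  have "coeff (flat_poly (Suc a - j)) (Suc a) = 0" for j
    by (rule coeff_flat_poly_ge) simp
  with Suc show ?case
    by (simp add: coeff_sum)
qed simp

text \<open>The coefficient of \<open>U^a V^b\<close> in
  \<open>(1 + K) / ((x(U) - x) (x(V) - x)) = sum Phi_(a+b-1) U^a V^b\<close>. The induction moves
  one factor \<open>x\<close> from the first polynomial to the second.\<close>

lemma flat_poly_mult:
  assumes "a \<ge> 1" "b \<ge> 1"
  shows "flat_poly a * flat_poly b = flat_poly (a + b - 1)
    - (\<Sum>j = 1..N. smult (s j) (\<Sum>i = 1..j. flat_poly (a - i) * flat_poly (b - (j + 1 - i))))"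
  using assms
proof (induction a arbitrary: b rule: nat_induct_at_least)
  case base
  have "flat_poly (1 - i) = 0" if "i \<ge> 1" for i
    using that by (metis diff_is_0_eq flat_poly.simps(1))
  then have "flat_poly (1 - i) * p = 0" if "i \<in> {1..j}" for i j p
    using that by simp
  then show ?case
    by simp
next
  case (Suc a)
  let ?P = flat_poly
  \<comment> \<open>Shifting \<open>i\<close> turns the sum for \<open>(a + 1, b)\<close> into the
    sum for \<open>(a, b + 1)\<close> up to the end terms \<open>i = 0\<close> and
    \<open>i = j\<close>. These cancel the corrections that the recurrences of
    \<open>Phi_(a+1)\<close> and \<open>Phi_(b+1)\<close> produce.\<close>
  have inner: "(\<Sum>i = 1..j. ?P (Suc a - i) * ?P (b - (j + 1 - i)))
      = (\<Sum>i = 1..j. ?P (a - i) * ?P (Suc b - (j + 1 - i))) + ?P a * ?P (b - j) - ?P (a - j) * ?P b"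
    if "j \<ge> 1" for j
  proof -
    let ?f = "\<lambda>i. ?P (a - i) * ?P (Suc b - (j + 1 - i))"
    have 1: "(\<Sum>i = 1..j. ?P (Suc a - i) * ?P (b - (j + 1 - i))) = (\<Sum>i = 0..<j. ?f i)"
      by (rule sum.reindex_bij_witness[where i = Suc and j = "\<lambda>i. i - 1"])
         (auto simp: Suc_diff_le intro!: arg_cong[where f = ?P] arg_cong2[where f = "(*)"])
    have "(\<Sum>i = 0..<j. ?f i) + ?f j = (\<Sum>i = 0..j. ?f i)"
      by (simp only: sum.atLeast0_lessThan_Suc flip: atLeastLessThanSuc_atLeastAtMost)
    moreover have "(\<Sum>i = 0..j. ?f i) = ?f 0 + (\<Sum>i = 1..j. ?f i)"
      by (subst sum.atLeast_Suc_atMost) (simp_all only: le0 One_nat_def)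
    ultimately have "(\<Sum>i = 1..j. ?P (Suc a - i) * ?P (b - (j + 1 - i))) + ?f j = ?f 0 + (\<Sum>i = 1..j. ?f i)"
      unfolding 1 by (rule trans)
    then have *: "(\<Sum>i = 1..j. ?P (Suc a - i) * ?P (b - (j + 1 - i))) = (\<Sum>i = 1..j. ?f i) + ?f 0 - ?f j"
      by (simp only: eq_diff_eq add.commute)
    have "?f j = ?P (a - j) * ?P b" "?f 0 = ?P a * ?P (b - j)"
      by simp_all
    then show ?thesis
      unfolding * by (simp only:)
  qed
  have b: "pCons 0 (?P b) = ?P (Suc b) - (\<Sum>j = 1..N. smult (s j) (?P (b - j)))"
    by (simp only: flat_poly_Suc[OF Suc.prems] add_diff_cancel_right')
  have "?P (Suc a) * ?P b = ?P a * pCons 0 (?P b) + (\<Sum>j = 1..N. smult (s j) (?P (a - j) * ?P b))"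
    by (simp add: flat_poly_Suc[OF Suc.hyps] distrib_right sum_distrib_right)
  also have "\<dots> = ?P a * ?P (Suc b)
      + (\<Sum>j = 1..N. smult (s j) (?P (a - j) * ?P b - ?P a * ?P (b - j)))"
    unfolding b
    by (simp only: right_diff_distrib sum_distrib_left smult_diff_right sum_subtractf mult_smult_right) simp
  also have "\<dots> = ?P (a + Suc b - 1) - (\<Sum>j = 1..N. smult (s j)
          ((\<Sum>i = 1..j. ?P (a - i) * ?P (Suc b - (j + 1 - i))) - (?P (a - j) * ?P b - ?P a * ?P (b - j))))"
    unfolding Suc.IH[OF le_SucI[OF Suc.prems]] smult_diff_right sum_subtractf by simp
  also have "(\<Sum>j = 1..N. smult (s j)
          ((\<Sum>i = 1..j. ?P (a - i) * ?P (Suc b - (j + 1 - i))) - (?P (a - j) * ?P b - ?P a * ?P (b - j))))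
      = (\<Sum>j = 1..N. smult (s j) (\<Sum>i = 1..j. ?P (Suc a - i) * ?P (b - (j + 1 - i))))"
  proof (rule sum.cong[OF refl])
    fix j assume "j \<in> {1..N}"
    then have "j \<ge> 1"
      by simp
    show "smult (s j) ((\<Sum>i = 1..j. ?P (a - i) * ?P (Suc b - (j + 1 - i))) - (?P (a - j) * ?P b - ?P a * ?P (b - j)))
        = smult (s j) (\<Sum>i = 1..j. ?P (Suc a - i) * ?P (b - (j + 1 - i)))"
      unfolding inner[OF \<open>j \<ge> 1\<close>] by (simp only: diff_diff_eq2 diff_add_eq)
  qed
  finally show ?case
    by (simp only: add_Suc_right add_Suc)
qed

lemma coeff_flat_prod_top_ge: "n + 2 > m \<Longrightarrow> coeff (flat_prod_top m) n = 0"
proof (induction m arbitrary: n rule: less_induct)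
  case (less m)
  show ?case
  proof (cases m rule: flat_prod_top.cases)
    case (3 k)
    have "coeff (flat_prod_top (Suc k - j)) n = 0" for j
      by (rule less.IH) (use less.prems 3 in auto)
    then show ?thesis
      using less 3 by (auto simp: coeff_sum coeff_flat_poly_ge)
  qed auto
qed

lemma coeff_flat_prod_top_top: "coeff (flat_prod_top (Suc (Suc m))) m = 1"
proof -
  have "coeff (flat_prod_top (Suc m - j)) m = 0" for j
    by (rule coeff_flat_prod_top_ge) simp
  then show ?thesis
    by (simp add: coeff_sum coeff_flat_poly_top)
qed

text \<open>For the root \<open>z\<close> of \<open>z = x + \<Sum>\<^sub>j s\<^sub>j z\<^bsup>-j\<^esup>\<close> and \<open>a \<ge> 1\<close> one has \<open>flat_poly a = z\<^bsup>a-1\<^esup> dz/dx + O(x\<^bsup>-2\<^esup>)\<close>;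
  in the degrees considered here, \<open>flat_prod_top m\<close> stands for \<open>z\<^bsup>m-2\<^esup> (dz/dx)\<^sup>2\<close>.\<close>

lemma coeff_flat_poly_mult:
  assumes "a \<ge> 1" "b \<ge> 1" "n + 3 > max a b"
  shows "coeff (flat_poly a * flat_poly b) n = coeff (flat_prod_top (a + b)) n"
  using assms
proof (induction "a + b" arbitrary: a b rule: less_induct)
  case less
  let ?P = flat_poly and ?W = flat_prod_top
  have W: "?W (a + b) = ?P (a + b - 1) - (\<Sum>j = 1..N. smult (of_nat j * s j) (?W (a + b - (j + 1))))"
    using less.prems by (cases "a + b" rule: flat_prod_top.cases) auto
  have "coeff (?P (a - i) * ?P (b - (j + 1 - i))) n = coeff (?W (a + b - (j + 1))) n"
    if "1 \<le> i" "i \<le> j" for i j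
  proof (cases "a - i \<ge> 1 \<and> b - (j + 1 - i) \<ge> 1")
    case True
    then have "a - i + (b - (j + 1 - i)) = a + b - (j + 1)"
      using that by auto
    moreover have "coeff (?P (a - i) * ?P (b - (j + 1 - i))) n = coeff (?W (a - i + (b - (j + 1 - i)))) n"
      by (rule less.hyps) (use True that less.prems in auto)
    ultimately show ?thesis
      by simp
  next
    case False
    then have "?P (a - i) = 0 \<or> ?P (b - (j + 1 - i)) = 0"
      by (metis diff_is_0_eq flat_poly.simps(1) less_one not_le diff_self_eq_0)
    \<comment> \<open>The product is 0 here, and the right side must have no such coefficient
      either: if \<open>a <= i\<close> then \<open>a + b - (j + 1) < b\<close>, otherwise it is less
      than \<open>a\<close>. This is where the bound \<open>n + 3 > max a b\<close> matters.\<close>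
    moreover have "n + 2 > a + b - (j + 1)"
      using False that less.prems by auto
    ultimately show ?thesis
      using coeff_flat_prod_top_ge by auto
  qed
  then have "(\<Sum>j = 1..N. \<Sum>i = 1..j. s j * coeff (?P (a - i) * ?P (b - (j + 1 - i))) n)
      = (\<Sum>j = 1..N. \<Sum>i = 1..j. s j * coeff (?W (a + b - (j + 1))) n)"
    by (intro sum.cong refl) auto
  then show ?case
    using less.prems
    by (simp add: flat_poly_mult W coeff_sum sum_distrib_left mult.assoc)
qed

text \<open>For \<open>a + b >= N + 2\<close> both products have the same index sum, and by
  \<open>coeff_flat_poly_mult\<close> their coefficients in degrees at least \<open>N - 1\<close>
  depend on that sum only. For \<open>a + b <= N + 1\<close> the subtrahend is 0, and the first
  product is monic of degree \<open>a + b - 2\<close>.\<close>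

lemma flat_poly_mult_mod:
  assumes "1 \<le> a" "a \<le> N" "1 \<le> b" "b \<le> N"
  defines "r \<equiv> flat_poly a * flat_poly b - flat_poly (N + 1) * flat_poly (a + b - (N + 1))"
  shows "\<And>n. n \<ge> N \<Longrightarrow> coeff r n = 0"
    and "coeff r (N - 1) = (if a + b = N + 1 then 1 else 0)"
proof -
  have "coeff r n = (if a + b = N + 1 \<and> n = N - 1 then 1 else 0)" if "n \<ge> N - 1" for n
  proof (cases "a + b \<ge> N + 2")
    case True
    have 1: "coeff (flat_poly a * flat_poly b) n = coeff (flat_prod_top (a + b)) n"
      by (rule coeff_flat_poly_mult) (use assms that in auto)
    have "coeff (flat_poly (N + 1) * flat_poly (a + b - (N + 1))) n
        = coeff (flat_prod_top (N + 1 + (a + b - (N + 1)))) n"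
      by (rule coeff_flat_poly_mult) (use assms that True in auto)
    also have "N + 1 + (a + b - (N + 1)) = a + b"
      using True by simp
    finally have "coeff r n = 0"
      unfolding r_def coeff_diff 1 by simp
    then show ?thesis
      using True by simp
  next
    case False
    then have "r = flat_poly a * flat_poly b"
      by (simp add: r_def)
    also have "coeff \<dots> n = coeff (flat_prod_top (a + b)) n"
      by (rule coeff_flat_poly_mult) (use assms that in auto)
    finally have r: "coeff r n = coeff (flat_prod_top (a + b)) n" .
    show ?thesis
    proof (cases "a + b = N + 1 \<and> n = N - 1")
      case True
      then have "a + b = Suc (Suc n)"
        using assms by simp
      then have "coeff r n = 1"
        by (simp only: r coeff_flat_prod_top_top)
      with True show ?thesis
        by simp
    next
      case F: False
      have "coeff (flat_prod_top (a + b)) n = 0"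
        by (rule coeff_flat_prod_top_ge) (use F that False in auto)
      with F r show ?thesis
        by simp
    qed
  qed
  then show "\<And>n. n \<ge> N \<Longrightarrow> coeff r n = 0" "coeff r (N - 1) = (if a + b = N + 1 then 1 else 0)"
    using assms by auto
qed

end

section \<open>Derivations of the coefficient ring\<close>

locale derivation =
  fixes d :: "'a::comm_ring_1 \<Rightarrow> 'a"
  assumes d_add: "d (x + y) = d x + d y"
    and d_mult: "d (x * y) = d x * y + x * d y"
begin

lemma d_0 [simp]: "d 0 = 0"
  using d_add[of 0 0] by simp

lemma d_1 [simp]: "d 1 = 0"
  using d_mult[of 1 1] by simp

lemma d_uminus: "d (- x) = - d x"
  using d_add[of x "- x"] by (simp add: eq_neg_iff_add_eq_0 add.commute)

lemma d_diff: "d (x - y) = d x - d y"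
  using d_add[of x "- y"] by (simp add: d_uminus)

lemma d_sum: "d (\<Sum>i\<in>I. f i) = (\<Sum>i\<in>I. d (f i))"
  by (induction I rule: infinite_finite_induct) (auto simp: d_add)

end

section \<open>Laurent series at infinity\<close>

notation fls_nth (infixl \<open>$$\<close> 75)

text \<open>Laurent series in \<open>x\<^bsup>-1\<^esup>\<close>: the variable \<open>fls_X\<close> stands for \<open>x\<^bsup>-1\<^esup>\<close>.\<close>

definition laurent :: "'a::comm_ring_1 poly \<Rightarrow> 'a fls" where
  "laurent p = Abs_fls (\<lambda>n. if n \<le> 0 then coeff p (nat (- n)) else 0)"

text \<open>The chain rule for \<open>X = 1/x\<close>: \<open>d/dx = - X^2 d/dX\<close>.\<close>

definition xderiv :: "'a::comm_ring_1 fls \<Rightarrow> 'a fls" where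
  "xderiv f = - (fls_X ^ 2 * fls_deriv f)"

definition res :: "'a::zero fls \<Rightarrow> 'a" where
  "res f = f $$ 1"

lemma laurent_nth [simp]: "laurent p $$ n = (if n \<le> 0 then coeff p (nat (- n)) else 0)"
proof -
  have "\<forall>n < - int (degree p). (if n \<le> 0 then coeff p (nat (- n)) else 0) = 0"
    by (auto intro!: coeff_eq_0)
  from nth_Abs_fls_lower_bound[OF this, of n] show ?thesis
    by (simp add: laurent_def)
qed

lemma laurent_add: "laurent (p + q) = laurent p + laurent q"
  and laurent_diff: "laurent (p - q) = laurent p - laurent q"
  and laurent_smult: "laurent (smult c p) = fls_const c * laurent p"
  and laurent_0 [simp]: "laurent 0 = 0"
  and laurent_1 [simp]: "laurent 1 = 1"
  and laurent_pCons: "laurent (pCons c p) = fls_const c + fls_X_inv * laurent p"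
proof -
  show "laurent (pCons c p) = fls_const c + fls_X_inv * laurent p"
  proof (rule fls_eqI)
    fix n :: int
    consider "n > 0" | "n = 0" | "n < 0"
      by linarith
    then show "laurent (pCons c p) $$ n = (fls_const c + fls_X_inv * laurent p) $$ n"
    proof cases
      case 3
      then have "nat (- n) = Suc (nat (- n - 1))"
        by simp
      with 3 show ?thesis
        by (simp add: fls_X_inv_times_conv_shift)
    qed (auto simp: fls_X_inv_times_conv_shift)
  qed
qed (rule fls_eqI, simp)+

lemma laurent_sum: "laurent (\<Sum>i\<in>I. f i) = (\<Sum>i\<in>I. laurent (f i))"
  by (induction I rule: infinite_finite_induct) (auto simp: laurent_add)

lemma laurent_mult: "laurent (p * q) = laurent p * laurent q"
  by (induction p)
     (simp_all add: mult_pCons_left laurent_add laurent_smult laurent_pCons algebra_simps)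

lemma fls_mult_nth_bounds:
  fixes f g :: "'a::comm_ring_1 fls"
  assumes "\<And>k. k < a \<Longrightarrow> f $$ k = 0" "\<And>k. k < b \<Longrightarrow> g $$ k = 0"
  shows "(f * g) $$ n = (\<Sum>i = a..n - b. f $$ i * g $$ (n - i))"
proof (cases "f = 0 \<or> g = 0")
  case False
  then have "a \<le> fls_subdegree f" "b \<le> fls_subdegree g"
    using assms by (auto intro: fls_subdegree_geI)
  then show ?thesis
    unfolding fls_times_nth(2) by (intro sum.mono_neutral_left) auto
qed auto

lemma fls_mult_nth_eq_0:
  fixes f g :: "'a::comm_ring_1 fls"
  assumes "\<And>k. k < a \<Longrightarrow> f $$ k = 0" "\<And>k. k < b \<Longrightarrow> g $$ k = 0" "n < a + b"
  shows "(f * g) $$ n = 0"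
  using fls_mult_nth_bounds[of a f b g n] assms by simp

lemma fls_mult_nth_lowest:
  fixes f g :: "'a::comm_ring_1 fls"
  assumes "\<And>k. k < a \<Longrightarrow> f $$ k = 0" "\<And>k. k < b \<Longrightarrow> g $$ k = 0"
  shows "(f * g) $$ (a + b) = f $$ a * g $$ b"
  using fls_mult_nth_bounds[of a f b g "a + b"] assms by simp

lemma xderiv_add: "xderiv (f + g) = xderiv f + xderiv g"
  and xderiv_mult: "xderiv (f * g) = xderiv f * g + f * xderiv g"
  and xderiv_const [simp]: "xderiv (fls_const c) = 0"
  and xderiv_0 [simp]: "xderiv 0 = 0"
  and xderiv_1 [simp]: "xderiv 1 = 0"
  by (simp_all add: xderiv_def algebra_simps)

lemma xderiv_sum: "xderiv (\<Sum>i\<in>I. f i) = (\<Sum>i\<in>I. xderiv (f i))"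
  by (induction I rule: infinite_finite_induct) (auto simp: xderiv_add)

lemma xderiv_nth: "xderiv f $$ n = - (of_int (n - 1) * f $$ (n - 1))"
  by (simp add: xderiv_def fls_X_power_times_conv_shift)

lemma xderiv_X_inv: "xderiv fls_X_inv = 1"
  by (rule fls_eqI) (auto simp: xderiv_nth)

lemma res_simps:
  "res (f + g) = res f + res g" "res (f - g) = res f - res g" "res (fls_const c * f) = c * res f"
  "res 0 = 0" "res (laurent p) = 0" "res (xderiv f) = 0"
  for f g :: "'a::comm_ring_1 fls"
  by (simp_all add: res_def xderiv_nth)

lemma res_sum: "res (\<Sum>i\<in>I. f i) = (\<Sum>i\<in>I. res (f i :: 'a::comm_ring_1 fls))"
  by (induction I rule: infinite_finite_induct) (auto simp: res_simps)

lemma laurent_nth_low: "(\<And>n. n \<ge> N \<Longrightarrow> coeff r n = 0) \<Longrightarrow> k < 1 - int N \<Longrightarrow> laurent r $$ k = 0"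
  by (auto simp: nat_le_iff intro: nat_mono)

text \<open>The residue of \<open>f\<^sub>1' f\<^sub>2\<close> depends on the polynomial parts \<open>p\<^sub>i\<close> only through \<open>p\<^sub>1' f\<^sub>2 - p\<^sub>2' f\<^sub>1\<close>.\<close>

lemma res_xderiv_laurent_exchange:
  fixes f1 f2 :: "'a::comm_ring_1 fls"
  assumes "\<And>k. k < 1 \<Longrightarrow> (f1 - laurent p1) $$ k = 0" "\<And>k. k < 1 \<Longrightarrow> (f2 - laurent p2) $$ k = 0"
    and xp: "\<exists>q. xderiv (laurent p2) = laurent q"
  shows "res (xderiv (laurent p1) * f2) - res (xderiv (laurent p2) * f1) = res (xderiv f1 * f2)"
proof -
  define r1 r2 where r: "r1 = f1 - laurent p1" "r2 = f2 - laurent p2"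
  then have f: "f1 = laurent p1 + r1" "f2 = laurent p2 + r2"
    by simp_all
  obtain q where q: "xderiv (laurent p2) = laurent q"
    using xp by auto
  have "res (xderiv r1 * r2) = 0"
    unfolding res_def
  proof (rule fls_mult_nth_eq_0[where a = 2 and b = 1])
    show "xderiv r1 $$ k = 0" if "k < 2" for k
      using that assms(1)[of "k - 1"] by (simp add: xderiv_nth r)
  qed (use assms(2) r in auto)
  moreover have "res (laurent p1 * xderiv (laurent p2)) = 0"
    by (simp add: q res_simps flip: laurent_mult)
  \<comment> \<open>A total derivative, a polynomial, and a series starting at
    \<open>x^(-3)\<close>: none of the three has a residue.\<close>
  moreover have "xderiv f1 * f2 - xderiv (laurent p1) * f2 + xderiv (laurent p2) * f1
      = xderiv (r1 * laurent p2) + laurent p1 * xderiv (laurent p2) + xderiv r1 * r2"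
    by (simp add: f xderiv_add xderiv_mult algebra_simps)
  ultimately have "res (xderiv f1 * f2 - xderiv (laurent p1) * f2 + xderiv (laurent p2) * f1) = 0"
    by (simp add: res_simps)
  then show ?thesis
    by (simp add: res_simps algebra_simps)
qed

lemma xderiv_laurent: "\<exists>q. xderiv (laurent p) = laurent q"
proof (induction p)
  case (pCons c p)
  then obtain q where "xderiv (laurent p) = laurent q"
    by auto
  then have "xderiv (laurent (pCons c p)) = laurent (p + pCons 0 q)"
    by (simp add: laurent_pCons laurent_add xderiv_add xderiv_mult xderiv_X_inv)
  then show ?case ..
qed (auto intro: exI[of _ 0])

lemmas res_exchange = res_xderiv_laurent_exchange[OF _ _ xderiv_laurent]

section \<open>Derivations acting on the coefficients of Laurent series\<close>

context derivation
begin

definition fls_map :: "'a fls \<Rightarrow> 'a fls" where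
  "fls_map f = Abs_fls (\<lambda>n. d (f $$ n))"

lemma fls_map_nth [simp]: "fls_map f $$ n = d (f $$ n)"
proof -
  have "\<forall>n < fls_subdegree f. d (f $$ n) = 0"
    by simp
  from nth_Abs_fls_lower_bound[OF this, of n] show ?thesis
    by (simp add: fls_map_def)
qed

lemma fls_map_add: "fls_map (f + g) = fls_map f + fls_map g"
  and fls_map_0 [simp]: "fls_map 0 = 0"
  and fls_map_1 [simp]: "fls_map 1 = 0"
  and fls_map_const: "fls_map (fls_const c) = fls_const (d c)"
  and fls_map_X_inv [simp]: "fls_map fls_X_inv = 0"
  by (rule fls_eqI, simp add: d_add d_diff)+

lemma fls_map_sum: "fls_map (\<Sum>i\<in>I. f i) = (\<Sum>i\<in>I. fls_map (f i))"
  by (induction I rule: infinite_finite_induct) (auto simp: fls_map_add)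

lemma fls_map_mult: "fls_map (f * g) = fls_map f * g + f * fls_map g"
proof (rule fls_eqI)
  fix n :: int
  let ?a = "fls_subdegree f" and ?b = "fls_subdegree g"
  note * = fls_mult_nth_bounds[where a = ?a and b = ?b]
  show "fls_map (f * g) $$ n = (fls_map f * g + f * fls_map g) $$ n"
    by (simp add: *[of f g] *[of "fls_map f" g] *[of f "fls_map g"] d_sum d_mult sum.distrib)
qed

lemma res_fls_map: "res (fls_map f) = d (res f)"
  by (simp add: res_def)

end

section \<open>The flat frame at infinity and division by its last member\<close>

definition frame :: "(nat \<Rightarrow> 'a::comm_ring_1) \<Rightarrow> nat \<Rightarrow> nat \<Rightarrow> 'a fls" where
  "frame s N a = laurent (flat_poly s N a)"

lemma frame_0 [simp]: "frame s N 0 = 0"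
  and frame_1 [simp]: "frame s N (Suc 0) = 1"
  by (simp_all add: frame_def)

lemma frame_Suc:
  "a \<ge> 1 \<Longrightarrow> frame s N (Suc a) = fls_X_inv * frame s N a + (\<Sum>j = 1..N. fls_const (s j) * frame s N (a - j))"
  by (simp add: frame_def flat_poly_Suc laurent_add laurent_pCons laurent_sum laurent_smult)

text \<open>Both sides are the coefficient of \<open>U^a\<close> in
  \<open>U^l / (x(U) - x)^2\<close>, which is the derivative of \<open>1/(x(U) - x)\<close> in
  \<open>s_l\<close> and also \<open>U^l\<close> times its derivative in \<open>x\<close>.\<close>

lemma (in derivation) fls_map_frame:
  assumes "1 \<le> l" "l \<le> N" "\<And>j. 1 \<le> j \<Longrightarrow> j \<le> N \<Longrightarrow> d (s j) = (if j = l then 1 else 0)"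
  shows "fls_map (frame s N a) = xderiv (frame s N (a - l))"
proof (induction a rule: less_induct)
  case (less a)
  let ?P = "frame s N"
  show ?case
  proof (cases a rule: flat_poly.cases)
    case 2
    then show ?thesis
      using assms by (cases l) auto
  next
    case (3 m)
    have a: "?P a = fls_X_inv * ?P (Suc m) + (\<Sum>j = 1..N. fls_const (s j) * ?P (Suc m - j))"
      using 3 by (simp add: frame_Suc)
    have IH: "fls_map (?P (Suc m - j)) = xderiv (?P (Suc m - j - l))" for j
      by (rule less.IH) (simp add: 3)
    have IH0: "fls_map (?P (Suc m)) = xderiv (?P (Suc m - l))"
      using IH[of 0] by simp
    have "(\<Sum>j = 1..N. fls_const (d (s j)) * ?P (Suc m - j)) = (\<Sum>j = 1..N. if j = l then ?P (Suc m - l) else 0)"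
      by (rule sum.cong) (auto simp: assms(3))
    then have delta: "(\<Sum>j = 1..N. fls_const (d (s j)) * ?P (Suc m - j)) = ?P (Suc m - l)"
      using assms(1,2) by simp
    have 1: "fls_map (?P a) = fls_X_inv * xderiv (?P (Suc m - l)) + ?P (Suc m - l)
        + (\<Sum>j = 1..N. fls_const (s j) * xderiv (?P (Suc m - j - l)))"
      unfolding a fls_map_add fls_map_sum fls_map_mult fls_map_const IH IH0 sum.distrib delta
      by (simp add: algebra_simps)
    show ?thesis
    proof (cases "Suc m - l \<ge> 1")
      case True
      then have "a - l = Suc (Suc m - l)"
        using 3 by simp
      moreover have "Suc m - l - j = Suc m - j - l" for j
        by simp
      ultimately show ?thesis
        using True
        by (simp only: 1 frame_Suc xderiv_add xderiv_sum xderiv_mult xderiv_X_inv xderiv_const) simp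
    next
      \<comment> \<open>Now \<open>a - l\<close> is 0 or 1, so the claimed value is the derivative
        of a constant, and every term on the other side has index 0.\<close>
      case False
      then have l: "Suc m - l = 0" "\<And>j. Suc m - j - l = 0"
        by auto
      then have "a - l = 0 \<or> a - l = Suc 0"
        using 3 by auto
      then have "xderiv (?P (a - l)) = 0"
        by auto
      then show ?thesis
        unfolding 1 l by simp
    qed
  qed auto
qed

lemma frame_nth_low: "k < 1 - int a \<Longrightarrow> frame s N a $$ k = 0"
  using coeff_flat_poly_ge[of a _ s N] by (auto simp: frame_def)

text \<open>\<open>1/Phi_(N+1)\<close> expanded at infinity. It exists over every commutative ring
  because \<open>Phi_(N+1)\<close> is monic.\<close>

definition frame_inv :: "(nat \<Rightarrow> 'a::comm_ring_1) \<Rightarrow> nat \<Rightarrow> 'a fls" where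
  "frame_inv s N = fls_right_inverse (frame s N (N + 1)) 1"

lemma frame_inv: "frame s N (N + 1) * frame_inv s N = 1"
  and frame_inv_nth_low: "k < int N \<Longrightarrow> frame_inv s N $$ k = 0"
  and frame_inv_nth_lowest: "frame_inv s N $$ int N = 1"
proof -
  have top: "frame s N (N + 1) $$ (- int N) = 1"
    using coeff_flat_poly_top[of s N N] by (simp add: frame_def)
  then have sub: "fls_subdegree (frame s N (N + 1)) = - int N"
    by (intro fls_subdegree_eqI) (use frame_nth_low[of _ "N + 1" s N] in auto)
  show "frame s N (N + 1) * frame_inv s N = 1"
    unfolding frame_inv_def by (rule fls_right_inverse) (simp only: sub top mult_1)
  have "fls_subdegree (frame_inv s N) = - fls_subdegree (frame s N (N + 1))"
    unfolding frame_inv_def by (rule fls_lr_inverse_subdegree) simp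
  then have "fls_subdegree (frame_inv s N) = int N"
    unfolding sub by simp
  then show "k < int N \<Longrightarrow> frame_inv s N $$ k = 0"
    by simp
  show "frame_inv s N $$ int N = 1"
    using fls_lr_inverse_base(2)[of "frame s N (N + 1)" 1]
    unfolding frame_inv_def sub by simp
qed

lemma laurent_frame_inv_low:
  assumes "\<And>n. n \<ge> N \<Longrightarrow> coeff r n = 0"
  shows "k < 1 \<Longrightarrow> (laurent r * frame_inv s N) $$ k = 0"
    and "N \<ge> 1 \<Longrightarrow> res (laurent r * frame_inv s N) = coeff r (N - 1)"
proof -
  have low: "laurent r $$ k = 0" if "k < 1 - int N" for k
    using laurent_nth_low[OF assms that] .
  show "(laurent r * frame_inv s N) $$ k = 0" if "k < 1"
    by (rule fls_mult_nth_eq_0[OF low frame_inv_nth_low]) (use that in auto)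
  show "res (laurent r * frame_inv s N) = coeff r (N - 1)" if "N \<ge> 1"
    using fls_mult_nth_lowest[where f = "laurent r" and a = "1 - int N" and g = "frame_inv s N" and b = "int N"]
      low frame_inv_nth_low[of _ N s] that
    by (simp add: res_def frame_inv_nth_lowest nat_diff_distrib)
qed

text \<open>Taking the residue against \<open>1/Phi_(N+1)\<close> is the linear form on the quotient
  ring that reads the coefficient of \<open>x^(N-1)\<close>; this is the form that defines
  \<open>eta\<close>.\<close>

lemma res_div:
  assumes "p = flat_poly s N (N + 1) * q + r" "\<And>n. n \<ge> N \<Longrightarrow> coeff r n = 0" "N \<ge> 1"
  shows "res (laurent p * frame_inv s N) = coeff r (N - 1)"
proof -
  have "laurent p * frame_inv s N = laurent q * (frame s N (N + 1) * frame_inv s N) + laurent r * frame_inv s N"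
    by (simp add: assms(1) laurent_add laurent_mult frame_def algebra_simps)
  then show ?thesis
    using laurent_frame_inv_low(2)[OF assms(2,3)] by (simp only: frame_inv res_simps mult_1_right) simp
qed

text \<open>Divide by \<open>Phi_(N+1)\<close> with the remainder of
  \<open>flat_poly_mult_mod\<close>. The second part is the flatness of the pairing in the
  coordinates \<open>t\<close>.\<close>

lemma frame_mult_inv_low:
  fixes s :: "nat \<Rightarrow> 'a::comm_ring_1"
  assumes "1 \<le> a" "a \<le> N" "1 \<le> b" "b \<le> N"
  shows "k < 1 \<Longrightarrow> (frame s N a * frame s N b * frame_inv s N - frame s N (a + b - (N + 1))) $$ k = 0"
    and "res (frame s N a * frame s N b * frame_inv s N) = (if a + b = N + 1 then 1 else 0)"
proof -
  define r where "r = flat_poly s N a * flat_poly s N b - flat_poly s N (N + 1) * flat_poly s N (a + b - (N + 1))"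
  note r = flat_poly_mult_mod[OF assms, where s = s, folded r_def]
  have "frame s N a * frame s N b = frame s N (N + 1) * frame s N (a + b - (N + 1)) + laurent r"
    by (simp add: r_def frame_def laurent_diff laurent_mult)
  then have *: "frame s N a * frame s N b * frame_inv s N
      = frame s N (a + b - (N + 1)) * (frame s N (N + 1) * frame_inv s N) + laurent r * frame_inv s N"
    by (simp add: algebra_simps)
  show "k < 1 \<Longrightarrow> (frame s N a * frame s N b * frame_inv s N - frame s N (a + b - (N + 1))) $$ k = 0"
    using laurent_frame_inv_low(1)[where k = k and s = s, OF r(1)] by (simp only: * frame_inv) simp
  show "res (frame s N a * frame s N b * frame_inv s N) = (if a + b = N + 1 then 1 else 0)"
    using laurent_frame_inv_low(2)[where s = s, OF r(1)] r(2) assms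
    by (simp only: * frame_inv res_simps mult_1_right) (simp add: frame_def res_simps)
qed

section \<open>Three-point residues, their recurrence and their integrability\<close>

definition three_point :: "(nat \<Rightarrow> 'a::comm_ring_1) \<Rightarrow> nat \<Rightarrow> nat \<Rightarrow> nat \<Rightarrow> nat \<Rightarrow> 'a" where
  "three_point s N a b c = res (frame s N a * frame s N b * frame s N c * frame_inv s N)"

lemma three_point_sym:
  "three_point s N a b c = three_point s N b a c" "three_point s N a b c = three_point s N a c b"
  by (simp_all add: three_point_def mult_ac)

lemma three_point_0 [simp]: "three_point s N 0 b c = 0" "three_point s N a 0 c = 0" "three_point s N a b 0 = 0"
  by (simp_all add: three_point_def res_simps)

text \<open>Multiplied by \<open>1 + K\<close>, the generating function of the residues becomes that
  of the pairings of \<open>Phi_(a+b-1)\<close> with \<open>Phi_c\<close>, which are constants.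
  These pairings are known for indices up to \<open>N\<close>, hence the bound on
  \<open>a + b\<close>.\<close>

lemma three_point_rec:
  assumes "1 \<le> a" "1 \<le> b" "a + b \<le> N + 1" "1 \<le> c" "c \<le> N"
  shows "three_point s N a b c = (if a + b + c = N + 2 then 1 else 0)
    - (\<Sum>j = 1..N. s j * (\<Sum>i = 1..j. three_point s N (a - i) (b - (j + 1 - i)) c))"
proof -
  have "frame s N a * frame s N b = frame s N (a + b - 1)
      - (\<Sum>j = 1..N. fls_const (s j) * (\<Sum>i = 1..j. frame s N (a - i) * frame s N (b - (j + 1 - i))))"
    using flat_poly_mult[of a b s N] assms
    by (simp add: frame_def laurent_diff laurent_sum laurent_smult flip: laurent_mult)
  then have "frame s N a * frame s N b * frame s N c * frame_inv s N
      = frame s N (a + b - 1) * frame s N c * frame_inv s N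
      - (\<Sum>j = 1..N. fls_const (s j) *
          (\<Sum>i = 1..j. frame s N (a - i) * frame s N (b - (j + 1 - i)) * frame s N c * frame_inv s N))"
    by (simp add: left_diff_distrib sum_distrib_right mult.assoc)
  moreover have "res (frame s N (a + b - 1) * frame s N c * frame_inv s N) = (if a + b + c = N + 2 then 1 else 0)"
    using frame_mult_inv_low(2)[of "a + b - 1" N c s] assms by auto
  ultimately show ?thesis
    by (simp add: three_point_def res_simps res_sum)
qed

lemma fls_map_frame_inv:
  assumes "derivation d"
  shows "derivation.fls_map d (frame_inv s N) = - (frame_inv s N ^ 2 * derivation.fls_map d (frame s N (N + 1)))"
proof -
  interpret derivation d by fact
  let ?M = "frame s N (N + 1)" and ?J = "frame_inv s N"
  have "0 = ?J * fls_map (?M * ?J)"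
    unfolding frame_inv by simp
  also have "\<dots> = ?J ^ 2 * fls_map ?M + (?M * ?J) * fls_map ?J"
    by (simp add: fls_map_mult power2_eq_square algebra_simps)
  finally show ?thesis
    unfolding frame_inv by (simp add: eq_neg_iff_add_eq_0 add.commute)
qed

text \<open>In the application \<open>s l\<close> is the coordinate with number
  \<open>N + 1 - l\<close>, so this is the symmetry of the fourth derivatives of the potential to be
  constructed. It holds because the difference of the two sides is the residue of a total
  derivative.\<close>

lemma three_point_integrable:
  assumes d1: "derivation d1" "\<And>j. 1 \<le> j \<Longrightarrow> j \<le> N \<Longrightarrow> d1 (s j) = (if j = l then 1 else 0)"
    and d2: "derivation d2" "\<And>j. 1 \<le> j \<Longrightarrow> j \<le> N \<Longrightarrow> d2 (s j) = (if j = m then 1 else 0)"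
    and ranges: "1 \<le> l" "l \<le> N" "1 \<le> m" "m \<le> N" "1 \<le> a" "a \<le> N" "1 \<le> b" "b \<le> N"
  shows "d1 (three_point s N a b (N + 1 - m)) = d2 (three_point s N a b (N + 1 - l))"
proof -
  interpret D1: derivation d1 by fact
  interpret D2: derivation d2 by fact
  let ?P = "frame s N"
  define e g where "e = N + 1 - l" "g = N + 1 - m"
  define J where "J = frame_inv s N"
  define A B E G where "A = ?P a" "B = ?P b" "E = ?P e" "G = ?P g"
  have eg: "1 \<le> e" "e \<le> N" "1 \<le> g" "g \<le> N"
    using ranges by (auto simp: e_g_def)
  have m1: "D1.fls_map (?P c) = xderiv (?P (c - l))" for c
    by (rule D1.fls_map_frame[OF ranges(1,2) d1(2)])
  have m2: "D2.fls_map (?P c) = xderiv (?P (c - m))" for c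
    by (rule D2.fls_map_frame[OF ranges(3,4) d2(2)])
  have J: "D1.fls_map J = - (J ^ 2 * xderiv E)" "D2.fls_map J = - (J ^ 2 * xderiv G)"
    unfolding J_def A_B_E_G_def
    using fls_map_frame_inv[OF d1(1), of s N] fls_map_frame_inv[OF d2(1), of s N]
    by (simp_all add: m1 m2 e_g_def)
  \<comment> \<open>Since \<open>c - l = c + e - (N + 1)\<close>, \<open>Phi_(c-l)\<close> is the
    polynomial part of \<open>Phi_c E J\<close>; likewise \<open>Phi_(c'-m)\<close> is that of
    \<open>Phi_(c') G J\<close>.\<close>
  have exch: "res (xderiv (?P (c - l)) * (?P c' * G * J)) - res (xderiv (?P (c' - m)) * (?P c * E * J))
      = res (xderiv (?P c * E * J) * (?P c' * G * J))"
    if "1 \<le> c" "c \<le> N" "1 \<le> c'" "c' \<le> N" for c c'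
    unfolding frame_def[of s N "c - l"] frame_def[of s N "c' - m"]
  proof (rule res_exchange)
    have "c - l = c + e - (N + 1)" "c' - m = c' + g - (N + 1)"
      using ranges that by (auto simp: e_g_def)
    then show "(?P c * E * J - laurent (flat_poly s N (c - l))) $$ k = 0"
      "(?P c' * G * J - laurent (flat_poly s N (c' - m))) $$ k = 0" if "k < 1" for k
      using frame_mult_inv_low(1)[of c N e k s] frame_mult_inv_low(1)[of c' N g k s]
        that eg \<open>1 \<le> c\<close> \<open>c \<le> N\<close> \<open>1 \<le> c'\<close> \<open>c' \<le> N\<close>
      by (simp_all add: frame_def J_def A_B_E_G_def)
  qed
  have "d1 (three_point s N a b g) = res (D1.fls_map (A * B * G * J))"
    by (simp only: three_point_def D1.res_fls_map A_B_E_G_def J_def)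
  also have "D1.fls_map (A * B * G * J) = xderiv (?P (a - l)) * (B * G * J) + xderiv (?P (b - l)) * (A * G * J)
      + A * B * xderiv (?P (g - l)) * J - A * B * G * J ^ 2 * xderiv E"
    unfolding D1.fls_map_mult J unfolding A_B_E_G_def m1 by (simp add: algebra_simps)
  finally have 1: "d1 (three_point s N a b g) = res (xderiv (?P (a - l)) * (B * G * J))
      + res (xderiv (?P (b - l)) * (A * G * J)) + res (A * B * xderiv (?P (g - l)) * J)
      - res (A * B * G * J ^ 2 * xderiv E)"
    by (simp only: res_simps)
  have "d2 (three_point s N a b e) = res (D2.fls_map (A * B * E * J))"
    by (simp only: three_point_def D2.res_fls_map A_B_E_G_def J_def)
  also have "D2.fls_map (A * B * E * J) = xderiv (?P (a - m)) * (B * E * J) + xderiv (?P (b - m)) * (A * E * J)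
      + A * B * xderiv (?P (e - m)) * J - A * B * E * J ^ 2 * xderiv G"
    unfolding D2.fls_map_mult J unfolding A_B_E_G_def m2 by (simp add: algebra_simps)
  finally have 2: "d2 (three_point s N a b e) = res (xderiv (?P (a - m)) * (B * E * J))
      + res (xderiv (?P (b - m)) * (A * E * J)) + res (A * B * xderiv (?P (e - m)) * J)
      - res (A * B * E * J ^ 2 * xderiv G)"
    by (simp only: res_simps)
  \<comment> \<open>The terms in which the third factor is differentiated are the same on both sides
    and cancel.\<close>
  have em: "e - m = g - l"
    using ranges by (simp add: e_g_def)
  \<comment> \<open>Crosswise pairing: index \<open>a\<close> lowered by \<open>l\<close> goes with
    \<open>b\<close> lowered by \<open>m\<close>, and \<open>b\<close> lowered by \<open>l\<close>
    with \<open>a\<close> lowered by \<open>m\<close>. Each pair has the form required by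
    \<open>exch\<close>.\<close>
  have "d1 (three_point s N a b g) - d2 (three_point s N a b e)
      = (res (xderiv (?P (a - l)) * (B * G * J)) - res (xderiv (?P (b - m)) * (A * E * J)))
      + (res (xderiv (?P (b - l)) * (A * G * J)) - res (xderiv (?P (a - m)) * (B * E * J)))
      - (res (A * B * G * J ^ 2 * xderiv E) - res (A * B * E * J ^ 2 * xderiv G))"
    unfolding 1 2 em by (simp add: algebra_simps)
  also have "\<dots> = res (xderiv (A * E * J) * (B * G * J)) + res (xderiv (B * E * J) * (A * G * J))
      - (res (A * B * G * J ^ 2 * xderiv E) - res (A * B * E * J ^ 2 * xderiv G))"
    unfolding A_B_E_G_def(1,2) exch[OF ranges(5-8)] exch[OF ranges(7,8,5,6)] ..
  also have "\<dots> = res (xderiv (A * E * J) * (B * G * J) + xderiv (B * E * J) * (A * G * J)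
      - (A * B * G * J ^ 2 * xderiv E - A * B * E * J ^ 2 * xderiv G))"
    by (simp only: res_simps)
  also have "xderiv (A * E * J) * (B * G * J) + xderiv (B * E * J) * (A * G * J)
      - (A * B * G * J ^ 2 * xderiv E - A * B * E * J ^ 2 * xderiv G) = xderiv (A * B * E * G * (J * J))"
    by (simp add: xderiv_mult power2_eq_square algebra_simps)
  finally show ?thesis
    by (simp add: res_simps e_g_def)
qed

section \<open>The flat frame in the flat coordinates\<close>

definition flat_coord :: "nat \<Rightarrow> nat \<Rightarrow> complex mps" where
  "flat_coord N j = mvar (N + 1 - j)"

lemma derivation_pdiff: "derivation (pdiff k)"
  by standard simp_all

lemma pdiff_flat_coord:
  assumes "1 \<le> k" "k \<le> N" "1 \<le> j" "j \<le> N"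
  shows "pdiff k (flat_coord N j) = (if j = N + 1 - k then 1 else 0)"
  using assms by (auto simp: flat_coord_def pdiff_mvar)

section \<open>Weights and multinomial coefficients\<close>

definition flat_weight :: "nat \<Rightarrow> (nat \<Rightarrow>\<^sub>0 nat) \<Rightarrow> nat" where
  "flat_weight N \<mu> = (\<Sum>i<N. (N + 1 - i) * lookup \<mu> i)"

definition inv_facts :: "nat \<Rightarrow> (nat \<Rightarrow>\<^sub>0 nat) \<Rightarrow> complex" where
  "inv_facts N \<mu> = (\<Prod>i<N. 1 / fact (lookup \<mu> i))"

lemma flat_weight_alt: "(\<Sum>k = 1..N. (N + 2 - k) * lookup \<mu> (k - 1)) = flat_weight N \<mu>"
  unfolding flat_weight_def
  by (rule sum.reindex_bij_witness[where i = Suc and j = "\<lambda>k. k - 1"]) auto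

lemma inv_facts_alt: "(\<Prod>k = 1..N. 1 / fact (lookup \<mu> (k - 1))) = inv_facts N \<mu>"
  unfolding inv_facts_def
  by (rule prod.reindex_bij_witness[where i = Suc and j = "\<lambda>k. k - 1"]) auto

lemma total_degree_alt: "keys \<mu> \<subseteq> {..<N} \<Longrightarrow> total_degree \<mu> = (\<Sum>i<N. lookup \<mu> i)"
  unfolding total_degree_def by (rule sum.mono_neutral_left) (auto simp: in_keys_iff)

lemma sum_lookup_single:
  fixes f :: "nat \<Rightarrow> nat"
  assumes "i < N"
  shows "(\<Sum>k<N. f k * lookup (\<mu> + Poly_Mapping.single i 1) k) = (\<Sum>k<N. f k * lookup \<mu> k) + f i"
proof -
  have "(\<Sum>k<N. f k * lookup (\<mu> + Poly_Mapping.single i 1) k)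
      = (\<Sum>k<N. f k * lookup \<mu> k + (if k = i then f i else 0))"
    by (rule sum.cong) (auto simp: lookup_add lookup_single when_def)
  with assms show ?thesis
    by (simp add: sum.distrib)
qed

lemma flat_weight_add_single:
  "i < N \<Longrightarrow> flat_weight N (\<mu> + Poly_Mapping.single i 1) = flat_weight N \<mu> + (N + 1 - i)"
  unfolding flat_weight_def by (rule sum_lookup_single)

lemma total_degree_add_single: "total_degree (\<mu> + Poly_Mapping.single i 1) = total_degree \<mu> + 1"
proof -
  obtain n where "keys \<mu> \<subseteq> {..<n}"
    using finite_nat_iff_bounded finite_keys by blast
  then have *: "keys \<mu> \<subseteq> {..<max n (Suc i)}" "keys (\<mu> + Poly_Mapping.single i 1) \<subseteq> {..<max n (Suc i)}"
    unfolding keys_add_single by auto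
  show ?thesis
    unfolding total_degree_alt[OF *(1)] total_degree_alt[OF *(2)]
    using sum_lookup_single[of i "max n (Suc i)" "\<lambda>_. 1" \<mu>] by simp
qed

lemma inv_facts_add_single:
  assumes "i < N"
  shows "of_nat (lookup \<mu> i + 1) * inv_facts N (\<mu> + Poly_Mapping.single i 1) = inv_facts N \<mu>"
proof -
  let ?e = "Poly_Mapping.single i (1::nat)"
  have split: "inv_facts N \<nu> = 1 / fact (lookup \<nu> i) * (\<Prod>k\<in>{..<N} - {i}. 1 / fact (lookup \<nu> k))" for \<nu>
    unfolding inv_facts_def using assms by (intro prod.remove) auto
  have "(\<Prod>k\<in>{..<N} - {i}. 1 / fact (lookup (\<mu> + ?e) k)) = (\<Prod>k\<in>{..<N} - {i}. 1 / fact (lookup \<mu> k) :: complex)"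
    by (rule prod.cong) (auto simp: lookup_add lookup_single when_def)
  moreover have "of_nat (lookup \<mu> i + 1) * (1 / fact (lookup (\<mu> + ?e) i)) = (1 / fact (lookup \<mu> i) :: complex)"
  proof -
    have "of_nat (lookup \<mu> i + 1) \<noteq> (0 :: complex)"
      by (simp only: of_nat_eq_0_iff)
    then show ?thesis
      by (simp only: lookup_add lookup_single_eq fact_Suc of_nat_mult flip: Suc_eq_plus1)
         (simp add: divide_simps del: of_nat_Suc)
  qed
  ultimately show ?thesis
    unfolding split[of "\<mu> + ?e"] split[of \<mu>] by (simp only: mult.assoc[symmetric])
qed

lemma flat_weight_eq_0:
  assumes "keys \<mu> \<subseteq> {..<N}"
  shows "flat_weight N \<mu> = 0 \<longleftrightarrow> \<mu> = 0"
proof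
  assume *: "flat_weight N \<mu> = 0"
  show "\<mu> = 0"
  proof (rule poly_mapping_eqI)
    fix i
    show "lookup \<mu> i = lookup 0 i"
    proof (cases "i < N")
      case True
      with * have "(N + 1 - i) * lookup \<mu> i = 0"
        by (simp add: flat_weight_def)
      with True show ?thesis
        by simp
    next
      case False
      with assms have "i \<notin> keys \<mu>"
        by auto
      then show ?thesis
        by (simp add: in_keys_iff)
    qed
  qed
qed (simp add: flat_weight_def)

text \<open>Every variable has weight at least 2. Hence \<open>Phi_(N+1)\<close> has no term
  \<open>x^(N-1)\<close>, in agreement with the derivative of \<open>Lambda\<close>.\<close>

lemma flat_weight_neq_1: "flat_weight N \<mu> \<noteq> 1"
proof
  assume *: "flat_weight N \<mu> = 1"
  have "\<exists>i<N. lookup \<mu> i \<noteq> 0"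
  proof (rule ccontr)
    assume "\<not> ?thesis"
    then have "flat_weight N \<mu> = 0"
      unfolding flat_weight_def by (intro sum.neutral) auto
    with * show False
      by simp
  qed
  then obtain i where i: "i < N" "lookup \<mu> i \<noteq> 0"
    by auto
  have "2 * 1 \<le> (N + 1 - i) * lookup \<mu> i"
    using i by (intro mult_le_mono) auto
  also have "\<dots> \<le> flat_weight N \<mu>"
    unfolding flat_weight_def using i by (intro member_le_sum) auto
  finally show False
    using * by simp
qed

lemma single_decomp: "lookup \<mu> i > 0 \<Longrightarrow> \<exists>\<nu> :: nat \<Rightarrow>\<^sub>0 nat. \<mu> = \<nu> + Poly_Mapping.single i 1"
  by (rule exI[of _ "\<mu> - Poly_Mapping.single i 1"]) (simp only: single_add_diff)

definition flat_coeff :: "nat \<Rightarrow> nat \<Rightarrow> nat \<Rightarrow> (nat \<Rightarrow>\<^sub>0 nat) \<Rightarrow> complex" where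
  "flat_coeff N a n \<mu> = (if keys \<mu> \<subseteq> {..<N} \<and> n + 1 + flat_weight N \<mu> = a
     then fact (total_degree \<mu> + n) / fact n * inv_facts N \<mu> else 0)"

text \<open>The multinomial coefficients: \<open>flat_coeff N a n\<close> is the coefficient of \<open>U\<^sup>a\<close> in \<open>x(U)\<^bsup>-n-1\<^esup>\<close>,
  where \<open>x(U) = U\<^bsup>-1\<^esup> - \<Sum>\<^sub>k t\<^sub>k U\<^bsup>N+1-k\<^esup>\<close>.\<close>

lemma flat_coeff_rec:
  "flat_coeff N (Suc (Suc m)) n \<mu> = (if n = 0 then 0 else flat_coeff N (Suc m) (n - 1) \<mu>)
    + (\<Sum>j = 1..N. if lookup \<mu> (N - j) > 0
         then flat_coeff N (Suc m - j) n (\<mu> - Poly_Mapping.single (N - j) 1) else 0)"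
proof -
  let ?C = "keys \<mu> \<subseteq> {..<N} \<and> n + 1 + flat_weight N \<mu> = Suc (Suc m)"
  let ?c = "fact (total_degree \<mu> + n - 1) / fact n * inv_facts N \<mu> :: complex"
  have summand: "(if lookup \<mu> (N - j) > 0 then flat_coeff N (Suc m - j) n (\<mu> - Poly_Mapping.single (N - j) 1) else 0)
      = (if ?C then of_nat (lookup \<mu> (N - j)) * ?c else 0)" if "j \<in> {1..N}" for j
  proof (cases "lookup \<mu> (N - j) > 0")
    case True
    then obtain \<nu> where \<nu>: "\<mu> = \<nu> + Poly_Mapping.single (N - j) 1"
      using single_decomp by blast
    have lt: "N - j < N"
      using that by auto
    have sub: "\<mu> - Poly_Mapping.single (N - j) 1 = \<nu>"
      by (simp add: \<nu>)
    have C: "?C \<longleftrightarrow> keys \<nu> \<subseteq> {..<N} \<and> n + 1 + flat_weight N \<nu> = Suc m - j"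
      unfolding \<nu> flat_weight_add_single[OF lt] keys_add_single using that lt by auto
    have 1: "of_nat (lookup \<mu> (N - j)) * inv_facts N \<mu> = inv_facts N \<nu>"
      using inv_facts_add_single[OF lt, of \<nu>] by (simp add: \<nu> lookup_add)
    have 2: "total_degree \<mu> + n - 1 = total_degree \<nu> + n"
      unfolding \<nu> total_degree_add_single by simp
    have "of_nat (lookup \<mu> (N - j)) * ?c = fact (total_degree \<nu> + n) / fact n * inv_facts N \<nu>"
      unfolding 2 1[symmetric] by (simp only: mult_ac)
    with True show ?thesis
      unfolding sub C flat_coeff_def by (simp only: if_True)
  qed auto
  have sum: "(\<Sum>j = 1..N. if lookup \<mu> (N - j) > 0
         then flat_coeff N (Suc m - j) n (\<mu> - Poly_Mapping.single (N - j) 1) else 0)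
      = (\<Sum>j = 1..N. if ?C then of_nat (lookup \<mu> (N - j)) * ?c else 0)"
    by (rule sum.cong[OF refl summand])
  show ?thesis
  proof (cases ?C)
    case C: True
    have "(\<Sum>j = 1..N. lookup \<mu> (N - j)) = (\<Sum>i<N. lookup \<mu> i)"
      by (rule sum.reindex_bij_witness[where i = "\<lambda>i. N - i" and j = "\<lambda>i. N - i"]) auto
    then have td: "(\<Sum>j = 1..N. lookup \<mu> (N - j)) = total_degree \<mu>"
      using C total_degree_alt[of \<mu> N] by simp
    have "(\<Sum>j = 1..N. if ?C then of_nat (lookup \<mu> (N - j)) * ?c else 0)
        = (\<Sum>j = 1..N. of_nat (lookup \<mu> (N - j))) * ?c"
      unfolding if_P[OF C] sum_distrib_right ..
    also have "(\<Sum>j = 1..N. of_nat (lookup \<mu> (N - j))) = (of_nat (total_degree \<mu>) :: complex)"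
      unfolding td[symmetric] of_nat_sum ..
    finally have sum': "(\<Sum>j = 1..N. if ?C then of_nat (lookup \<mu> (N - j)) * ?c else 0) = of_nat (total_degree \<mu>) * ?c" .
    have main: "flat_coeff N (Suc (Suc m)) n \<mu> = fact (total_degree \<mu> + n) / fact n * inv_facts N \<mu>"
      unfolding flat_coeff_def if_P[OF C] ..
    show ?thesis
    proof (cases n)
      case 0
      with C have "\<mu> \<noteq> 0"
        by (auto simp: flat_weight_def)
      then obtain i where "lookup \<mu> i \<noteq> 0"
        by (metis lookup_zero poly_mapping_eqI)
      then have "total_degree \<mu> > 0"
        using single_decomp[of \<mu> i] total_degree_add_single by fastforce
      then have "fact (total_degree \<mu>) = (of_nat (total_degree \<mu>) * fact (total_degree \<mu> - 1) :: complex)"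
        by (rule fact_reduce)
      then show ?thesis
        unfolding sum sum' main unfolding 0 by simp
    next
      case (Suc n')
      note main
      moreover have "flat_coeff N (Suc m) n' \<mu> = fact (total_degree \<mu> + n') / fact n' * inv_facts N \<mu>"
      proof -
        have "keys \<mu> \<subseteq> {..<N} \<and> n' + 1 + flat_weight N \<mu> = Suc m"
          using C Suc by simp
        then show ?thesis
          unfolding flat_coeff_def by (rule if_P)
      qed
      \<comment> \<open>Pascal's rule: in the factor \<open>T + n\<close> of the factorial, with
        \<open>T\<close> the total degree, the part \<open>n\<close> yields the term of
        \<open>x\<close> and the part \<open>T\<close> the terms of the variables.\<close>
      moreover have "fact (total_degree \<mu> + n) / fact n
          = fact (total_degree \<mu> + n') / fact n' + of_nat (total_degree \<mu>) * (fact (total_degree \<mu> + n - 1) / fact n :: complex)"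
      proof -
        have "(T + x) * f / (x * g) = f / g + T * (f / (x * g))" if "x \<noteq> 0" "g \<noteq> 0" for T x f g :: complex
          using that by (simp add: field_simps)
        from this[of "of_nat (Suc n')" "fact n'" "of_nat (total_degree \<mu>)" "fact (total_degree \<mu> + n')"]
        show ?thesis
          by (simp add: Suc of_nat_eq_0_iff del: of_nat_Suc flip: of_nat_add)
      qed
      ultimately show ?thesis
        unfolding sum sum' by (simp only: Suc nat.distinct if_False diff_Suc_1 distrib_right mult.assoc)
    qed
  next
    case False
    then have "flat_coeff N (Suc m) (n - 1) \<mu> = 0" if "n \<noteq> 0"
      using that by (auto simp: flat_coeff_def)
    moreover have "flat_coeff N (Suc (Suc m)) n \<mu> = 0"
      unfolding flat_coeff_def by (rule if_not_P[OF False])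
    ultimately show ?thesis
      unfolding sum if_not_P[OF False] by simp
  qed
qed

abbreviation flat_frame :: "nat \<Rightarrow> nat \<Rightarrow> complex mps poly" where
  "flat_frame N \<equiv> flat_poly (flat_coord N) N"

lemma mcoeff_flat_frame: "mcoeff (coeff (flat_frame N a) n) \<mu> = flat_coeff N a n \<mu>"
proof (induction a arbitrary: n \<mu> rule: less_induct)
  case (less a)
  show ?case
  proof (cases a rule: flat_poly.cases)
    case 1
    then show ?thesis
      by (simp add: flat_coeff_def)
  next
    case 2
    show ?thesis
    proof (cases "\<mu> = 0 \<and> n = 0")
      case True
      then show ?thesis
        by (simp add: 2 flat_coeff_def flat_weight_def total_degree_def inv_facts_def)
    next
      case False
      then have "flat_coeff N a n \<mu> = 0"
        using flat_weight_eq_0[of \<mu> N] 2 by (auto simp: flat_coeff_def)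
      then show ?thesis
        using False by (auto simp: 2 one_pCons coeff_pCons split: nat.split)
    qed
  next
    case (3 m)
    have 1: "mcoeff (coeff (flat_frame N a) n) \<mu> = (if n = 0 then 0 else mcoeff (coeff (flat_frame N (Suc m)) (n - 1)) \<mu>)
        + (\<Sum>j = 1..N. mcoeff (flat_coord N j * coeff (flat_frame N (Suc m - j)) n) \<mu>)"
      unfolding 3 flat_poly.simps coeff_add coeff_sum mcoeff_simps mcoeff_sum coeff_smult
      by (cases n) simp_all
    have IH: "mcoeff (coeff (flat_frame N (Suc m)) n) \<mu> = flat_coeff N (Suc m) n \<mu>"
      "mcoeff (coeff (flat_frame N (Suc m - j)) n) \<mu> = flat_coeff N (Suc m - j) n \<mu>" for n \<mu> j
      by (rule less.IH, simp add: 3)+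
    have "mcoeff (flat_coord N j * coeff (flat_frame N (Suc m - j)) n) \<mu>
        = (if lookup \<mu> (N - j) > 0
           then flat_coeff N (Suc m - j) n (\<mu> - Poly_Mapping.single (N - j) 1) else 0)" for j
      unfolding flat_coord_def[of N j] mcoeff_mvar_mult IH by simp
    with 1 show ?thesis
      unfolding IH 3 flat_coeff_rec[of N m n \<mu>] by (simp only:)
  qed
qed

section \<open>Comparison with the given change of coordinates\<close>

lemma mcoeff_v_of_t: "mcoeff (v_of_t N \<gamma>) \<mu> =
    (if keys \<mu> \<subseteq> {..<N} \<and> flat_weight N \<mu> = N + 2 - \<gamma>
     then fact (total_degree \<mu> + \<gamma> - 2) / fact (\<gamma> - 1) * inv_facts N \<mu> else 0)"
  by (simp only: v_of_t_def mcoeff_Abs_mps flat_weight_alt inv_facts_alt)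

text \<open>With \<open>x^(\<gamma>-1)\<close> standing for the vector field of
  \<open>v_\<gamma>\<close>, that of \<open>t_\<alpha>\<close> becomes \<open>Phi_\<alpha>\<close>.
  Differentiation lowers the degree by 1 and the weight by \<open>N + 2 - \<alpha>\<close>, which
  turns the coefficients of \<open>v_\<gamma>\<close> into those of the flat frame.\<close>

lemma pdiff_v_of_t:
  assumes "1 \<le> \<alpha>" "\<alpha> \<le> N" "1 \<le> \<gamma>" "\<gamma> \<le> N"
  shows "pdiff \<alpha> (v_of_t N \<gamma>) = coeff (flat_frame N \<alpha>) (\<gamma> - 1)"
proof (rule mps_eqI)
  fix \<mu>
  have lt: "\<alpha> - 1 < N"
    using assms by auto
  let ?e = "Poly_Mapping.single (\<alpha> - 1) (1::nat)"
  have C: "keys (\<mu> + ?e) \<subseteq> {..<N} \<and> flat_weight N (\<mu> + ?e) = N + 2 - \<gamma>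
      \<longleftrightarrow> keys \<mu> \<subseteq> {..<N} \<and> \<gamma> - 1 + 1 + flat_weight N \<mu> = \<alpha>"
    unfolding keys_add_single flat_weight_add_single[OF lt] using assms by auto
  have td: "total_degree (\<mu> + ?e) + \<gamma> - 2 = total_degree \<mu> + (\<gamma> - 1)"
    unfolding total_degree_add_single using assms by simp
  show "mcoeff (pdiff \<alpha> (v_of_t N \<gamma>)) \<mu> = mcoeff (coeff (flat_frame N \<alpha>) (\<gamma> - 1)) \<mu>"
    unfolding mcoeff_pdiff mcoeff_v_of_t mcoeff_flat_frame flat_coeff_def C td
      inv_facts_add_single[OF lt, of \<mu>, symmetric]
    by (simp only: mult_zero_right if_distrib[of "(*) _"]) (simp only: mult_ac)
qed

text \<open>These are the coefficients of the derivative of \<open>Lambda\<close> in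
  \<open>x\<close>, so the Jacobian ring is the quotient by \<open>Phi_(N+1)\<close>. The gap at
  \<open>n = N - 1\<close> comes from \<open>flat_weight_neq_1\<close>.\<close>

lemma coeff_flat_frame_top:
  assumes "N \<ge> 1"
  shows "coeff (flat_frame N (N + 1)) n
    = (if n = N then 1 else if n + 2 \<le> N then mps_const (of_nat (n + 1)) * v_of_t N (n + 2) else 0)"
proof (rule mps_eqI)
  fix \<mu>
  consider "n = N" | "n > N" | "n = N - 1" "n < N" | "n + 2 \<le> N"
    by linarith
  then show "mcoeff (coeff (flat_frame N (N + 1)) n) \<mu>
      = mcoeff (if n = N then 1 else if n + 2 \<le> N then mps_const (of_nat (n + 1)) * v_of_t N (n + 2) else 0) \<mu>"
  proof cases
    case 1
    then show ?thesis
      using coeff_flat_poly_top[of "flat_coord N" N N] by simp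
  next
    case 2
    then show ?thesis
      using coeff_flat_poly_ge[of "N + 1" n "flat_coord N" N] by simp
  next
    case 3
    then have "flat_coeff N (N + 1) n \<mu> = 0"
      using flat_weight_neq_1[of N \<mu>] assms by (auto simp: flat_coeff_def)
    with 3 show ?thesis
      by (simp only: mcoeff_flat_frame) auto
  next
    case 4
    have "x * (f / (x * g) * h) = f / g * h" if "x \<noteq> 0" for x f g h :: complex
      using that by simp
    from this[of "of_nat (Suc n)" "fact (total_degree \<mu> + n)" "fact n" "inv_facts N \<mu>"]
    have *: "of_nat (n + 1) * (fact (total_degree \<mu> + n) / fact (n + 1) * inv_facts N \<mu>)
        = fact (total_degree \<mu> + n) / fact n * inv_facts N \<mu>"
      by (simp add: of_nat_eq_0_iff del: of_nat_Suc)
    have "n + 1 + flat_weight N \<mu> = N + 1 \<longleftrightarrow> flat_weight N \<mu> = N + 2 - (n + 2)"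
      using 4 by auto
    then show ?thesis
      using 4 * by (simp add: mcoeff_flat_frame flat_coeff_def mcoeff_v_of_t)
  qed
qed

section \<open>Evaluation at a point\<close>

definition eval_poly :: "(nat \<Rightarrow> complex) \<Rightarrow> complex mps poly \<Rightarrow> complex poly" where
  "eval_poly t p = map_poly (\<lambda>F. poly_value F t) p"

text \<open>\<open>poly_value\<close> is shown to respect sums and products for polynomials only (a
  sum over an infinite support is 0 by convention), so this condition accompanies every
  specialisation.\<close>

definition poly_coeffs :: "nat \<Rightarrow> complex mps poly \<Rightarrow> bool" where
  "poly_coeffs N p \<longleftrightarrow> (\<forall>n. is_polynomial N (coeff p n))"

lemma coeff_eval_poly [simp]: "coeff (eval_poly t p) n = poly_value (coeff p n) t"
  by (simp add: eval_poly_def coeff_map_poly)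

lemma poly_coeffs_simps [simp]: "poly_coeffs N 0" "poly_coeffs N 1"
  by (auto simp: poly_coeffs_def of_bool_def)

lemma poly_coeffs_pCons [simp]: "poly_coeffs N (pCons a p) \<longleftrightarrow> is_polynomial N a \<and> poly_coeffs N p"
proof
  assume *: "poly_coeffs N (pCons a p)"
  show "is_polynomial N a \<and> poly_coeffs N p"
    unfolding poly_coeffs_def
    using *[unfolded poly_coeffs_def, rule_format, of 0] *[unfolded poly_coeffs_def, rule_format, of "Suc _"]
    by simp
qed (auto simp: poly_coeffs_def coeff_pCons split: nat.split)

lemma poly_coeffs_arith:
  assumes "poly_coeffs N p" "poly_coeffs N q"
  shows "poly_coeffs N (p + q)" "poly_coeffs N (p - q)" "poly_coeffs N (p * q)"
    "is_polynomial N c \<Longrightarrow> poly_coeffs N (smult c p)"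
  using assms by (auto simp: poly_coeffs_def coeff_mult)

lemma poly_coeffs_sum: "(\<And>i. i \<in> I \<Longrightarrow> poly_coeffs N (f i)) \<Longrightarrow> poly_coeffs N (\<Sum>i\<in>I. f i)"
  by (induction I rule: infinite_finite_induct) (auto intro: poly_coeffs_arith)

lemma eval_poly_add:
  assumes "poly_coeffs N p" "poly_coeffs N q"
  shows "eval_poly t (p + q) = eval_poly t p + eval_poly t q"
  using assms by (auto simp: poly_eq_iff poly_coeffs_def intro!: poly_value_add[of N])

lemma eval_poly_mult:
  assumes "poly_coeffs N p" "poly_coeffs N q"
  shows "eval_poly t (p * q) = eval_poly t p * eval_poly t q"
proof (rule poly_eqI)
  fix n
  have "poly_value (\<Sum>i\<le>n. coeff p i * coeff q (n - i)) t
      = (\<Sum>i\<le>n. poly_value (coeff p i * coeff q (n - i)) t)"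
    by (rule poly_value_sum[of _ N]) (use assms in \<open>auto simp: poly_coeffs_def\<close>)
  also have "\<dots> = (\<Sum>i\<le>n. poly_value (coeff p i) t * poly_value (coeff q (n - i)) t)"
    by (rule sum.cong[OF refl], rule poly_value_mult[of N]) (use assms in \<open>auto simp: poly_coeffs_def\<close>)
  finally show "coeff (eval_poly t (p * q)) n = coeff (eval_poly t p * eval_poly t q) n"
    by (simp add: coeff_mult)
qed

lemma poly_coeffs_flat_frame: "poly_coeffs N (flat_frame N a)"
proof (induction a rule: less_induct)
  case (less a)
  show ?case
  proof (cases a rule: flat_poly.cases)
    case (3 m)
    have IH: "poly_coeffs N (flat_frame N (Suc m - j))" "poly_coeffs N (flat_frame N (Suc m))" for j
      by (rule less.IH, simp add: 3)+
    have "is_polynomial N (flat_coord N j)" if "j \<in> {1..N}" for j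
      unfolding flat_coord_def using that by (intro is_polynomial_mvar) auto
    with IH show ?thesis
      unfolding 3 flat_poly.simps
      by (intro poly_coeffs_arith(1) poly_coeffs_sum poly_coeffs_arith(4)) auto
  qed simp_all
qed

text \<open>Long division by a monic polynomial, done before specialisation, so that one quotient
  and one remainder serve all points \<open>t\<close>.\<close>

lemma flat_frame_division:
  assumes "N \<ge> 1" "poly_coeffs N p"
  shows "\<exists>q r. poly_coeffs N q \<and> poly_coeffs N r \<and> p = flat_frame N (N + 1) * q + r \<and> (\<forall>n\<ge>N. coeff r n = 0)"
  using assms(2)
proof (induction p)
  case 0
  show ?case
    by (rule exI[of _ 0], rule exI[of _ 0]) simp
next
  case (pCons a p)
  let ?M = "flat_frame N (N + 1)"
  obtain q r where qr: "poly_coeffs N q" "poly_coeffs N r" "p = ?M * q + r" "\<forall>n\<ge>N. coeff r n = 0"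
    using pCons by auto
  \<comment> \<open>The coefficient of \<open>x^N\<close> in \<open>x r\<close>; subtracting
    \<open>?c\<close> times the monic divisor removes it.\<close>
  let ?c = "coeff r (N - 1)"
  have c: "is_polynomial N ?c"
    using qr(2) by (simp add: poly_coeffs_def)
  have "pCons a p = ?M * (pCons 0 q + [:?c:]) + (pCons a r - smult ?c ?M)"
    by (simp add: qr(3) algebra_simps)
  moreover have "coeff (pCons a r - smult ?c ?M) n = 0" if "n \<ge> N" for n
  proof (cases "n = N")
    case True
    then show ?thesis
      using assms(1) coeff_flat_poly_top[of "flat_coord N" N N] by (cases N) (auto simp: coeff_pCons)
  next
    case False
    then show ?thesis
      using that qr(4) coeff_flat_poly_ge[of "N + 1" n "flat_coord N" N] by (cases n) auto
  qed
  moreover have "poly_coeffs N (pCons 0 q + [:?c:])"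
    using qr c by (intro poly_coeffs_arith) auto
  moreover have "poly_coeffs N (pCons a r - smult ?c ?M)"
    using qr c pCons.prems poly_coeffs_flat_frame by (intro poly_coeffs_arith) auto
  ultimately show ?case
    by blast
qed

section \<open>The structure constants\<close>

definition Lambda_x :: "nat \<Rightarrow> (nat \<Rightarrow> complex) \<Rightarrow> complex poly" where
  "Lambda_x N v = monom (1 / of_nat (N + 1)) (N + 1) + (\<Sum>k = 1..N. monom (v k) (k - 1))"

text \<open>The identification of tangent vectors with elements of the Jacobian ring.\<close>

definition vector_poly :: "nat \<Rightarrow> (nat \<Rightarrow> complex) \<Rightarrow> complex poly" where
  "vector_poly N X = (\<Sum>a = 1..N. monom (X a) (a - 1))"

lemma coeff_vector_poly: "coeff (vector_poly N X) n = (if n < N then X (n + 1) else 0)"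
proof -
  have "coeff (vector_poly N X) n = (\<Sum>a = 1..N. if a = Suc n then X (n + 1) else 0)"
    unfolding vector_poly_def coeff_sum by (rule sum.cong) auto
  then show ?thesis
    by simp
qed

lemma var_x_power: "var_x ^ n = [:monom 1 n:]"
  by (induction n) (auto simp: var_x_def monom_Suc one_pCons)

lemma xy_const_var_x: "xy_const c * var_x ^ n = [:monom c n:]"
  by (simp add: var_x_power xy_const_def smult_monom)

lemma sum_pCons_0: "(\<Sum>i\<in>I. [:f i:]) = [:\<Sum>i\<in>I. f i:]"
  by (induction I rule: infinite_finite_induct) auto

lemma Lambda_eq: "Lambda N v = [:Lambda_x N v, 0, 1:]"
  unfolding Lambda_def xy_const_var_x sum_pCons_0 Lambda_x_def by (simp add: var_y_def power2_eq_square)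

text \<open>The derivative of \<open>Lambda\<close> in \<open>y\<close> is \<open>2 y\<close>.
  Setting \<open>y = 0\<close> kills its multiples and leaves an ideal in one variable.\<close>

lemma const_in_jacobian_ideal: "[:h:] \<in> jacobian_ideal N v \<longleftrightarrow> pderiv (Lambda_x N v) dvd h"
proof -
  have x: "diff_x (Lambda N v) = [:pderiv (Lambda_x N v):]"
    by (rule poly_eqI) (auto simp: diff_x_def Lambda_eq coeff_map_poly coeff_pCons split: nat.split)
  have y: "diff_y (Lambda N v) = [:0, 2:]"
    by (simp add: diff_y_def Lambda_eq pderiv_pCons)
  show ?thesis
  proof
    assume "[:h:] \<in> jacobian_ideal N v"
    then obtain p q where "[:h:] = p * [:pderiv (Lambda_x N v):] + q * [:0, 2:]"
      unfolding jacobian_ideal_def x y by blast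
    then have "coeff [:h:] 0 = coeff (p * [:pderiv (Lambda_x N v):] + q * [:0, 2:]) 0"
      by simp
    then have "h = coeff p 0 * pderiv (Lambda_x N v)"
      by (simp add: coeff_mult_0)
    then show "pderiv (Lambda_x N v) dvd h"
      by simp
  next
    assume "pderiv (Lambda_x N v) dvd h"
    then obtain k where "h = k * pderiv (Lambda_x N v)"
      by (metis dvdE mult.commute)
    then have "[:h:] = [:k:] * diff_x (Lambda N v) + 0 * diff_y (Lambda N v)"
      by (simp add: x)
    then show "[:h:] \<in> jacobian_ideal N v"
      unfolding jacobian_ideal_def by blast
  qed
qed

lemma coeff_pderiv_Lambda_x:
  "coeff (pderiv (Lambda_x N v)) n = (if n = N then 1 else if n + 2 \<le> N then of_nat (n + 1) * v (n + 2) else 0)"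
proof -
  have *: "Lambda_x N v = monom (1 / of_nat (N + 1)) (N + 1) + vector_poly N v"
    by (simp add: Lambda_x_def vector_poly_def)
  have "of_nat (Suc N) \<noteq> (0 :: complex)"
    by (simp only: of_nat_eq_0_iff)
  then show ?thesis
    by (auto simp: coeff_pderiv * coeff_vector_poly simp del: of_nat_Suc)
qed

lemma degree_pderiv_Lambda_x: "degree (pderiv (Lambda_x N v)) = N"
  by (rule antisym[OF degree_le le_degree]) (auto simp: coeff_pderiv_Lambda_x)

text \<open>The modulus has degree \<open>N\<close>, so remainders are the unique representatives in
  the span of \<open>1, ..., x^(N-1)\<close>. This is what gives the definite description its
  value.\<close>

lemma struct_const_eq:
  assumes "N \<ge> 1" "1 \<le> k" "k \<le> N"
  shows "struct_const N v a b k
    = coeff ((monom 1 (a - 1) * monom 1 (b - 1)) mod pderiv (Lambda_x N v)) (k - 1)"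
proof -
  let ?M = "pderiv (Lambda_x N v)" and ?X = "monom 1 (a - 1) * monom 1 (b - 1) :: complex poly"
  have M: "?M \<noteq> 0"
    using degree_pderiv_Lambda_x[of N v] assms(1) by auto
  have small: "vector_poly N c mod ?M = vector_poly N c" for c
  proof (rule mod_poly_less)
    have "degree (vector_poly N c) \<le> N - 1"
      by (rule degree_le) (auto simp: coeff_vector_poly)
    then show "degree (vector_poly N c) < degree ?M"
      using assms(1) by (simp add: degree_pderiv_Lambda_x)
  qed
  have mem: "var_x ^ (a - 1) * var_x ^ (b - 1) - (\<Sum>k = 1..N. xy_const (c k) * var_x ^ (k - 1)) \<in> jacobian_ideal N v
      \<longleftrightarrow> ?X mod ?M = vector_poly N c" for c
  proof -
    have "var_x ^ (a - 1) * var_x ^ (b - 1) - (\<Sum>k = 1..N. xy_const (c k) * var_x ^ (k - 1)) = [:?X - vector_poly N c:]"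
      unfolding xy_const_var_x unfolding sum_pCons_0 var_x_power vector_poly_def by simp
    then show ?thesis
      by (simp only: const_in_jacobian_ideal small flip: mod_eq_dvd_iff)
  qed
  define c where "c k = (if k \<in> {1..N} then coeff (?X mod ?M) (k - 1) else 0)" for k
  have deg: "coeff (?X mod ?M) n = 0" if "n \<ge> N" for n
    by (rule coeff_eq_0) (use that degree_mod_less[OF M, of ?X] assms(1) degree_pderiv_Lambda_x[of N v] in auto)
  have "struct_const N v a b = c"
    unfolding struct_const_def mem
  proof (rule the_equality)
    show "(\<forall>k. k \<notin> {1..N} \<longrightarrow> c k = 0) \<and> ?X mod ?M = vector_poly N c"
      using deg by (auto simp: c_def poly_eq_iff coeff_vector_poly simp del: One_nat_def)
  next
    fix c' assume c': "(\<forall>k. k \<notin> {1..N} \<longrightarrow> c' k = 0) \<and> ?X mod ?M = vector_poly N c'"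
    show "c' = c"
      using c' by (auto simp: c_def coeff_vector_poly fun_eq_iff)
  qed
  then show ?thesis
    using assms by (simp add: c_def)
qed

lemma poly_mod_sum: "(\<Sum>i\<in>I. f i) mod M = (\<Sum>i\<in>I. f i mod M)" for M :: "complex poly"
  by (induction I rule: infinite_finite_induct) (auto simp: poly_mod_add_left)

lemma sum_struct_const:
  assumes "N \<ge> 1" "1 \<le> k" "k \<le> N"
  shows "(\<Sum>a = 1..N. \<Sum>b = 1..N. X a * Y b * struct_const N v a b k)
    = coeff ((vector_poly N X * vector_poly N Y) mod pderiv (Lambda_x N v)) (k - 1)"
proof -
  have "vector_poly N X * vector_poly N Y
      = (\<Sum>a = 1..N. \<Sum>b = 1..N. smult (X a * Y b) (monom 1 (a - 1) * monom 1 (b - 1)))"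
    unfolding vector_poly_def sum_product by (intro sum.cong refl) (simp add: mult_monom smult_monom)
  then show ?thesis
    by (simp add: poly_mod_sum mod_smult_left coeff_sum struct_const_eq[OF assms])
qed

lemma vector_poly_vprod:
  assumes "N \<ge> 1"
  shows "vector_poly N (vprod N v X Y) = (vector_poly N X * vector_poly N Y) mod pderiv (Lambda_x N v)"
proof (rule poly_eqI)
  fix n
  let ?M = "pderiv (Lambda_x N v)" and ?X = "vector_poly N X * vector_poly N Y"
  have M: "?M \<noteq> 0"
    using degree_pderiv_Lambda_x[of N v] assms(1) by auto
  have deg: "coeff (?X mod ?M) n = 0" if "n \<ge> N" for n
    by (rule coeff_eq_0) (use that degree_mod_less[OF M, of ?X] assms(1) degree_pderiv_Lambda_x[of N v] in auto)
  show "coeff (vector_poly N (vprod N v X Y)) n = coeff (?X mod ?M) n"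
    using sum_struct_const[OF assms, of "n + 1" X Y v] deg[of n] by (auto simp: coeff_vector_poly vprod_def)
qed

lemma eta_vprod:
  assumes "N \<ge> 1"
  shows "eta N v (vprod N v X Y) Z
    = coeff ((vector_poly N X * vector_poly N Y * vector_poly N Z) mod pderiv (Lambda_x N v)) (N - 1)"
  unfolding eta_def sum_struct_const[OF assms assms order_refl] vector_poly_vprod[OF assms] mod_mult_left_eq ..

lemma poly_value_const_mult: "poly_value (mps_const c * F) t = c * poly_value F t" for c :: complex
  by (cases "c = 0") (simp_all add: mps_const_simps poly_value_def sum_distrib_left mult.assoc)

lemma pderiv_Lambda_x_v_point:
  "N \<ge> 1 \<Longrightarrow> pderiv (Lambda_x N (v_point N t)) = eval_poly t (flat_frame N (N + 1))"
  by (rule poly_eqI) (simp only: coeff_pderiv_Lambda_x coeff_eval_poly coeff_flat_frame_top v_point_def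
      poly_value_const_mult poly_value_1 poly_value_0 if_distrib[of "\<lambda>F. poly_value F t"])

lemma vector_poly_t_frame:
  assumes "1 \<le> \<alpha>" "\<alpha> \<le> N"
  shows "vector_poly N (t_frame N t \<alpha>) = eval_poly t (flat_frame N \<alpha>)"
proof (rule poly_eqI)
  fix n
  show "coeff (vector_poly N (t_frame N t \<alpha>)) n = coeff (eval_poly t (flat_frame N \<alpha>)) n"
  proof (cases "n < N")
    case True
    then show ?thesis
      using pdiff_v_of_t[of \<alpha> N "n + 1"] assms by (simp add: coeff_vector_poly t_frame_def)
  next
    case False
    then show ?thesis
      using coeff_flat_poly_ge[of \<alpha> n "flat_coord N" N] assms by (simp add: coeff_vector_poly)
  qed
qed

text \<open>Both sides read the coefficient of \<open>x^(N-1)\<close> in the remainder of a triple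
  product modulo \<open>Phi_(N+1)\<close>: the residue does so over the ring of series, the pairing
  after specialisation at \<open>t\<close>.\<close>

lemma three_point_value:
  assumes "N \<ge> 1" "\<alpha> \<in> {1..N}" "\<beta> \<in> {1..N}" "\<gamma> \<in> {1..N}"
  shows "is_polynomial N (three_point (flat_coord N) N \<alpha> \<beta> \<gamma>)"
    and "poly_value (three_point (flat_coord N) N \<alpha> \<beta> \<gamma>) t =
          eta N (v_point N t)
            (vprod N (v_point N t) (t_frame N t \<alpha>) (t_frame N t \<beta>)) (t_frame N t \<gamma>)"
proof -
  let ?P = "flat_frame N" and ?M = "flat_frame N (N + 1)"
  note pc = poly_coeffs_flat_frame[of N]
  have "poly_coeffs N (?P \<alpha> * ?P \<beta> * ?P \<gamma>)"
    by (intro poly_coeffs_arith pc)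
  then obtain q r where qr: "poly_coeffs N q" "poly_coeffs N r"
      "?P \<alpha> * ?P \<beta> * ?P \<gamma> = ?M * q + r" "\<And>n. n \<ge> N \<Longrightarrow> coeff r n = 0"
    using flat_frame_division[OF assms(1)] by blast
  have c: "three_point (flat_coord N) N \<alpha> \<beta> \<gamma> = coeff r (N - 1)"
    using res_div[OF qr(3,4) assms(1)] by (simp add: three_point_def frame_def laurent_mult)
  then show "is_polynomial N (three_point (flat_coord N) N \<alpha> \<beta> \<gamma>)"
    using qr(2) by (simp add: poly_coeffs_def)
  have ev: "eval_poly t (?P \<alpha>) * eval_poly t (?P \<beta>) * eval_poly t (?P \<gamma>) = eval_poly t ?M * eval_poly t q + eval_poly t r"
  proof -
    have "eval_poly t (?P \<alpha> * ?P \<beta> * ?P \<gamma>) = eval_poly t (?M * q + r)"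
      unfolding qr(3) ..
    moreover have "eval_poly t (?P \<alpha> * ?P \<beta> * ?P \<gamma>) = eval_poly t (?P \<alpha>) * eval_poly t (?P \<beta>) * eval_poly t (?P \<gamma>)"
      using eval_poly_mult[OF poly_coeffs_arith(3)[OF pc pc] pc] eval_poly_mult[OF pc pc] by simp
    moreover have "eval_poly t (?M * q + r) = eval_poly t ?M * eval_poly t q + eval_poly t r"
      using eval_poly_add[OF poly_coeffs_arith(3)[OF pc qr(1)] qr(2)] eval_poly_mult[OF pc qr(1)] by simp
    ultimately show ?thesis
      by simp
  qed
  have M: "eval_poly t ?M = pderiv (Lambda_x N (v_point N t))"
    using pderiv_Lambda_x_v_point[OF assms(1)] by simp
  have "eval_poly t r mod eval_poly t ?M = eval_poly t r"
  proof (rule mod_poly_less)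
    have "degree (eval_poly t r) \<le> N - 1"
      by (rule degree_le) (auto simp: qr(4))
    then show "degree (eval_poly t r) < degree (eval_poly t ?M)"
      unfolding M degree_pderiv_Lambda_x using assms(1) by simp
  qed
  then have "(eval_poly t (?P \<alpha>) * eval_poly t (?P \<beta>) * eval_poly t (?P \<gamma>)) mod eval_poly t ?M = eval_poly t r"
    unfolding ev by simp
  then show "poly_value (three_point (flat_coord N) N \<alpha> \<beta> \<gamma>) t =
          eta N (v_point N t)
            (vprod N (v_point N t) (t_frame N t \<alpha>) (t_frame N t \<beta>)) (t_frame N t \<gamma>)"
    using assms(2-4) unfolding eta_vprod[OF assms(1)] by (simp add: vector_poly_t_frame c flip: M)
qed

section \<open>The potential\<close>

text \<open>The primitive without constant term of the closed form \<open>\<Sum>\<^sub>\<alpha> g\<^sub>\<alpha> dt\<^sub>\<alpha>\<close>, by Euler's formula.\<close>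

definition primitive :: "nat \<Rightarrow> (nat \<Rightarrow> complex mps) \<Rightarrow> complex mps" where
  "primitive N g = Abs_mps (\<lambda>\<mu>. if keys \<mu> \<subseteq> {..<N}
     then (\<Sum>i\<in>keys \<mu>. mcoeff (g (i + 1)) (\<mu> - Poly_Mapping.single i 1)) / of_nat (total_degree \<mu>)
     else 0)"

lemma mcoeff_primitive_0 [simp]: "mcoeff (primitive N g) 0 = 0"
  by (simp add: primitive_def)

lemma primitive_polynomial:
  assumes "\<And>\<alpha>. \<alpha> \<in> {1..N} \<Longrightarrow> is_polynomial N (g \<alpha>)"
  shows "is_polynomial N (primitive N g)"
proof -
  let ?A = "\<Union>i<N. (\<lambda>\<nu>. \<nu> + Poly_Mapping.single i 1) ` {\<nu>. mcoeff (g (i + 1)) \<nu> \<noteq> 0}"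
  have "\<mu> \<in> ?A" if nz: "mcoeff (primitive N g) \<mu> \<noteq> 0" for \<mu>
  proof -
    have "keys \<mu> \<subseteq> {..<N}"
      using nz by (auto simp: primitive_def split: if_splits)
    moreover have "(\<Sum>i\<in>keys \<mu>. mcoeff (g (i + 1)) (\<mu> - Poly_Mapping.single i 1)) \<noteq> 0"
      using nz by (auto simp: primitive_def split: if_splits)
    then obtain i where "i \<in> keys \<mu>" "mcoeff (g (i + 1)) (\<mu> - Poly_Mapping.single i 1) \<noteq> 0"
      by (metis (no_types, lifting) sum.neutral)
    moreover have "\<mu> - Poly_Mapping.single i 1 + Poly_Mapping.single i 1 = \<mu>"
      using \<open>i \<in> keys \<mu>\<close> by (intro single_add_diff) (simp add: in_keys_iff)
    ultimately show ?thesis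
      by (intro UN_I[of i] image_eqI[of _ _ "\<mu> - Poly_Mapping.single i 1"]) auto
  qed
  then have "{\<mu>. mcoeff (primitive N g) \<mu> \<noteq> 0} \<subseteq> ?A"
    by blast
  moreover have "finite ?A"
    using assms by (intro finite_UN_I finite_imageI is_polynomialD[of N]) auto
  ultimately have "finite {\<mu>. mcoeff (primitive N g) \<mu> \<noteq> 0}"
    by (rule finite_subset)
  then show ?thesis
    by (auto simp: is_polynomial_def primitive_def split: if_splits)
qed

lemma pdiff_primitive:
  assumes poly: "\<And>\<alpha>. \<alpha> \<in> {1..N} \<Longrightarrow> is_polynomial N (g \<alpha>)"
    and closed: "\<And>\<alpha> \<beta>. \<alpha> \<in> {1..N} \<Longrightarrow> \<beta> \<in> {1..N} \<Longrightarrow> pdiff \<alpha> (g \<beta>) = pdiff \<beta> (g \<alpha>)"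
    and \<alpha>: "\<alpha> \<in> {1..N}"
  shows "pdiff \<alpha> (primitive N g) = g \<alpha>"
proof (rule mps_eqI)
  fix \<mu>
  let ?k = "\<alpha> - 1"
  let ?e = "Poly_Mapping.single ?k (1::nat)"
  have \<alpha>k: "?k + 1 = \<alpha>" "?k < N"
    using \<alpha> by auto
  show "mcoeff (pdiff \<alpha> (primitive N g)) \<mu> = mcoeff (g \<alpha>) \<mu>"
  proof (cases "keys \<mu> \<subseteq> {..<N}")
    case True
    then have keys: "keys (\<mu> + ?e) \<subseteq> {..<N}"
      unfolding keys_add_single using \<alpha>k by simp
    \<comment> \<open>Closedness rewrites every summand as an exponent times the same coefficient of
      \<open>g \<alpha>\<close>; the exponents then add up to the total degree in the
      denominator.\<close>
    have summand: "of_nat (lookup \<mu> ?k + 1) * mcoeff (g (i + 1)) (\<mu> + ?e - Poly_Mapping.single i 1)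
        = of_nat (lookup (\<mu> + ?e) i) * mcoeff (g \<alpha>) \<mu>" if i: "i \<in> keys (\<mu> + ?e)" for i
    proof (cases "i = ?k")
      case True
      then show ?thesis
        using \<alpha>k by (simp add: lookup_add)
    next
      case False
      then have "lookup \<mu> i > 0"
        using i by (simp add: in_keys_iff lookup_add lookup_single when_def)
      then obtain \<nu> where \<nu>: "\<mu> = \<nu> + Poly_Mapping.single i 1"
        using single_decomp by blast
      have "i + 1 \<in> {1..N}"
        using i keys by auto
      then have "mcoeff (pdiff \<alpha> (g (i + 1))) \<nu> = mcoeff (pdiff (i + 1) (g \<alpha>)) \<nu>"
        using closed[OF \<alpha>] by simp
      then have "of_nat (lookup \<nu> ?k + 1) * mcoeff (g (i + 1)) (\<nu> + ?e) = of_nat (lookup \<nu> i + 1) * mcoeff (g \<alpha>) \<mu>"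
        by (simp add: mcoeff_pdiff \<nu>)
      moreover have "\<mu> + ?e - Poly_Mapping.single i 1 = \<nu> + ?e"
      proof -
        have "\<mu> + ?e = \<nu> + ?e + Poly_Mapping.single i 1"
          by (simp add: \<nu> ac_simps)
        then show ?thesis
          by simp
      qed
      moreover have "lookup \<nu> ?k = lookup \<mu> ?k" "lookup (\<mu> + ?e) i = lookup \<nu> i + 1"
        using False by (auto simp: \<nu> lookup_add lookup_single when_def)
      ultimately show ?thesis
        by simp
    qed
    have "of_nat (lookup \<mu> ?k + 1) * (\<Sum>i\<in>keys (\<mu> + ?e). mcoeff (g (i + 1)) (\<mu> + ?e - Poly_Mapping.single i 1))
        = (\<Sum>i\<in>keys (\<mu> + ?e). of_nat (lookup (\<mu> + ?e) i)) * mcoeff (g \<alpha>) \<mu>"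
      unfolding sum_distrib_left sum_distrib_right by (rule sum.cong[OF refl summand])
    also have "(\<Sum>i\<in>keys (\<mu> + ?e). of_nat (lookup (\<mu> + ?e) i)) = (of_nat (total_degree (\<mu> + ?e)) :: complex)"
      by (simp only: total_degree_def of_nat_sum)
    finally have eq: "of_nat (lookup \<mu> ?k + 1) * (\<Sum>i\<in>keys (\<mu> + ?e). mcoeff (g (i + 1)) (\<mu> + ?e - Poly_Mapping.single i 1))
        = of_nat (total_degree (\<mu> + ?e)) * mcoeff (g \<alpha>) \<mu>" .
    have "of_nat (total_degree (\<mu> + ?e)) \<noteq> (0 :: complex)"
      unfolding of_nat_eq_0_iff total_degree_add_single by simp
    then show ?thesis
      unfolding mcoeff_pdiff primitive_def mcoeff_Abs_mps if_P[OF keys] times_divide_eq_right eq by simp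
  next
    case False
    then have "\<not> keys (\<mu> + ?e) \<subseteq> {..<N}"
      unfolding keys_add_single by auto
    moreover have "mcoeff (g \<alpha>) \<mu> = 0"
      using False poly[OF \<alpha>] by (auto simp: is_polynomial_def)
    ultimately show ?thesis
      by (simp only: mcoeff_pdiff primitive_def mcoeff_Abs_mps if_False mult_zero_right)
  qed
qed

lemma polynomial_eqI_pdiff:
  assumes "is_polynomial N F" "is_polynomial N G" "mcoeff F 0 = mcoeff G 0"
    and "\<And>\<alpha>. \<alpha> \<in> {1..N} \<Longrightarrow> pdiff \<alpha> F = pdiff \<alpha> (G :: complex mps)"
  shows "F = G"
proof (rule mps_eqI)
  fix \<mu>
  show "mcoeff F \<mu> = mcoeff G \<mu>"
  proof (cases "\<mu> = 0 \<or> \<not> keys \<mu> \<subseteq> {..<N}")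
    case True
    then show ?thesis
      using assms(1-3) unfolding is_polynomial_def by metis
  next
    case False
    then obtain i where i: "i \<in> keys \<mu>"
      by (metis all_not_in_conv keys_eq_empty)
    then have "lookup \<mu> i > 0"
      by (simp add: in_keys_iff)
    then obtain \<nu> where \<nu>: "\<mu> = \<nu> + Poly_Mapping.single i 1"
      using single_decomp by blast
    have "i + 1 \<in> {1..N}"
      using i False by auto
    then have "mcoeff (pdiff (i + 1) F) \<nu> = mcoeff (pdiff (i + 1) G) \<nu>"
      using assms(4) by simp
    moreover have "of_nat (lookup \<nu> i + 1) \<noteq> (0 :: complex)"
      unfolding of_nat_eq_0_iff by simp
    ultimately show ?thesis
      unfolding mcoeff_pdiff \<nu> by (simp del: of_nat_add)
  qed
qed

lemma mcoeff_pdiff_eq_0_iff: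
  "mcoeff (pdiff (i + 1) F) \<mu> = 0 \<longleftrightarrow> mcoeff F (\<mu> + Poly_Mapping.single i 1) = (0 :: complex)"
proof -
  have "of_nat (lookup \<mu> i + 1) \<noteq> (0 :: complex)"
    unfolding of_nat_eq_0_iff by simp
  then show ?thesis
    by (simp add: mcoeff_pdiff del: of_nat_add)
qed

section \<open>The potential as a threefold primitive of the residues\<close>

abbreviation A_three_point :: "nat \<Rightarrow> nat \<Rightarrow> nat \<Rightarrow> nat \<Rightarrow> complex mps" where
  "A_three_point N \<equiv> three_point (flat_coord N) N"

lemma A_three_point_closed:
  assumes "a \<in> {1..N}" "b \<in> {1..N}" "\<gamma> \<in> {1..N}" "\<delta> \<in> {1..N}"
  shows "pdiff \<delta> (A_three_point N a b \<gamma>) = pdiff \<gamma> (A_three_point N a b \<delta>)"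
  using three_point_integrable[of "pdiff \<delta>" N "flat_coord N" "N + 1 - \<delta>" "pdiff \<gamma>" "N + 1 - \<gamma>" a b]
    assms by (auto simp: derivation_pdiff pdiff_flat_coord)

definition A_potential :: "nat \<Rightarrow> complex mps" where
  "A_potential N = primitive N (\<lambda>\<alpha>. primitive N (\<lambda>\<beta>. primitive N (\<lambda>\<gamma>. A_three_point N \<alpha> \<beta> \<gamma>)))"

lemma A_potential:
  assumes N: "N \<ge> 1"
  shows "is_polynomial N (A_potential N)"
    and "\<And>\<mu>. total_degree \<mu> \<le> 2 \<Longrightarrow> mcoeff (A_potential N) \<mu> = 0"
    and "\<And>\<alpha> \<beta> \<gamma>. \<alpha> \<in> {1..N} \<Longrightarrow> \<beta> \<in> {1..N} \<Longrightarrow> \<gamma> \<in> {1..N} \<Longrightarrow>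
      pdiff \<alpha> (pdiff \<beta> (pdiff \<gamma> (A_potential N))) = A_three_point N \<alpha> \<beta> \<gamma>"
proof -
  define S where "S \<alpha> \<beta> = primitive N (\<lambda>\<gamma>. A_three_point N \<alpha> \<beta> \<gamma>)" for \<alpha> \<beta>
  define T where "T \<alpha> = primitive N (\<lambda>\<beta>. S \<alpha> \<beta>)" for \<alpha>
  have pot: "A_potential N = primitive N T"
    unfolding A_potential_def T_def[abs_def] S_def[abs_def] ..
  have S: "pdiff \<gamma> (S \<alpha> \<beta>) = A_three_point N \<alpha> \<beta> \<gamma>" "is_polynomial N (S \<alpha> \<beta>)"
    if "\<alpha> \<in> {1..N}" "\<beta> \<in> {1..N}" "\<gamma> \<in> {1..N}" for \<alpha> \<beta> \<gamma>
    unfolding S_def using that three_point_value(1)[OF N] A_three_point_closed[of \<alpha> N \<beta>]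
    by (auto intro!: pdiff_primitive primitive_polynomial)
  have S_sym: "S \<alpha> \<beta> = S \<beta> \<alpha>" for \<alpha> \<beta>
    by (simp add: S_def three_point_sym(1)[of _ _ \<alpha> \<beta>])
  have T: "pdiff \<beta> (T \<alpha>) = S \<alpha> \<beta>" "is_polynomial N (T \<alpha>)"
    if "\<alpha> \<in> {1..N}" "\<beta> \<in> {1..N}" for \<alpha> \<beta>
    unfolding T_def using that S three_point_sym(2)
    by (auto intro!: pdiff_primitive primitive_polynomial)
  have U: "pdiff \<alpha> (A_potential N) = T \<alpha>" "is_polynomial N (A_potential N)" if "\<alpha> \<in> {1..N}" for \<alpha>
    unfolding pot using that T S_sym
    by (auto intro!: pdiff_primitive primitive_polynomial)
  show "is_polynomial N (A_potential N)"
    using U(2)[of 1] N by simp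
  show "pdiff \<alpha> (pdiff \<beta> (pdiff \<gamma> (A_potential N))) = A_three_point N \<alpha> \<beta> \<gamma>"
    if "\<alpha> \<in> {1..N}" "\<beta> \<in> {1..N}" "\<gamma> \<in> {1..N}" for \<alpha> \<beta> \<gamma>
    using that U T S three_point_sym by metis
  show "mcoeff (A_potential N) \<mu> = 0" if td: "total_degree \<mu> \<le> 2" for \<mu>
  proof (rule ccontr)
    assume nz: "mcoeff (A_potential N) \<mu> \<noteq> 0"
    then have "keys \<mu> \<subseteq> {..<N}"
      using \<open>is_polynomial N (A_potential N)\<close> by (simp add: is_polynomial_def)
    \<comment> \<open>A nonzero coefficient survives differentiation by a variable of its monomial.
      All three primitives have constant term 0, so a variable can be removed three times and the
      degree is at least 3.\<close>
    have dec: "\<nu> = 0 \<or> (\<exists>i<N. \<exists>\<rho>. \<nu> = \<rho> + Poly_Mapping.single i 1 \<and> keys \<rho> \<subseteq> {..<N} \<and> total_degree \<nu> = Suc (total_degree \<rho>))"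
      if keys: "keys \<nu> \<subseteq> {..<N}" for \<nu>
    proof (cases "\<nu> = 0")
      case False
      then obtain i where i: "i \<in> keys \<nu>"
        by (metis all_not_in_conv keys_eq_empty)
      then have "lookup \<nu> i > 0"
        by (simp add: in_keys_iff)
      then obtain \<rho> where \<rho>: "\<nu> = \<rho> + Poly_Mapping.single i 1"
        using single_decomp by blast
      with i keys total_degree_add_single[of \<rho> i] keys_add_single[of \<rho> i] show ?thesis
        by (intro disjI2 exI[of _ i] conjI exI[of _ \<rho>]) auto
    qed simp
    have "\<mu> \<noteq> 0"
      using nz by (auto simp: pot)
    with dec[OF \<open>keys \<mu> \<subseteq> {..<N}\<close>] obtain i \<rho> where 1: "i < N" "\<mu> = \<rho> + Poly_Mapping.single i 1"
      "keys \<rho> \<subseteq> {..<N}" "total_degree \<mu> = Suc (total_degree \<rho>)"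
      by auto
    then have nzT: "mcoeff (T (i + 1)) \<rho> \<noteq> 0"
      using nz mcoeff_pdiff_eq_0_iff[of i "A_potential N" \<rho>] U(1)[of "i + 1"] by auto
    then have "\<rho> \<noteq> 0"
      by (auto simp: T_def)
    with dec[OF 1(3)] obtain j \<sigma> where 2: "j < N" "\<rho> = \<sigma> + Poly_Mapping.single j 1"
      "keys \<sigma> \<subseteq> {..<N}" "total_degree \<rho> = Suc (total_degree \<sigma>)"
      by auto
    then have nzS: "mcoeff (S (i + 1) (j + 1)) \<sigma> \<noteq> 0"
      using nzT mcoeff_pdiff_eq_0_iff[of j "T (i + 1)" \<sigma>] T(1)[of "i + 1" "j + 1"] 1(1) by auto
    then have "\<sigma> \<noteq> 0"
      by (auto simp: S_def)
    with dec[OF 2(3)] 1 2 td show False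
      by auto
  qed
qed

text \<open>For uniqueness, the values at all points fix the third derivatives as polynomials, and
  the vanishing of the terms of degree at most 2 fixes the constants of three integrations.\<close>

lemma F_A_eq:
  assumes N: "N \<ge> 1"
  shows "F_A N = A_potential N"
  unfolding F_A_def
proof (rule the_equality)
  show "is_potential N (A_potential N)"
    unfolding is_potential_def using A_potential[OF N] three_point_value(2)[OF N] by simp
next
  fix F assume F: "is_potential N F"
  note P = A_potential[OF N]
  have poly: "is_polynomial N F" and low: "\<And>\<mu>. total_degree \<mu> \<le> 2 \<Longrightarrow> mcoeff F \<mu> = 0"
    using F by (auto simp: is_potential_def)
  have 3: "pdiff \<alpha> (pdiff \<beta> (pdiff \<gamma> F)) = pdiff \<alpha> (pdiff \<beta> (pdiff \<gamma> (A_potential N)))"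
    if "\<alpha> \<in> {1..N}" "\<beta> \<in> {1..N}" "\<gamma> \<in> {1..N}" for \<alpha> \<beta> \<gamma>
  proof (rule polynomial_eqI[of N])
    fix t
    show "poly_value (pdiff \<alpha> (pdiff \<beta> (pdiff \<gamma> F))) t = poly_value (pdiff \<alpha> (pdiff \<beta> (pdiff \<gamma> (A_potential N)))) t"
      unfolding P(3)[OF that] three_point_value(2)[OF N that] using F that by (simp add: is_potential_def)
  qed (intro is_polynomial_pdiff poly P(1))+
  have td: "total_degree (Poly_Mapping.single i (Suc 0)) \<le> 2" "total_degree (Poly_Mapping.single i (Suc 0) + Poly_Mapping.single j (Suc 0)) \<le> 2" for i j
    using total_degree_add_single[of 0 i] total_degree_add_single[of "Poly_Mapping.single i (Suc 0)" j]
    by (auto simp: total_degree_def)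
  have 2: "pdiff \<beta> (pdiff \<gamma> F) = pdiff \<beta> (pdiff \<gamma> (A_potential N))"
    if "\<beta> \<in> {1..N}" "\<gamma> \<in> {1..N}" for \<beta> \<gamma>
    by (rule polynomial_eqI_pdiff[of N])
       (use 3 that in \<open>auto simp: mcoeff_pdiff low P(2) td intro!: is_polynomial_pdiff poly P(1)\<close>)
  have 1: "pdiff \<gamma> F = pdiff \<gamma> (A_potential N)" if "\<gamma> \<in> {1..N}" for \<gamma>
    by (rule polynomial_eqI_pdiff[of N])
       (use 2 that in \<open>auto simp: mcoeff_pdiff low P(2) td intro!: is_polynomial_pdiff poly P(1)\<close>)
  show "F = A_potential N"
    by (rule polynomial_eqI_pdiff[of N, OF poly P(1)])
       (use 1 in \<open>auto simp: low P(2) total_degree_def\<close>)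
qed

lemma pdiff3_F_A:
  assumes "\<alpha> \<in> {1..N}" "\<beta> \<in> {1..N}" "\<gamma> \<in> {1..N}"
  shows "pdiff \<alpha> (pdiff \<beta> (pdiff \<gamma> (F_A N))) = A_three_point N \<alpha> \<beta> \<gamma>"
proof -
  have "N \<ge> 1"
    using assms by auto
  then show ?thesis
    using A_potential(3)[OF _ assms] by (simp add: F_A_eq)
qed

section \<open>The numbers \<open>P_hat\<close>\<close>

lemma P_hat_Nil: "P_hat i j [] = (if i = 0 \<and> j = 0 then 1 else 0)"
proof -
  have "{(is, js). length is = length ([] :: nat list) \<and> length js = length ([] :: nat list) \<and>
     (\<forall>n\<in>set is. n \<ge> 1) \<and> (\<forall>n\<in>set js. n \<ge> 1) \<and> sum_list is = i \<and> sum_list js = j \<and>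
     (\<forall>k<length ([] :: nat list). is ! k + js ! k = [] ! k + 1)} = (if i = 0 \<and> j = 0 then {([], [])} else {})"
    by auto
  then show ?thesis
    by (simp add: P_hat_def)
qed

text \<open>The choice \<open>i_1 = k\<close> forces \<open>j_1 = g + 1 - k\<close>. The
  inequalities guard the truncated subtractions.\<close>

lemma P_hat_Cons:
  "P_hat i j (g # gs) = (\<Sum>k = 1..g. if k \<le> i \<and> g + 1 - k \<le> j then P_hat (i - k) (j - (g + 1 - k)) gs else 0)"
proof -
  define A where "A i j \<gamma>s = {(is, js). length is = length \<gamma>s \<and> length js = length \<gamma>s \<and>
     (\<forall>n\<in>set is. n \<ge> 1) \<and> (\<forall>n\<in>set js. n \<ge> 1) \<and> sum_list is = i \<and> sum_list js = j \<and>
     (\<forall>k<length \<gamma>s. is ! k + js ! k = \<gamma>s ! k + 1)}" for i j and \<gamma>s :: "nat list"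
  have P: "P_hat i j \<gamma>s = card (A i j \<gamma>s)" for i j \<gamma>s
    by (simp add: P_hat_def A_def)
  have fin: "finite (A i j \<gamma>s)" for i j \<gamma>s
  proof (rule finite_subset)
    show "A i j \<gamma>s \<subseteq> {xs. set xs \<subseteq> {..i} \<and> length xs = length \<gamma>s} \<times> {xs. set xs \<subseteq> {..j} \<and> length xs = length \<gamma>s}"
      unfolding A_def by (auto simp: member_le_sum_list)
  qed (intro finite_cartesian_product finite_lists_length_eq finite_atMost)
  let ?K = "{k \<in> {1..g}. k \<le> i \<and> g + 1 - k \<le> j}"
  let ?h = "\<lambda>k (is, js). (k # is, (g + 1 - k) # js)"
  have A: "A i j (g # gs) = (\<Union>k\<in>?K. ?h k ` A (i - k) (j - (g + 1 - k)) gs)"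
  proof (intro equalityI subsetI)
    fix p assume "p \<in> A i j (g # gs)"
    then obtain k "is" l js where p: "p = (k # is, l # js)" and *: "(k # is, l # js) \<in> A i j (g # gs)"
      by (auto simp: A_def length_Suc_conv)
    have nth: "(k # is) ! n + (l # js) ! n = (g # gs) ! n + 1" if "n < Suc (length gs)" for n
      using * that by (simp add: A_def)
    have kl: "k + l = g + 1" "k \<ge> 1" "l \<ge> 1" "k \<le> i" "l \<le> j"
      using * nth[of 0] by (auto simp: A_def)
    have "is ! n + js ! n = gs ! n + 1" if "n < length gs" for n
      using nth[of "Suc n"] that by simp
    then have "(is, js) \<in> A (i - k) (j - (g + 1 - k)) gs"
      using * kl unfolding A_def by auto
    then have "?h k (is, js) \<in> ?h k ` A (i - k) (j - (g + 1 - k)) gs"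
      by (rule imageI)
    moreover have l: "l = g + 1 - k" and "k \<in> ?K"
      using kl by auto
    ultimately show "p \<in> (\<Union>k\<in>?K. ?h k ` A (i - k) (j - (g + 1 - k)) gs)"
      unfolding p l by (intro UN_I[of k]) (simp_all only: prod.case)
  next
    fix p assume "p \<in> (\<Union>k\<in>?K. ?h k ` A (i - k) (j - (g + 1 - k)) gs)"
    then show "p \<in> A i j (g # gs)"
      unfolding A_def by (auto simp: less_Suc_eq_0_disj)
  qed
  have "P_hat i j (g # gs) = (\<Sum>k\<in>?K. card (?h k ` A (i - k) (j - (g + 1 - k)) gs))"
    unfolding P A by (rule card_UN_disjoint) (auto simp: fin)
  also have "\<dots> = (\<Sum>k\<in>?K. P_hat (i - k) (j - (g + 1 - k)) gs)"
    unfolding P by (intro sum.cong refl card_image) (auto simp: inj_on_def)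
  also have "\<dots> = (\<Sum>k = 1..g. if k \<le> i \<and> g + 1 - k \<le> j then P_hat (i - k) (j - (g + 1 - k)) gs else 0)"
    by (rule sum.inter_filter) simp
  finally show ?thesis .
qed

lemma P_hat_nonzero:
  "P_hat i j \<gamma>s \<noteq> 0 \<Longrightarrow> length \<gamma>s \<le> i \<and> length \<gamma>s \<le> j \<and> (\<forall>\<gamma>\<in>set \<gamma>s. \<gamma> \<ge> 1) \<and> sum_list \<gamma>s + length \<gamma>s = i + j"
proof (induction \<gamma>s arbitrary: i j)
  case (Cons g gs)
  have "\<exists>k\<in>{1..g}. (if k \<le> i \<and> g + 1 - k \<le> j then P_hat (i - k) (j - (g + 1 - k)) gs else 0) \<noteq> 0"
  proof (rule ccontr)
    assume "\<not> ?thesis"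
    then have "P_hat i j (g # gs) = 0"
      unfolding P_hat_Cons by (intro sum.neutral) blast
    with Cons.prems show False
      by simp
  qed
  then obtain k where k: "1 \<le> k" "k \<le> g" "k \<le> i" "g + 1 - k \<le> j" "P_hat (i - k) (j - (g + 1 - k)) gs \<noteq> 0"
    by (auto split: if_splits)
  with Cons.IH[OF k(5)] show ?case
    by auto
qed (simp add: P_hat_Nil split: if_splits)

text \<open>A truncated difference is 0, which is not a sum of \<open>length gs > 0\<close> positive
  integers, so terms out of range vanish by themselves. For empty \<open>gs\<close> the value
  \<open>P_hat 0 0 [] = 1\<close> would spoil this.\<close>

lemma P_hat_Cons_truncated:
  assumes "gs \<noteq> []"
  shows "P_hat i j (g # gs) = (\<Sum>k = 1..g. P_hat (i - k) (j - (g + 1 - k)) gs)"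
proof -
  have len: "length gs > 0"
    using assms by simp
  have "P_hat (i - k) (j - l) gs = 0" if "\<not> (k \<le> i \<and> l \<le> j)" for k l
  proof (rule ccontr)
    assume "P_hat (i - k) (j - l) gs \<noteq> 0"
    then have "length gs \<le> i - k" "length gs \<le> j - l"
      using P_hat_nonzero by blast+
    with that len show False
      by auto
  qed
  then show ?thesis
    unfolding P_hat_Cons by (intro sum.cong refl) (metis (mono_tags))
qed

lemma P_hat_swap: "P_hat i j (x # y # gs) = P_hat i j (y # x # gs)"
proof -
  have "P_hat i j (x # y # gs) = (\<Sum>k = 1..x. \<Sum>l = 1..y.
      if k + l \<le> i \<and> (x + 1 - k) + (y + 1 - l) \<le> j
      then P_hat (i - (k + l)) (j - ((x + 1 - k) + (y + 1 - l))) gs else 0)" for x y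
    unfolding P_hat_Cons
  proof (rule sum.cong[OF refl])
    fix k
    let ?m = "x + 1 - k"
    show "(if k \<le> i \<and> ?m \<le> j then (\<Sum>l = 1..y. if l \<le> i - k \<and> y + 1 - l \<le> j - ?m
          then P_hat (i - k - l) (j - ?m - (y + 1 - l)) gs else 0) else 0)
        = (\<Sum>l = 1..y. if k + l \<le> i \<and> ?m + (y + 1 - l) \<le> j
          then P_hat (i - (k + l)) (j - (?m + (y + 1 - l))) gs else 0)"
    proof (cases "k \<le> i \<and> ?m \<le> j")
      case True
      then have "l \<le> i - k \<and> y + 1 - l \<le> j - ?m \<longleftrightarrow> k + l \<le> i \<and> ?m + (y + 1 - l) \<le> j" for l
        by linarith
      then show ?thesis
        unfolding if_P[OF True] diff_diff_eq by (simp only:)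
    next
      case False
      then have "\<not> (k + l \<le> i \<and> ?m + (y + 1 - l) \<le> j)" for l
        by linarith
      then show ?thesis
        unfolding if_not_P[OF False] by (simp only: if_False sum.neutral_const)
    qed
  qed
  note eq = this
  have "(\<Sum>k = 1..x. \<Sum>l = 1..y. h (k + l) (x + 1 - k + (y + 1 - l)))
      = (\<Sum>l = 1..y. \<Sum>k = 1..x. h (l + k) (y + 1 - l + (x + 1 - k)))" for h :: "nat \<Rightarrow> nat \<Rightarrow> nat"
  proof (subst sum.swap, rule sum.cong[OF refl], rule sum.cong[OF refl])
    fix k l
    show "h (k + l) (x + 1 - k + (y + 1 - l)) = h (l + k) (y + 1 - l + (x + 1 - k))"
      unfolding add.commute[of k] add.commute[of "x + 1 - k"] ..
  qed
  from this[of "\<lambda>a b. if a \<le> i \<and> b \<le> j then P_hat (i - a) (j - b) gs else 0"] show ?thesis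
    unfolding eq[of x y] eq[of y x] .
qed

text \<open>The Taylor expansion removes an index from an arbitrary position of the list; by this
  symmetry all positions contribute equally.\<close>

lemma P_hat_move: "P_hat i j (xs @ y # ys) = P_hat i j (y # xs @ ys)"
proof (induction xs arbitrary: i j)
  case (Cons x xs)
  have "P_hat i j (x # (xs @ y # ys)) = P_hat i j (x # (y # xs @ ys))"
    unfolding P_hat_Cons[of i j x "xs @ y # ys"] P_hat_Cons[of i j x "y # xs @ ys"] Cons.IH ..
  also have "\<dots> = P_hat i j (y # x # (xs @ ys))"
    by (rule P_hat_swap)
  finally show ?case
    unfolding append_Cons .
qed simp

section \<open>Taylor coefficients of the potential\<close>

lemma foldr_pdiff_diff:
  "foldr pdiff L (F - G) = foldr pdiff L F - foldr pdiff L (G :: 'a::comm_ring_1 mps)"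
  by (induction L) simp_all

lemma foldr_pdiff_0: "foldr pdiff L 0 = (0 :: 'a::comm_ring_1 mps)"
  by (induction L) simp_all

lemma foldr_pdiff_sum:
  "foldr pdiff L (\<Sum>i\<in>I. f i) = (\<Sum>i\<in>I. foldr pdiff L (f i :: 'a::comm_ring_1 mps))"
  by (induction L) (simp_all add: pdiff_sum)

lemma foldr_pdiff_1: "L \<noteq> [] \<Longrightarrow> foldr pdiff L 1 = (0 :: 'a::comm_ring_1 mps)"
proof (induction L)
  case (Cons l L)
  then show ?case
    by (cases "L = []") simp_all
qed simp

lemma pdiff_foldr_pdiff: "pdiff k (foldr pdiff L F) = foldr pdiff L (pdiff k (F :: 'a::comm_ring_1 mps))"
proof (induction L)
  case (Cons l L)
  have "pdiff k (foldr pdiff (l # L) F) = pdiff l (pdiff k (foldr pdiff L F))"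
    unfolding foldr.simps comp_apply by (rule pdiff_commute)
  then show ?case
    unfolding Cons.IH by simp
qed simp

text \<open>At most one of the derivatives can fall on the linear factor. The sum runs over
  positions because equal indices in the list count separately.\<close>

lemma foldr_pdiff_mvar_mult:
  assumes "k \<ge> 1" "\<forall>l\<in>set L. l \<ge> 1"
  shows "foldr pdiff L (mvar k * G) = mvar k * foldr pdiff L G
    + (\<Sum>p<length L. if L ! p = k then foldr pdiff (take p L @ drop (Suc p) L) G else 0)"
  using assms(2)
proof (induction L)
  case (Cons l L)
  have "(\<Sum>p<length L. pdiff l (if L ! p = k then foldr pdiff (take p L @ drop (Suc p) L) G else 0))
      = (\<Sum>p<length L. if L ! p = k then pdiff l (foldr pdiff (take p L @ drop (Suc p) L) G) else 0)"
    by (rule sum.cong) auto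
  then show ?case
    using Cons assms(1) by (simp add: pdiff_sum pdiff_mvar sum.lessThan_Suc_shift del: sum.lessThan_Suc cong: if_cong)
qed simp

text \<open>At \<open>t = 0\<close> exactly one derivative must fall on the coordinate in each term
  of \<open>three_point_rec\<close>. What remains is the recursion that splits off one pair
  \<open>(i, j + 1 - i)\<close>, as in \<open>P_hat\<close>; the sign comes from the recurrence and
  the factorial from the equal contributions of all positions.\<close>

lemma mcoeff_A_three_point:
  assumes "g \<in> {1..N}" "set gs \<subseteq> {1..N}" "a + b \<le> N + 1"
  shows "mcoeff (foldr pdiff (map (\<lambda>\<gamma>. N + 1 - \<gamma>) gs) (A_three_point N a b (N + 1 - g))) 0
    = (-1) ^ length gs * fact (length gs) * of_nat (P_hat a b (g # gs))"
  using assms(2,3)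
proof (induction "length gs" arbitrary: gs a b)
  case (0 gs a b)
  then have gs: "gs = []"
    by simp
  show ?case
  proof (cases "a \<ge> 1 \<and> b \<ge> 1")
    case True
    have "P_hat a b [g] = (\<Sum>k = 1..g. if k = a then (if a + b = g + 1 then 1 else 0) else 0)"
      unfolding P_hat_Cons P_hat_Nil by (rule sum.cong) auto
    also have "\<dots> = (if a + b = g + 1 then 1 else 0)"
      using True by auto
    finally have P: "P_hat a b [g] = (if a + b = g + 1 then 1 else 0)" .
    have "mcoeff (A_three_point N a b (N + 1 - g)) 0 = (if a + b + (N + 1 - g) = N + 2 then 1 else 0)"
      using three_point_rec[of a b N "N + 1 - g" "flat_coord N"] True 0 assms(1)
      by (auto simp: flat_coord_def)
    with assms(1) show ?thesis
      by (auto simp: gs P)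
  next
    case False
    then have "a = 0 \<or> b = 0"
      by auto
    moreover from this have "P_hat a b [g] = 0"
      using P_hat_nonzero[of a b "[g]"] by fastforce
    ultimately show ?thesis
      by (auto simp: gs)
  qed
next
  case (Suc n gs a b)
  let ?k = "\<lambda>\<gamma>. N + 1 - \<gamma>"
  let ?e = "\<lambda>gs a b. mcoeff (foldr pdiff (map ?k gs) (A_three_point N a b (N + 1 - g))) 0"
  have ne: "gs \<noteq> []"
    using Suc.hyps(2) by auto
  show ?case
  proof (cases "a \<ge> 1 \<and> b \<ge> 1")
    case True
    let ?del = "\<lambda>p. take p gs @ drop (Suc p) gs"
    have term1: "mcoeff (foldr pdiff (map ?k gs) (flat_coord N j * F)) 0
        = (\<Sum>p<length gs. if gs ! p = j then mcoeff (foldr pdiff (map ?k (?del p)) F) 0 else 0)"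
      if "j \<in> {1..N}" for j F
    proof -
      have l: "\<forall>l\<in>set (map ?k gs). l \<ge> 1" and k: "?k j \<ge> 1"
        using Suc.prems(1) that by (auto simp: subset_iff Suc_le_eq less_Suc_eq_le)
      have "mcoeff (foldr pdiff (map ?k gs) (flat_coord N j * F)) 0
          = (\<Sum>p<length gs. mcoeff (if map ?k gs ! p = ?k j
              then foldr pdiff (take p (map ?k gs) @ drop (Suc p) (map ?k gs)) F else 0) 0)"
        unfolding flat_coord_def foldr_pdiff_mvar_mult[OF k l] mcoeff_simps mcoeff_sum mcoeff_mult_0 mcoeff_mvar_0
        by (simp only: mult_zero_left add_0_left length_map)
      also have "\<dots> = (\<Sum>p<length gs. if gs ! p = j then mcoeff (foldr pdiff (map ?k (?del p)) F) 0 else 0)"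
      proof (rule sum.cong[OF refl])
        fix p assume p: "p \<in> {..<length gs}"
        then have "gs ! p \<in> {1..N}"
          using Suc.prems(1) nth_mem by blast
        then have "map ?k gs ! p = ?k j \<longleftrightarrow> gs ! p = j"
          using p that by auto
        then show "mcoeff (if map ?k gs ! p = ?k j
              then foldr pdiff (take p (map ?k gs) @ drop (Suc p) (map ?k gs)) F else 0) 0
            = (if gs ! p = j then mcoeff (foldr pdiff (map ?k (?del p)) F) 0 else 0)"
          by (simp add: take_map drop_map)
      qed
      finally show ?thesis .
    qed
    have rec: "A_three_point N a b (N + 1 - g) = (if a + b + (N + 1 - g) = N + 2 then 1 else 0)
        - (\<Sum>j = 1..N. \<Sum>i = 1..j. flat_coord N j * A_three_point N (a - i) (b - (j + 1 - i)) (N + 1 - g))"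
    proof -
      have "1 \<le> a" "1 \<le> b" "1 \<le> N + 1 - g" "N + 1 - g \<le> N"
        using True assms(1) by auto
      from three_point_rec[OF this(1,2) Suc.prems(2) this(3,4), of "flat_coord N"] show ?thesis
        unfolding sum_distrib_left .
    qed
    have const: "foldr pdiff (map ?k gs) (if a + b + (N + 1 - g) = N + 2 then 1 else 0) = (0 :: complex mps)"
      using ne by (simp add: foldr_pdiff_0 foldr_pdiff_1)
    have "?e gs a b = - (\<Sum>j = 1..N. \<Sum>i = 1..j. mcoeff (foldr pdiff (map ?k gs)
        (flat_coord N j * A_three_point N (a - i) (b - (j + 1 - i)) (N + 1 - g))) 0)"
      by (subst rec) (simp only: foldr_pdiff_diff foldr_pdiff_sum const mcoeff_simps mcoeff_sum diff_0)
    also have "\<dots> = - (\<Sum>j = 1..N. \<Sum>i = 1..j. \<Sum>p<length gs.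
        if gs ! p = j then ?e (?del p) (a - i) (b - (j + 1 - i)) else 0)"
      by (intro arg_cong[where f = uminus] sum.cong refl term1)
    also have "\<dots> = - (\<Sum>p<length gs. \<Sum>j = 1..N. \<Sum>i = 1..j.
        if gs ! p = j then ?e (?del p) (a - i) (b - (j + 1 - i)) else 0)"
      by (subst sum.swap, subst (2) sum.swap) (rule refl)
    also have "\<dots> = - (\<Sum>p<length gs. (-1) ^ n * fact n * of_nat (P_hat a b (g # gs)))"
    proof (intro arg_cong[where f = uminus] sum.cong[OF refl])
      fix p assume p: "p \<in> {..<length gs}"
      let ?q = "gs ! p"
      have q: "?q \<in> {1..N}"
        using p Suc.prems(1) nth_mem by blast
      have "(\<Sum>j = 1..N. \<Sum>i = 1..j. if ?q = j then ?e (?del p) (a - i) (b - (j + 1 - i)) else 0)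
          = (\<Sum>j = 1..N. if ?q = j then (\<Sum>i = 1..?q. ?e (?del p) (a - i) (b - (?q + 1 - i))) else 0)"
        by (rule sum.cong) auto
      also have "\<dots> = (\<Sum>i = 1..?q. ?e (?del p) (a - i) (b - (?q + 1 - i)))"
        using q by simp
      also have "\<dots> = (\<Sum>i = 1..?q. (-1) ^ n * fact n * of_nat (P_hat (a - i) (b - (?q + 1 - i)) (g # ?del p)))"
      proof (rule sum.cong[OF refl])
        fix i
        have len: "n = length (?del p)"
          using p Suc.hyps(2) by auto
        have "set (?del p) \<subseteq> {1..N}"
          using Suc.prems(1) set_take_subset[of p gs] set_drop_subset[of "Suc p" gs] by auto
        moreover have "a - i + (b - (?q + 1 - i)) \<le> N + 1"
          using Suc.prems(2) by linarith
        ultimately show "?e (?del p) (a - i) (b - (?q + 1 - i))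
            = (-1) ^ n * fact n * of_nat (P_hat (a - i) (b - (?q + 1 - i)) (g # ?del p))"
          using Suc.hyps(1)[OF len] len by simp
      qed
      also have "\<dots> = (-1) ^ n * fact n * of_nat (P_hat a b (?q # g # ?del p))"
        by (simp add: P_hat_Cons_truncated sum_distrib_left)
      also have "P_hat a b (?q # g # ?del p) = P_hat a b (g # gs)"
        using P_hat_move[of a b "g # take p gs" ?q "drop (Suc p) gs"] p by (simp add: id_take_nth_drop[symmetric])
      finally show "(\<Sum>j = 1..N. \<Sum>i = 1..j. if ?q = j then ?e (?del p) (a - i) (b - (j + 1 - i)) else 0)
          = (-1) ^ n * fact n * of_nat (P_hat a b (g # gs))" .
    qed
    also have "\<dots> = (-1) ^ length gs * fact (length gs) * of_nat (P_hat a b (g # gs))"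
      by (simp add: algebra_simps flip: Suc.hyps(2))
    finally show ?thesis .
  next
    case False
    then have ab: "a = 0 \<or> b = 0"
      by auto
    moreover from this have "P_hat a b (g # gs) = 0"
      using P_hat_nonzero[of a b "g # gs"] by fastforce
    ultimately show ?thesis
      by (auto simp: foldr_pdiff_0)
  qed
qed

text \<open>Of the \<open>m\<close> indices one belongs to the third derivative and
  \<open>m - 1\<close> to its Taylor coefficient, so \<open>(m - 1)!/m!\<close> leaves
  \<open>1/m\<close>. The choice \<open>N = i + j + 1\<close> keeps \<open>i + j\<close> within the
  range of the recurrence.\<close>

lemma R_A_eq:
  assumes "i \<ge> 1" "j \<ge> 1" "\<gamma>s \<in> index_tuples i j"
  shows "R_A i j \<gamma>s = (-1) ^ (length \<gamma>s - 1) / of_nat (length \<gamma>s) * of_nat (P_hat i j \<gamma>s)"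
proof (cases \<gamma>s)
  case Nil
  with assms show ?thesis
    by (simp add: index_tuples_def)
next
  case (Cons g gs)
    define N where "N = i + j + 1"
    have range: "set \<gamma>s \<subseteq> {1..N}"
    proof
      fix \<gamma> assume "\<gamma> \<in> set \<gamma>s"
      then show "\<gamma> \<in> {1..N}"
        using assms member_le_sum_list[of \<gamma> \<gamma>s] by (auto simp: index_tuples_def N_def)
    qed
    let ?L = "map (\<lambda>\<gamma>. N + 1 - \<gamma>) gs"
    have "R_A i j \<gamma>s = 1 / fact (length \<gamma>s) * mcoeff (pdiff i (pdiff j (pdiff (N + 1 - g) (foldr pdiff ?L (F_A N))))) 0"
      by (simp add: R_A_def Let_def N_def Cons)
    also have "pdiff i (pdiff j (pdiff (N + 1 - g) (foldr pdiff ?L (F_A N))))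
        = foldr pdiff ?L (pdiff i (pdiff j (pdiff (N + 1 - g) (F_A N))))"
      by (simp only: pdiff_foldr_pdiff)
    also have "pdiff i (pdiff j (pdiff (N + 1 - g) (F_A N))) = A_three_point N i j (N + 1 - g)"
      by (rule pdiff3_F_A) (use assms range in \<open>auto simp: N_def Cons\<close>)
    also have "mcoeff (foldr pdiff ?L (A_three_point N i j (N + 1 - g))) 0
        = (-1) ^ length gs * fact (length gs) * of_nat (P_hat i j (g # gs))"
      by (rule mcoeff_A_three_point) (use range in \<open>auto simp: N_def Cons\<close>)
    also have "1 / fact (length \<gamma>s) * ((-1) ^ length gs * fact (length gs) * of_nat (P_hat i j (g # gs)))
        = (-1) ^ (length \<gamma>s - 1) / of_nat (length \<gamma>s) * (of_nat (P_hat i j \<gamma>s) :: complex)"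
    proof -
      have "1 / (x * f) * (s * f * p) = s / x * p" if "f \<noteq> 0" for x f s p :: complex
        using that by simp
      from this[of "fact (length gs)" "of_nat (Suc (length gs))"] show ?thesis
        by (simp only: Cons list.size fact_Suc of_nat_mult of_nat_fact fact_nonzero add_Suc_right add_0_right diff_Suc_1 not_False_eq_True)
    qed
    finally show ?thesis .
qed

section \<open>Exponential and logarithm over rings\<close>

lemma fps_power_nth_eq_0: "G $ 0 = (0 :: 'b::comm_ring_1) \<Longrightarrow> n < k \<Longrightarrow> (G ^ k) $ n = 0"
  using startsby_zero_power_prefix[of G k] by blast

text \<open>The coefficient rings are rings of power series and not fields; \<open>\<kappa>\<close>
  supplies the scalars \<open>1/n\<close> and \<open>1/n!\<close> of logarithm and
  exponential.\<close>

locale rational_scalars =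
  fixes \<kappa> :: "complex \<Rightarrow> 'b::comm_ring_1"
  assumes \<kappa>_mult: "\<kappa> (x * y) = \<kappa> x * \<kappa> y"
    and \<kappa>_of_nat: "\<kappa> (of_nat n) = of_nat n"
    and \<kappa>_uminus: "\<kappa> (- x) = - \<kappa> x"
begin

lemma \<kappa>_1 [simp]: "\<kappa> 1 = 1"
  using \<kappa>_of_nat[of 1] by simp

lemma of_nat_mult_\<kappa>: "of_nat n * \<kappa> x = \<kappa> (of_nat n * x)"
  by (simp only: \<kappa>_mult \<kappa>_of_nat)

lemma of_nat_Suc_cancel:
  assumes "of_nat (Suc n) * a = of_nat (Suc n) * (b :: 'b)"
  shows "a = b"
proof -
  have "\<kappa> (1 / of_nat (Suc n)) * of_nat (Suc n) = 1"
    by (simp only: mult.commute[of "\<kappa> _"] of_nat_mult_\<kappa>) (simp del: of_nat_Suc)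
  then show ?thesis
    using arg_cong[OF assms, of "\<lambda>c. \<kappa> (1 / of_nat (Suc n)) * c"] by (simp only: mult.assoc[symmetric] mult_1_left)
qed

lemma fps_deriv_eqI:
  fixes F G :: "'b fps"
  assumes "fps_deriv F = fps_deriv G" "F $ 0 = G $ 0"
  shows "F = G"
proof (rule fps_ext)
  fix n
  show "F $ n = G $ n"
  proof (cases n)
    case (Suc m)
    have "fps_deriv F $ m = fps_deriv G $ m"
      using assms(1) by simp
    then show ?thesis
      using of_nat_Suc_cancel[of m "F $ Suc m" "G $ Suc m"] by (simp add: Suc)
  qed (use assms(2) in simp)
qed

definition ring_exp :: "'b fps \<Rightarrow> 'b fps" where
  "ring_exp G = Abs_fps (\<lambda>n. \<kappa> (1 / fact n)) oo G"

definition ring_log1p :: "'b fps \<Rightarrow> 'b fps" where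
  "ring_log1p S = Abs_fps (\<lambda>n. \<Sum>m = 1..n. \<kappa> ((-1) ^ (m - 1) / of_nat m) * (S ^ m) $ n)"

lemma fps_deriv_ring_exp:
  assumes "G $ 0 = 0"
  shows "fps_deriv (ring_exp G) = fps_deriv G * ring_exp G"
proof (rule fps_ext)
  fix n
  \<comment> \<open>A finite truncation that can be differentiated term by term. As \<open>G\<close>
    has no constant term, coefficients up to index \<open>N\<close> do not see higher
    powers.\<close>
  define P where "P N = (\<Sum>i\<le>N. fps_const (\<kappa> (1 / fact i)) * G ^ i)" for N
  have P: "ring_exp G $ k = P N $ k" if "k \<le> N" for k N
  proof -
    have "ring_exp G $ k = (\<Sum>i\<in>{0..k}. \<kappa> (1 / fact i) * (G ^ i) $ k)"
      by (simp add: ring_exp_def fps_compose_nth)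
    also have "\<dots> = (\<Sum>i\<le>N. \<kappa> (1 / fact i) * (G ^ i) $ k)"
      by (rule sum.mono_neutral_left) (use that in \<open>auto simp: fps_power_nth_eq_0[OF assms]\<close>)
    finally show ?thesis
      by (simp add: P_def fps_sum_nth)
  qed
  have summand: "fps_deriv (fps_const (\<kappa> (1 / fact (Suc i))) * G ^ Suc i)
      = fps_deriv G * (fps_const (\<kappa> (1 / fact i)) * G ^ i)" for i
  proof -
    have "of_nat (Suc i) * (1 / fact (Suc i)) = (1 / fact i :: complex)"
      by (simp add: divide_simps del: of_nat_Suc)
    then have "of_nat (Suc i) * \<kappa> (1 / fact (Suc i)) = \<kappa> (1 / fact i)"
      by (simp only: of_nat_mult_\<kappa>)
    then have *: "fps_const (\<kappa> (1 / fact i)) = fps_const (of_nat (Suc i)) * fps_const (\<kappa> (1 / fact (Suc i)))"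
      by (simp only: fps_const_mult)
    show ?thesis
      unfolding fps_deriv_mult fps_deriv_power diff_Suc_1 fps_deriv_const mult_zero_left add_0_right *
      by (simp only: mult_ac)
  qed
  have "P (Suc n) = fps_const (\<kappa> (1 / fact 0)) * G ^ 0 + (\<Sum>i\<le>n. fps_const (\<kappa> (1 / fact (Suc i))) * G ^ Suc i)"
    unfolding P_def by (rule sum.atMost_Suc_shift)
  then have dP: "fps_deriv (P (Suc n)) = fps_deriv G * P n"
    by (simp only: fps_deriv_add fps_deriv_sum summand P_def sum_distrib_left) simp
  have "fps_deriv (ring_exp G) $ n = fps_deriv (P (Suc n)) $ n"
    by (simp add: P[of "Suc n" "Suc n"])
  also have "\<dots> = (fps_deriv G * ring_exp G) $ n"
    unfolding dP fps_mult_nth by (intro sum.cong refl) (simp add: P[of _ n])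
  finally show "fps_deriv (ring_exp G) $ n = (fps_deriv G * ring_exp G) $ n" .
qed

text \<open>The derivative of the truncated logarithm is that of \<open>S\<close> times a geometric
  sum in \<open>-S\<close>. The factor \<open>1 + S\<close> makes it telescope up to
  \<open>(-S)^(n+1)\<close>, which does not reach index \<open>n\<close>.\<close>

lemma fps_deriv_ring_log1p:
  assumes "S $ 0 = 0"
  shows "fps_deriv (ring_log1p S) * (1 + S) = fps_deriv S"
proof (rule fps_ext)
  fix n
  define Q where "Q N = (\<Sum>m = 1..N. fps_const (\<kappa> ((-1) ^ (m - 1) / of_nat m)) * S ^ m)" for N
  have Q: "ring_log1p S $ k = Q N $ k" if "k \<le> N" for k N
  proof -
    have "ring_log1p S $ k = (\<Sum>m = 1..N. \<kappa> ((-1) ^ (m - 1) / of_nat m) * (S ^ m) $ k)"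
      unfolding ring_log1p_def fps_nth_Abs_fps
      by (rule sum.mono_neutral_left) (use that in \<open>auto simp: fps_power_nth_eq_0[OF assms]\<close>)
    then show ?thesis
      by (simp add: Q_def fps_sum_nth)
  qed
  have \<kappa>_sign: "\<kappa> ((-1) ^ m) = (-1) ^ m" for m
    by (induction m) (simp_all add: \<kappa>_uminus)
  have summand: "fps_deriv (fps_const (\<kappa> ((-1) ^ m / of_nat (Suc m))) * S ^ Suc m) = fps_deriv S * (- S) ^ m" for m
  proof -
    have "of_nat (Suc m) * ((-1) ^ m / of_nat (Suc m)) = ((-1) ^ m :: complex)"
      by (simp del: of_nat_Suc)
    then have "of_nat (Suc m) * \<kappa> ((-1) ^ m / of_nat (Suc m)) = (-1) ^ m"
      by (simp only: of_nat_mult_\<kappa> \<kappa>_sign)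
    moreover have "fps_const ((-1) ^ m) = (-1 :: 'b fps) ^ m"
      by (induction m) (simp_all flip: fps_const_neg fps_const_mult)
    ultimately have "(-1) ^ m = fps_const (of_nat (Suc m)) * fps_const (\<kappa> ((-1) ^ m / of_nat (Suc m)))"
      by (simp only: fps_const_mult)
    then have *: "(- S) ^ m = fps_const (of_nat (Suc m)) * fps_const (\<kappa> ((-1) ^ m / of_nat (Suc m))) * S ^ m"
      by (simp only: power_minus[of S])
    show ?thesis
      unfolding fps_deriv_mult fps_deriv_power diff_Suc_1 fps_deriv_const mult_zero_left add_0_right *
      by (simp only: mult_ac)
  qed
  have "Q (Suc n) = (\<Sum>m\<le>n. fps_const (\<kappa> ((-1) ^ m / of_nat (Suc m))) * S ^ Suc m)"
    unfolding Q_def by (rule sum.reindex_bij_witness[where i = Suc and j = "\<lambda>m. m - 1"]) auto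
  then have "fps_deriv (Q (Suc n)) = fps_deriv S * (\<Sum>m\<le>n. (- S) ^ m)"
    by (simp only: fps_deriv_sum summand sum_distrib_left)
  then have dQ: "fps_deriv (Q (Suc n)) * (1 + S) = fps_deriv S * (1 - (- S) ^ Suc n)"
    using one_diff_power_eq[of "- S" "Suc n"] by (simp add: lessThan_Suc_atMost mult_ac)
  have "(fps_deriv (ring_log1p S) * (1 + S)) $ n = (fps_deriv (Q (Suc n)) * (1 + S)) $ n"
    unfolding fps_mult_nth
  proof (rule sum.cong[OF refl])
    fix k assume "k \<in> {0..n}"
    then have "fps_deriv (ring_log1p S) $ k = fps_deriv (Q (Suc n)) $ k"
      using Q[of "Suc k" "Suc n"] by simp
    then show "fps_deriv (ring_log1p S) $ k * (1 + S) $ (n - k) = fps_deriv (Q (Suc n)) $ k * (1 + S) $ (n - k)"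
      by simp
  qed
  also have "\<dots> = fps_deriv S $ n"
  proof -
    have "(fps_deriv S * (- S) ^ Suc n) $ n = 0"
      unfolding fps_mult_nth
      by (intro sum.neutral ballI) (subst fps_power_nth_eq_0, use assms in auto)
    then show ?thesis
      unfolding dQ right_diff_distrib mult_1_right fps_sub_nth by (simp only: diff_zero)
  qed
  finally show "(fps_deriv (ring_log1p S) * (1 + S)) $ n = fps_deriv S $ n" .
qed

text \<open>Logarithmic derivatives: \<open>exp G = 1 + S\<close> gives
  \<open>G' (1 + S) = S'\<close>, the equation of the logarithm, and \<open>1 + S\<close> is
  invertible. Conversely \<open>V = exp G - (1 + S)\<close> solves \<open>V' = G' V\<close> with
  constant term 0 and therefore vanishes.\<close>

lemma ring_exp_eq_iff:
  assumes "G $ 0 = 0" "S $ 0 = 0"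
  shows "ring_exp G = 1 + S \<longleftrightarrow> G = ring_log1p S"
proof
  let ?L = "ring_log1p S"
  assume *: "ring_exp G = 1 + S"
  have "fps_deriv S = fps_deriv G * (1 + S)"
    using fps_deriv_ring_exp[OF assms(1)] unfolding * by simp
  then have "(fps_deriv G - fps_deriv ?L) * (1 + S) = 0"
    unfolding left_diff_distrib fps_deriv_ring_log1p[OF assms(2)] by (simp only: diff_self)
  moreover have "(1 + S) * fps_right_inverse (1 + S) 1 = 1"
    by (rule fps_right_inverse) (simp add: assms(2))
  then have "fps_deriv G - fps_deriv ?L = (fps_deriv G - fps_deriv ?L) * (1 + S) * fps_right_inverse (1 + S) 1"
    by (simp only: mult.assoc mult_1_right)
  ultimately have "fps_deriv G - fps_deriv ?L = 0"
    by (simp only: mult_zero_left)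
  then have "fps_deriv G = fps_deriv ?L"
    by (rule eq_iff_diff_eq_0[THEN iffD2])
  then show "G = ?L"
    by (rule fps_deriv_eqI) (simp add: assms ring_log1p_def)
next
  let ?L = "ring_log1p S"
  assume G: "G = ?L"
  define V where "V = ring_exp G - (1 + S)"
  have "fps_deriv V = fps_deriv G * ring_exp G - fps_deriv S"
    by (simp add: V_def fps_deriv_ring_exp[OF assms(1)])
  also have "\<dots> = fps_deriv G * V"
    unfolding V_def right_diff_distrib G fps_deriv_ring_log1p[OF assms(2)] ..
  finally have dV: "fps_deriv V = fps_deriv G * V" .
  have V0: "V $ 0 = 0"
    by (simp add: V_def ring_exp_def assms)
  have "V $ n = 0" for n
  proof (induction n rule: less_induct)
    case (less n)
    show ?case
    proof (cases n)
      case (Suc m)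
      have "V $ (m - i) = 0" for i
        by (rule less.IH) (simp add: Suc)
      then have "fps_deriv V $ m = 0"
        unfolding dV fps_mult_nth by (simp only: mult_zero_right sum.neutral_const)
      then show ?thesis
        using of_nat_Suc_cancel[of m "V $ Suc m" 0] by (simp add: Suc)
    qed (simp add: V0)
  qed
  then have "V = 0"
    by (intro fps_ext) simp
  then show "ring_exp G = 1 + S"
    by (simp add: V_def)
qed

end

section \<open>The logarithm of the generating series\<close>

text \<open>The kernel \<open>K\<close> with arbitrary values \<open>A\<close> in place of the
  \<open>s_j\<close>, as a series in \<open>V\<close> over series in \<open>U\<close>.\<close>

definition symbol_series :: "(nat \<Rightarrow> 'a::comm_ring_1) \<Rightarrow> 'a fps fps" where
  "symbol_series A = Abs_fps (\<lambda>j. Abs_fps (\<lambda>i. if i \<ge> 1 \<and> j \<ge> 1 then A (i + j - 1) else 0))"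

lemma symbol_series_nth: "symbol_series A $ j $ i = (if i \<ge> 1 \<and> j \<ge> 1 then A (i + j - 1) else 0)"
  by (simp add: symbol_series_def)

lemma symbol_series_nth_0: "symbol_series A $ 0 = 0"
  by (simp add: fps_eq_iff symbol_series_nth)

text \<open>A term of the power takes exponents \<open>(i_k, j_k)\<close> from each factor; grouping
  by \<open>\<gamma>_k = i_k + j_k - 1\<close> gives \<open>P_hat\<close>. The bound
  \<open>n\<close> is separate from \<open>i\<close> and \<open>j\<close> so that the set of tuples
  stays fixed in the induction.\<close>

lemma symbol_series_power:
  assumes "i + j \<le> n"
  shows "(symbol_series A ^ m) $ j $ i
    = (\<Sum>\<gamma>s | set \<gamma>s \<subseteq> {1..n} \<and> length \<gamma>s = m. of_nat (P_hat i j \<gamma>s) * (\<Prod>\<gamma>\<leftarrow>\<gamma>s. A \<gamma>))"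
  using assms
proof (induction m arbitrary: i j)
  case 0
  have "{\<gamma>s. set \<gamma>s \<subseteq> {1..n} \<and> length \<gamma>s = 0} = {[]}"
    by auto
  then show ?case
    by (simp add: P_hat_Nil)
next
  case (Suc m)
  let ?U = "\<lambda>m. {\<gamma>s. set \<gamma>s \<subseteq> {1..n} \<and> length \<gamma>s = m}"
  let ?T = "\<lambda>i j. (symbol_series A ^ m) $ j $ i"
  have "(\<Sum>\<gamma>s\<in>?U (Suc m). of_nat (P_hat i j \<gamma>s) * (\<Prod>\<gamma>\<leftarrow>\<gamma>s. A \<gamma>))
      = (\<Sum>(g, gs)\<in>{1..n} \<times> ?U m. of_nat (P_hat i j (g # gs)) * (\<Prod>\<gamma>\<leftarrow>g # gs. A \<gamma>))"
    by (rule sum.reindex_bij_witness[where i = "\<lambda>(g, gs). g # gs" and j = "\<lambda>\<gamma>s. (hd \<gamma>s, tl \<gamma>s)"])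
       (auto simp: length_Suc_conv)
  also have "\<dots> = (\<Sum>g = 1..n. \<Sum>gs\<in>?U m. of_nat (P_hat i j (g # gs)) * (\<Prod>\<gamma>\<leftarrow>g # gs. A \<gamma>))"
    by (rule sum.cartesian_product[symmetric])
  also have "\<dots> = (\<Sum>g = 1..n. \<Sum>k = 1..g. if k \<le> i \<and> g + 1 - k \<le> j then A g * ?T (i - k) (j - (g + 1 - k)) else 0)"
  proof (rule sum.cong[OF refl])
    fix g
    have "(\<Sum>gs\<in>?U m. of_nat (P_hat i j (g # gs)) * (\<Prod>\<gamma>\<leftarrow>g # gs. A \<gamma>))
        = (\<Sum>gs\<in>?U m. \<Sum>k = 1..g. if k \<le> i \<and> g + 1 - k \<le> j
            then A g * (of_nat (P_hat (i - k) (j - (g + 1 - k)) gs) * (\<Prod>\<gamma>\<leftarrow>gs. A \<gamma>)) else 0)"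
      unfolding P_hat_Cons of_nat_sum sum_distrib_right
      by (intro sum.cong refl) (simp add: mult_ac)
    also have "\<dots> = (\<Sum>k = 1..g. \<Sum>gs\<in>?U m. if k \<le> i \<and> g + 1 - k \<le> j
            then A g * (of_nat (P_hat (i - k) (j - (g + 1 - k)) gs) * (\<Prod>\<gamma>\<leftarrow>gs. A \<gamma>)) else 0)"
      by (rule sum.swap)
    also have "\<dots> = (\<Sum>k = 1..g. if k \<le> i \<and> g + 1 - k \<le> j then A g * ?T (i - k) (j - (g + 1 - k)) else 0)"
    proof (rule sum.cong[OF refl])
      fix k
      have T: "?T (i - k) (j - (g + 1 - k)) = (\<Sum>gs\<in>?U m. of_nat (P_hat (i - k) (j - (g + 1 - k)) gs) * (\<Prod>\<gamma>\<leftarrow>gs. A \<gamma>))"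
        by (rule Suc.IH) (use Suc.prems in linarith)
      show "(\<Sum>gs\<in>?U m. if k \<le> i \<and> g + 1 - k \<le> j
            then A g * (of_nat (P_hat (i - k) (j - (g + 1 - k)) gs) * (\<Prod>\<gamma>\<leftarrow>gs. A \<gamma>)) else 0)
          = (if k \<le> i \<and> g + 1 - k \<le> j then A g * ?T (i - k) (j - (g + 1 - k)) else 0)"
      proof (cases "k \<le> i \<and> g + 1 - k \<le> j")
          case True
          show ?thesis
            unfolding if_P[OF True] T sum_distrib_left by (simp only:)
        next
          case False
          show ?thesis
            unfolding if_not_P[OF False] by (rule sum.neutral_const)
        qed
    qed
    finally show "(\<Sum>gs\<in>?U m. of_nat (P_hat i j (g # gs)) * (\<Prod>\<gamma>\<leftarrow>g # gs. A \<gamma>))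
        = (\<Sum>k = 1..g. if k \<le> i \<and> g + 1 - k \<le> j then A g * ?T (i - k) (j - (g + 1 - k)) else 0)" .
  qed
  also have "\<dots> = (\<Sum>(g, k)\<in>Sigma {1..n} (\<lambda>g. {1..g}).
      if k \<le> i \<and> g + 1 - k \<le> j then A g * ?T (i - k) (j - (g + 1 - k)) else 0)"
    by (rule sum.Sigma) auto
  also have "\<dots> = (\<Sum>(g, k)\<in>{(g, k). g \<in> {1..n} \<and> k \<in> {1..g} \<and> k \<le> i \<and> g + 1 - k \<le> j}.
      A g * ?T (i - k) (j - (g + 1 - k)))"
    by (rule sum.mono_neutral_cong_right) (auto split: if_splits)
  \<comment> \<open>From an index \<open>g\<close> and its first part \<open>k\<close> to the
    exponents \<open>a = k\<close> and \<open>b = g + 1 - k\<close>; the limit \<open>g <= n\<close>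
    follows from \<open>a + b <= i + j <= n\<close>.\<close>
  also have "\<dots> = (\<Sum>(b, a)\<in>{1..j} \<times> {1..i}. A (a + b - 1) * ?T (i - a) (j - b))"
    by (rule sum.reindex_bij_witness[where i = "\<lambda>(b, a). (a + b - 1, a)" and j = "\<lambda>(g, k). (g + 1 - k, k)"])
       (use Suc.prems in auto)
  also have "\<dots> = (\<Sum>b = 1..j. \<Sum>a = 1..i. A (a + b - 1) * ?T (i - a) (j - b))"
    by (rule sum.cartesian_product[symmetric])
  also have "\<dots> = (\<Sum>b = 0..j. \<Sum>a = 0..i. symbol_series A $ b $ a * ?T (i - a) (j - b))"
    by (intro sum.mono_neutral_cong_left) (auto simp: symbol_series_nth intro!: sum.mono_neutral_cong_left)
  also have "\<dots> = (symbol_series A ^ Suc m) $ j $ i"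
    by (simp add: fps_mult_nth fps_sum_nth)
  finally show ?case ..
qed

section \<open>The dispersionless hierarchy\<close>

lemma monom_value_single: "monom_value t (Poly_Mapping.single i 1) = t (i + 1)"
  by (simp add: monom_value_def)

lemma mcoeff_rescale: "mcoeff (rescale F) \<mu> = mcoeff F \<mu> * monom_value (\<lambda>k. 1 / of_nat k) \<mu>"
  by (simp add: rescale_def monom_value_def)

lemma rescale_mult: "rescale (F * G) = rescale F * rescale G"
proof (rule mps_eqI)
  fix \<mu> :: "nat \<Rightarrow>\<^sub>0 nat"
  show "mcoeff (rescale (F * G)) \<mu> = mcoeff (rescale F * rescale G) \<mu>"
    unfolding mcoeff_rescale mcoeff_mult sum_distrib_right
    by (rule sum.cong) (auto simp: monom_value_add)
qed

lemma rescale_simps: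
  "rescale (mps_const c * F) = mps_const c * rescale F" "rescale 1 = 1" "rescale (F + G) = rescale F + rescale G"
  "rescale 0 = 0"
  by (rule mps_eqI, simp add: mcoeff_rescale distrib_right mult.assoc)+

lemma rescale_sum: "rescale (\<Sum>i\<in>I. F i) = (\<Sum>i\<in>I. rescale (F i))"
  by (induction I rule: infinite_finite_induct) (auto simp: rescale_simps)

lemma rescale_eq_iff: "rescale F = rescale G \<longleftrightarrow> F = G"
proof
  assume *: "rescale F = rescale G"
  show "F = G"
  proof (rule mps_eqI)
    fix \<mu>
    have "monom_value (\<lambda>k. 1 / of_nat k :: complex) \<mu> \<noteq> 0"
      unfolding monom_value_def by (simp del: of_nat_Suc)
    moreover have "mcoeff (rescale F) \<mu> = mcoeff (rescale G) \<mu>"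
      using * by simp
    ultimately show "mcoeff F \<mu> = mcoeff G \<mu>"
      by (simp add: mcoeff_rescale)
  qed
qed simp

lemma pdiff_rescale:
  assumes "k \<ge> 1"
  shows "pdiff k (rescale F) = mps_const (1 / of_nat k) * rescale (pdiff k F)"
  using assms monom_value_single[of "\<lambda>k. 1 / of_nat k :: complex" "k - 1"]
  by (intro mps_eqI) (simp add: mcoeff_pdiff mcoeff_rescale monom_value_add)

lemma pdiff_const_mult: "pdiff k (mps_const c * F) = mps_const c * pdiff k F"
  by simp

lemma prod_list_const_mult:
  assumes "\<And>x y. \<kappa> (x * y) = \<kappa> x * (\<kappa> y :: 'b::comm_monoid_mult)" "\<kappa> 1 = 1"
  shows "(\<Prod>\<gamma>\<leftarrow>\<gamma>s. \<kappa> (1 / of_nat \<gamma> :: complex) * f \<gamma>) = \<kappa> (1 / of_nat (prod_list \<gamma>s)) * (\<Prod>\<gamma>\<leftarrow>\<gamma>s. f \<gamma>)"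
proof (induction \<gamma>s)
  case (Cons g gs)
  have "\<kappa> (1 / of_nat (prod_list (g # gs))) = \<kappa> (1 / of_nat g) * \<kappa> (1 / of_nat (prod_list gs))"
    by (simp flip: assms(1))
  then show ?case
    unfolding list.map prod_list.Cons Cons.IH by (simp only: mult_ac)
qed (simp add: assms(2))

lemma rescale_prod_list: "rescale (\<Prod>\<gamma>\<leftarrow>\<gamma>s. f \<gamma>) = (\<Prod>\<gamma>\<leftarrow>\<gamma>s. rescale (f \<gamma>))"
  by (induction \<gamma>s) (simp_all add: rescale_simps rescale_mult)

text \<open>\<open>rescale\<close> is an injective homomorphism that commutes with the derivative in
  \<open>t_k\<close> up to \<open>1/k\<close>. The resulting factors \<open>1/(i j)\<close> and
  \<open>1/\<gamma>_k\<close> account exactly for the quotient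
  \<open>i j/(\<gamma>_1 ... \<gamma>_m)\<close>.\<close>

lemma A_equation_iff:
  assumes "i \<ge> 1" "j \<ge> 1"
  shows "pdiff i (pdiff j (rescale F0)) =
       (\<Sum>\<gamma>s\<in>index_tuples i j. mps_const (R_A i j \<gamma>s) * (\<Prod>\<gamma>\<leftarrow>\<gamma>s. pdiff 1 (pdiff \<gamma> (rescale F0))))
    \<longleftrightarrow> pdiff i (pdiff j F0) =
       (\<Sum>\<gamma>s\<in>index_tuples i j.
          mps_const ((-1) ^ (length \<gamma>s - 1) / of_nat (length \<gamma>s)
            * (of_nat (i * j) / of_nat (prod_list \<gamma>s)) * of_nat (P_hat i j \<gamma>s))
          * (\<Prod>\<gamma>\<leftarrow>\<gamma>s. pdiff 1 (pdiff \<gamma> F0)))" (is "?l = ?r \<longleftrightarrow> ?lhs = ?rhs")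
proof -
  have nz: "of_nat (i * j) \<noteq> (0 :: complex)"
    unfolding of_nat_eq_0_iff using assms by simp
  have l: "?l = mps_const (1 / of_nat (i * j)) * rescale ?lhs"
    using assms by (simp add: pdiff_rescale mps_const_simps mult_ac flip: mult.assoc)
  have summand: "mps_const (R_A i j \<gamma>s) * (\<Prod>\<gamma>\<leftarrow>\<gamma>s. pdiff 1 (pdiff \<gamma> (rescale F0)))
      = mps_const (1 / of_nat (i * j)) * rescale (mps_const ((-1) ^ (length \<gamma>s - 1) / of_nat (length \<gamma>s)
            * (of_nat (i * j) / of_nat (prod_list \<gamma>s)) * of_nat (P_hat i j \<gamma>s))
          * (\<Prod>\<gamma>\<leftarrow>\<gamma>s. pdiff 1 (pdiff \<gamma> F0)))" if \<gamma>s: "\<gamma>s \<in> index_tuples i j" for \<gamma>s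
  proof -
    have "(\<Prod>\<gamma>\<leftarrow>\<gamma>s. pdiff 1 (pdiff \<gamma> (rescale F0)))
        = (\<Prod>\<gamma>\<leftarrow>\<gamma>s. mps_const (1 / of_nat \<gamma>) * rescale (pdiff 1 (pdiff \<gamma> F0)))"
    proof (intro arg_cong[where f = prod_list] map_cong refl)
      fix \<gamma> assume "\<gamma> \<in> set \<gamma>s"
      with \<gamma>s have "\<gamma> \<ge> 1"
        by (auto simp: index_tuples_def)
      then show "pdiff 1 (pdiff \<gamma> (rescale F0)) = mps_const (1 / of_nat \<gamma>) * rescale (pdiff 1 (pdiff \<gamma> F0))"
        unfolding pdiff_rescale[OF \<open>\<gamma> \<ge> 1\<close>] pdiff_const_mult pdiff_rescale[OF order_refl]
        by (simp add: mps_const_simps)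
    qed
    then have prod: "(\<Prod>\<gamma>\<leftarrow>\<gamma>s. pdiff 1 (pdiff \<gamma> (rescale F0)))
        = mps_const (1 / of_nat (prod_list \<gamma>s)) * rescale (\<Prod>\<gamma>\<leftarrow>\<gamma>s. pdiff 1 (pdiff \<gamma> F0))"
      by (simp only: prod_list_const_mult[of mps_const] rescale_prod_list mps_const_simps(2,3))
    have "R_A i j \<gamma>s * (1 / of_nat (prod_list \<gamma>s)) = 1 / of_nat (i * j) * ((-1) ^ (length \<gamma>s - 1) / of_nat (length \<gamma>s)
            * (of_nat (i * j) / of_nat (prod_list \<gamma>s)) * of_nat (P_hat i j \<gamma>s))"
      unfolding R_A_eq[OF assms \<gamma>s] using nz by simp
    then show ?thesis
      unfolding prod rescale_simps(1) mult.assoc[symmetric] mps_const_simps(3) by (simp only:)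
  qed
  have r: "?r = mps_const (1 / of_nat (i * j)) * rescale ?rhs"
    unfolding rescale_sum sum_distrib_left by (rule sum.cong[OF refl summand])
  have "mps_const (of_nat (i * j)) * (mps_const (1 / of_nat (i * j)) * F) = F" for F :: "complex mps"
    using nz by (simp add: mps_const_simps flip: mult.assoc)
  then have "mps_const (1 / of_nat (i * j)) * F = mps_const (1 / of_nat (i * j)) * G \<longleftrightarrow> F = G" for F G :: "complex mps"
    by metis
  then show ?thesis
    unfolding l r rescale_eq_iff[of ?lhs ?rhs, symmetric] .
qed

section \<open>The full hierarchy\<close>

lemma hconst_simps:
  "hconst (x * y) = hconst x * hconst y" "hconst (of_nat n) = of_nat n" "hconst (- x) = - hconst x" "hconst 1 = 1"
  unfolding hconst_def
  by (simp_all add: mps_const_simps fps_of_nat flip: mps_const_simps(3) mps_const_simps(5))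

lemma fps_X_mult_cancel:
  fixes F G :: "'b::comm_ring_1 fps"
  assumes "fps_X * F = fps_X * G"
  shows "F = G"
proof (rule fps_ext)
  fix n
  have "(fps_X * F) $ Suc n = (fps_X * G) $ Suc n"
    unfolding assms ..
  then show "F $ n = G $ n"
    by simp
qed

lemma hpdiff_nth: "hpdiff k F $ n = pdiff k (F $ n)"
  by (simp add: hpdiff_def)

lemma hpdiff_simps: "hpdiff k 0 = 0" "hpdiff k (F + G) = hpdiff k F + hpdiff k G"
  "hpdiff k (F - G) = hpdiff k F - hpdiff k G"
  by (rule fps_ext, simp add: hpdiff_nth)+

lemma hpdiff_sum: "hpdiff k (\<Sum>i\<in>I. f i) = (\<Sum>i\<in>I. hpdiff k (f i))"
  by (induction I rule: infinite_finite_induct) (auto simp: hpdiff_simps)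

lemma hpdiff_hconst_mult: "hpdiff k (hconst c * F) = hconst c * hpdiff k F"
  by (rule fps_ext) (simp add: hpdiff_nth hconst_def)

lemma hpdiff_X_power_mult: "hpdiff k (fps_X ^ n * F) = fps_X ^ n * hpdiff k F"
  by (rule fps_ext) (simp add: hpdiff_nth fps_X_power_mult_nth)

lemma hpdiff_commute: "hpdiff j (hpdiff k F) = hpdiff k (hpdiff j F)"
  by (rule fps_ext) (simp add: hpdiff_nth pdiff_commute)

lemma D_op_nth: "D_op G $ n = (\<Sum>k = 1..n. hconst (1 / of_nat k) * hpdiff k (G $ (n - k)))"
  by (simp add: D_op_def)

lemma D_op_power_linear:
  fixes h :: "complex mps fps \<Rightarrow> complex mps fps"
  assumes "\<And>(I :: nat set) f. h (\<Sum>i\<in>I. f i) = (\<Sum>i\<in>I. h (f i))"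
    and "\<And>c F. h (hconst c * F) = hconst c * h F" "\<And>k F. h (hpdiff k F) = hpdiff k (h F)"
  shows "(D_op ^^ m) (fps_const (h F)) $ n = h ((D_op ^^ m) (fps_const F) $ n)"
proof (induction m arbitrary: n)
  case 0
  have "h 0 = 0"
    using assms(1)[of "\<lambda>_. 0" "{}"] by simp
  then show ?case
    by simp
next
  case (Suc m)
  show ?case
    unfolding funpow.simps comp_apply D_op_nth Suc.IH assms by (rule refl)
qed

text \<open>\<open>Delta\<close> is built from sums, scalars, derivatives and division by a power of
  \<hbar>, so it commutes with any \<open>h\<close> that respects these. It is applied to a
  derivative and to the zero map.\<close>

lemma Delta_linear:
  fixes h :: "complex mps fps \<Rightarrow> complex mps fps"
  assumes h: "\<And>(I :: nat set) f. h (\<Sum>i\<in>I. f i) = (\<Sum>i\<in>I. h (f i))"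
      "\<And>c F. h (hconst c * F) = hconst c * h F" "\<And>k F. h (hpdiff k F) = hpdiff k (h F)"
    and X: "\<And>n F. h (fps_X ^ n * F) = fps_X ^ n * h F" and diff: "\<And>F G. h (F - G) = h F - h G"
  shows "Delta (h F) $ k = h (Delta F $ k)"
proof -
  have e: "exp_hD (h F) $ k = h (exp_hD F $ k)"
    by (simp only: exp_hD_def fps_nth_Abs_fps D_op_power_linear[OF h] h X mult.assoc)
  have c: "fps_const (h F) $ k = h (fps_const F $ k)"
    using h(1)[of "\<lambda>_. 0" "{}"] by simp
  have "fps_X * (Delta (h F) $ k) = h (fps_X ^ 1 * (Delta F $ k))"
    unfolding power_one_right Delta_nth fps_sub_nth diff e c ..
  also have "\<dots> = fps_X * h (Delta F $ k)"
    unfolding X by simp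
  finally show ?thesis
    by (rule fps_X_mult_cancel)
qed

lemma Delta_hpdiff: "Delta (hpdiff l F) $ k = hpdiff l (Delta F $ k)"
  by (rule Delta_linear)
     (simp_all add: hpdiff_sum hpdiff_hconst_mult hpdiff_commute[of l] hpdiff_X_power_mult hpdiff_simps)

lemma Delta_0 [simp]: "Delta 0 = 0"
  using Delta_linear[of "\<lambda>_. 0" 0] by (intro fps_ext) (simp add: hpdiff_simps)

lemma Delta_nth_0 [simp]: "Delta F $ 0 = 0"
  by (simp add: Delta_def exp_hD_def hconst_simps)

text \<open>In the coefficients of \<open>w2\<close> the assumption reads
  \<open>w1 Q_n = Q_(n-1)\<close>, with 0 in place of \<open>Q_(-1)\<close>, and multiplication by
  \<open>w1\<close> is injective.\<close>

lemma w_diff_cancel: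
  assumes "(w2 - w1) * Q = 0"
  shows "Q = 0"
proof -
  have *: "fps_X * (Q $ n) = (if n = 0 then 0 else Q $ (n - 1))" for n
  proof -
    have "((w2 - w1) * Q) $ n = (if n = 0 then 0 else Q $ (n - 1)) - fps_X * (Q $ n)"
      unfolding w1_def w2_def left_diff_distrib fps_sub_nth fps_mult_left_const_nth fps_X_mult_nth ..
    then have "(if n = 0 then 0 else Q $ (n - 1)) - fps_X * (Q $ n) = 0"
      unfolding assms fps_zero_nth by (rule sym)
    then show ?thesis
      unfolding right_minus_eq by (rule sym)
  qed
  have "Q $ n = 0" for n
  proof (induction n)
    case 0
    have "fps_X * (Q $ 0) = fps_X * 0"
      unfolding *[of 0] by simp
    then show ?case
      by (rule fps_X_mult_cancel)
  next
    case (Suc n)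
    have "fps_X * (Q $ Suc n) = fps_X * 0"
      unfolding *[of "Suc n"] by (simp add: Suc)
    then show ?case
      by (rule fps_X_mult_cancel)
  qed
  then show ?thesis
    by (intro fps_ext[of Q 0]) simp
qed

text \<open>For each \<gamma> the quotient
  \<open>w1 w2 (w1^\<gamma> - w2^\<gamma>) / (w2 - w1)\<close> is minus the sum of
  \<open>w1^i w2^j\<close> over positive \<open>i\<close>, \<open>j\<close> with
  \<open>i + j = \<gamma> + 1\<close>. So the right side of the Fay identity is 1 plus the
  kernel.\<close>

lemma Fay_quotient:
  fixes F :: "complex mps fps"
  defines "A \<equiv> \<lambda>\<gamma>. hpdiff 1 (Delta F $ \<gamma>)"
  shows "(w2 - w1) * Q = w1 * w2 * (Delta_z1 (hpdiff 1 F) - Delta_z2 (hpdiff 1 F))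
    \<longleftrightarrow> Q = - symbol_series A"
proof -
  let ?S = "symbol_series A"
  have A: "hpdiff (Suc 0) (Delta F $ \<gamma>) = A \<gamma>" for \<gamma>
    by (simp add: A_def)
  have A0: "A 0 = 0"
    by (simp add: A_def hpdiff_simps)
  have "(w2 - w1) * (- ?S) = w1 * w2 * (Delta_z1 (hpdiff 1 F) - Delta_z2 (hpdiff 1 F))"
  proof (rule fps_ext, rule fps_ext)
    fix j i
    have w1: "(w1 * G) $ j $ i = (if i = 0 then 0 else G $ j $ (i - 1))" for G j i
      by (simp add: w1_def)
    have w2: "(w2 * G) $ j $ i = (if j = 0 then 0 else G $ (j - 1) $ i)" for G j i
      by (simp add: w2_def)
    have "((w2 - w1) * (- ?S)) $ j $ i = (w1 * ?S) $ j $ i - (w2 * ?S) $ j $ i"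
      by (simp add: algebra_simps)
    \<comment> \<open>For \<open>i, j >= 2\<close> the two copies of \<open>A (i + j - 2)\<close>
      cancel; only the boundary \<open>j = 1\<close> sees \<open>Delta_z1\<close> and only
      \<open>i = 1\<close> sees \<open>Delta_z2\<close>.\<close>
    also have "\<dots> = (w1 * (w2 * (Delta_z1 (hpdiff 1 F) - Delta_z2 (hpdiff 1 F)))) $ j $ i"
      unfolding w1 w2
      by (cases i; cases j; cases "i = 1"; cases "j = 1")
         (auto simp: symbol_series_nth Delta_z1_def Delta_z2_def Delta_hpdiff A A0 hpdiff_simps)
    finally show "((w2 - w1) * (- ?S)) $ j $ i = (w1 * w2 * (Delta_z1 (hpdiff 1 F) - Delta_z2 (hpdiff 1 F))) $ j $ i"
      by (simp only: mult.assoc)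
  qed
  then have "(w2 - w1) * Q = w1 * w2 * (Delta_z1 (hpdiff 1 F) - Delta_z2 (hpdiff 1 F))
      \<longleftrightarrow> (w2 - w1) * (Q - - ?S) = 0"
    by (simp only: right_diff_distrib right_minus_eq)
  also have "\<dots> \<longleftrightarrow> Q = - ?S"
  proof
    assume "(w2 - w1) * (Q - - ?S) = 0"
    from w_diff_cancel[OF this] show "Q = - ?S"
      unfolding right_minus_eq .
  next
    assume "Q = - ?S"
    then show "(w2 - w1) * (Q - - ?S) = 0"
      by (simp only: diff_self mult_zero_right)
  qed
  finally show ?thesis .
qed

interpretation h: rational_scalars "\<lambda>x. fps_const (hconst x) :: complex mps fps fps"
  by standard (simp_all only: hconst_simps fps_const_mult fps_of_nat fps_const_neg)

text \<open>A tuple with nonzero \<open>P_hat\<close> satisfies the length bound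
  \<open>m <= j\<close> of the logarithm as well as the conditions of \<open>index_tuples\<close>,
  so both index sets carry the same sum.\<close>

lemma log1p_symbol_series_nth:
  "h.ring_log1p (symbol_series A) $ j $ i
    = (\<Sum>\<gamma>s\<in>index_tuples i j. hconst ((-1) ^ (length \<gamma>s - 1) / of_nat (length \<gamma>s) * of_nat (P_hat i j \<gamma>s))
        * (\<Prod>\<gamma>\<leftarrow>\<gamma>s. A \<gamma>))"
proof -
  let ?n = "i + j"
  let ?U = "\<lambda>m. {\<gamma>s. set \<gamma>s \<subseteq> {1..?n} \<and> length \<gamma>s = m}"
  let ?f = "\<lambda>\<gamma>s. hconst ((-1) ^ (length \<gamma>s - 1) / of_nat (length \<gamma>s) * of_nat (P_hat i j \<gamma>s)) * (\<Prod>\<gamma>\<leftarrow>\<gamma>s. A \<gamma>)"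
  have fin: "finite (?U m)" for m
    by (rule finite_lists_length_eq) simp
  have zero: "?f \<gamma>s = 0" if "P_hat i j \<gamma>s = 0" for \<gamma>s
    using that hconst_simps(2)[of 0] by simp
  have "h.ring_log1p (symbol_series A) $ j $ i
      = (\<Sum>m = 1..j. hconst ((-1) ^ (m - 1) / of_nat m) * (symbol_series A ^ m) $ j $ i)"
    by (simp add: h.ring_log1p_def fps_sum_nth)
  also have "\<dots> = (\<Sum>m = 1..j. \<Sum>\<gamma>s\<in>?U m. ?f \<gamma>s)"
  proof (rule sum.cong[OF refl])
    fix m
    show "hconst ((-1) ^ (m - 1) / of_nat m) * (symbol_series A ^ m) $ j $ i = (\<Sum>\<gamma>s\<in>?U m. ?f \<gamma>s)"
      unfolding symbol_series_power[OF order_refl] sum_distrib_left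
    proof (rule sum.cong[OF refl])
      fix \<gamma>s assume "\<gamma>s \<in> ?U m"
      then have m: "m = length \<gamma>s"
        by simp
      show "hconst ((-1) ^ (m - 1) / of_nat m) * (of_nat (P_hat i j \<gamma>s) * (\<Prod>\<gamma>\<leftarrow>\<gamma>s. A \<gamma>)) = ?f \<gamma>s"
        unfolding m by (simp only: hconst_simps(1,2) mult.assoc)
    qed
  qed
  also have "\<dots> = (\<Sum>\<gamma>s\<in>(\<Union>m\<in>{1..j}. ?U m). ?f \<gamma>s)"
    by (rule sum.UNION_disjoint[symmetric]) (use fin in \<open>auto simp del: One_nat_def\<close>)
  also have "\<dots> = (\<Sum>\<gamma>s\<in>index_tuples i j. ?f \<gamma>s)"
  proof (rule sum.mono_neutral_cong)
    show "finite (\<Union>m\<in>{1..j}. ?U m)"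
      by (intro finite_UN_I fin finite_atLeastAtMost)
    show "?f \<gamma>s = 0" if "\<gamma>s \<in> index_tuples i j - (\<Union>m\<in>{1..j}. ?U m)" for \<gamma>s
    proof (rule zero, rule ccontr)
      assume "P_hat i j \<gamma>s \<noteq> 0"
      then have "length \<gamma>s \<le> j"
        using P_hat_nonzero by blast
      moreover have "set \<gamma>s \<subseteq> {1..?n}" "length \<gamma>s \<ge> 1"
        using that member_le_sum_list[of _ \<gamma>s] by (fastforce simp: index_tuples_def)+
      ultimately show False
        using that by auto
    qed
    show "?f \<gamma>s = 0" if "\<gamma>s \<in> (\<Union>m\<in>{1..j}. ?U m) - index_tuples i j" for \<gamma>s
    proof (rule zero, rule ccontr)
      assume "P_hat i j \<gamma>s \<noteq> 0"
      then show False
        using P_hat_nonzero[of i j \<gamma>s] that by (auto simp: index_tuples_def)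
    qed
  qed (simp_all add: finite_index_tuples)
  finally show ?thesis .
qed

text \<open>Take the logarithm of the Fay identity and compare coefficients. Those with
  \<open>i = 0\<close> or \<open>j = 0\<close> vanish on both sides, which leaves the positive
  indices.\<close>

lemma full_KP_iff:
  "full_KP F \<longleftrightarrow> (\<forall>i\<ge>1. \<forall>j\<ge>1. Delta (Delta F $ j) $ i
    = (\<Sum>\<gamma>s\<in>index_tuples i j. hconst ((-1) ^ (length \<gamma>s - 1) / of_nat (length \<gamma>s) * of_nat (P_hat i j \<gamma>s))
        * (\<Prod>\<gamma>\<leftarrow>\<gamma>s. hpdiff 1 (Delta F $ \<gamma>))))"
proof -
  define A where "A \<gamma> = hpdiff 1 (Delta F $ \<gamma>)" for \<gamma>
  let ?S = "symbol_series A"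
  have zero: "h.ring_log1p ?S $ j $ i = 0" if "i = 0 \<or> j = 0" for i j
    unfolding log1p_symbol_series_nth
  proof (rule sum.neutral, rule ballI)
    fix \<gamma>s assume "\<gamma>s \<in> index_tuples i j"
    then have "length \<gamma>s \<ge> 1"
      by (simp add: index_tuples_def)
    then have "P_hat i j \<gamma>s = 0"
      using P_hat_nonzero[of i j \<gamma>s] that by fastforce
    then show "hconst ((-1) ^ (length \<gamma>s - 1) / of_nat (length \<gamma>s) * of_nat (P_hat i j \<gamma>s)) * (\<Prod>\<gamma>\<leftarrow>\<gamma>s. A \<gamma>) = 0"
      using hconst_simps(2)[of 0] by simp
  qed
  have "full_KP F \<longleftrightarrow> h.ring_exp (Delta_z1_z2 F) = 1 + ?S"
    unfolding full_KP_def Fay_quotient A_def[abs_def] exp_w_def h.ring_exp_def by auto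
  also have "\<dots> \<longleftrightarrow> Delta_z1_z2 F = h.ring_log1p ?S"
    by (rule h.ring_exp_eq_iff) (simp_all add: Delta_z1_z2_def symbol_series_nth_0)
  also have "\<dots> \<longleftrightarrow> (\<forall>i j. Delta (Delta F $ j) $ i = h.ring_log1p ?S $ j $ i)"
    by (auto simp: fps_eq_iff Delta_z1_z2_def)
  also have "\<dots> \<longleftrightarrow> (\<forall>i\<ge>1. \<forall>j\<ge>1. Delta (Delta F $ j) $ i = h.ring_log1p ?S $ j $ i)"
  proof (intro iffI allI impI)
    fix i j assume *: "\<forall>i\<ge>1. \<forall>j\<ge>1. Delta (Delta F $ j) $ i = h.ring_log1p ?S $ j $ i"
    show "Delta (Delta F $ j) $ i = h.ring_log1p ?S $ j $ i"
    proof (cases "i = 0 \<or> j = 0")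
      case True
      then show ?thesis
        using zero[of i j] by auto
    next
      case False
      then show ?thesis
        using * by simp
    qed
  qed simp
  finally show ?thesis
    unfolding log1p_symbol_series_nth A_def .
qed

theorem theorem6p2:
  shows "(\<forall>F0 :: complex mps. A_system (rescale F0) \<longleftrightarrow> dispersionless_KP F0) \<and>
    (\<forall>F :: complex mps fps. full_KP F \<longleftrightarrow>
      (\<forall>i\<ge>1. \<forall>j\<ge>1.
        hconst (1 / of_nat i) * hbar_pdiff i (hconst (1 / of_nat j) * hbar_pdiff j F) =
          (\<Sum>\<gamma>s\<in>index_tuples i j.
             hconst (R_A i j \<gamma>s) *
             (\<Prod>\<gamma>\<leftarrow>\<gamma>s. hconst (1 / of_nat \<gamma>) * hpdiff 1 (hbar_pdiff \<gamma> F)))))"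
proof (intro conjI allI)
  fix F0 :: "complex mps"
  show "A_system (rescale F0) \<longleftrightarrow> dispersionless_KP F0"
    unfolding A_system_def dispersionless_KP_def using A_equation_iff by auto
next
  fix F :: "complex mps fps"
  \<comment> \<open>\<open>hbar_pdiff k\<close> carries a factor \<open>k\<close>. The
    normalisations by \<open>1/i\<close>, \<open>1/j\<close> and \<open>1/\<gamma>\<close> remove it
    and leave bare coefficients of \<open>Delta\<close>.\<close>
  have hbar: "hconst (1 / of_nat k) * (hconst (of_nat k) * G) = G" if "k \<ge> 1" for k G
  proof -
    have "1 / of_nat k * of_nat k = (1 :: complex)"
      using that by simp
    then show ?thesis
      unfolding mult.assoc[symmetric] hconst_simps(1)[symmetric] by (simp only: hconst_simps(4) mult_1_left)
  qed
  have l: "hconst (1 / of_nat i) * hbar_pdiff i (hconst (1 / of_nat j) * hbar_pdiff j F) = Delta (Delta F $ j) $ i"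
    if "i \<ge> 1" "j \<ge> 1" for i j
    unfolding hbar_pdiff_def hbar[OF that(1)] hbar[OF that(2)] ..
  have r: "hconst (R_A i j \<gamma>s) * (\<Prod>\<gamma>\<leftarrow>\<gamma>s. hconst (1 / of_nat \<gamma>) * hpdiff 1 (hbar_pdiff \<gamma> F))
      = hconst ((-1) ^ (length \<gamma>s - 1) / of_nat (length \<gamma>s) * of_nat (P_hat i j \<gamma>s))
        * (\<Prod>\<gamma>\<leftarrow>\<gamma>s. hpdiff 1 (Delta F $ \<gamma>))"
    if "i \<ge> 1" "j \<ge> 1" "\<gamma>s \<in> index_tuples i j" for i j \<gamma>s
  proof -
    have "hconst (1 / of_nat \<gamma>) * hpdiff 1 (hbar_pdiff \<gamma> F) = hpdiff 1 (Delta F $ \<gamma>)" if "\<gamma> \<in> set \<gamma>s" for \<gamma>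
      using that \<open>\<gamma>s \<in> index_tuples i j\<close>
      unfolding hbar_pdiff_def hpdiff_hconst_mult by (intro hbar) (auto simp: index_tuples_def)
    then show ?thesis
      unfolding R_A_eq[OF that] by (simp cong: map_cong)
  qed
  show "full_KP F \<longleftrightarrow>
      (\<forall>i\<ge>1. \<forall>j\<ge>1.
        hconst (1 / of_nat i) * hbar_pdiff i (hconst (1 / of_nat j) * hbar_pdiff j F) =
          (\<Sum>\<gamma>s\<in>index_tuples i j.
             hconst (R_A i j \<gamma>s) *
             (\<Prod>\<gamma>\<leftarrow>\<gamma>s. hconst (1 / of_nat \<gamma>) * hpdiff 1 (hbar_pdiff \<gamma> F))))"
    unfolding full_KP_iff
  proof (intro all_cong1 imp_cong refl)
    fix i j :: nat assume "i \<ge> 1" "j \<ge> 1"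
    then show "(Delta (Delta F $ j) $ i
          = (\<Sum>\<gamma>s\<in>index_tuples i j. hconst ((-1) ^ (length \<gamma>s - 1) / of_nat (length \<gamma>s) * of_nat (P_hat i j \<gamma>s))
              * (\<Prod>\<gamma>\<leftarrow>\<gamma>s. hpdiff 1 (Delta F $ \<gamma>))))
        = (hconst (1 / of_nat i) * hbar_pdiff i (hconst (1 / of_nat j) * hbar_pdiff j F)
          = (\<Sum>\<gamma>s\<in>index_tuples i j. hconst (R_A i j \<gamma>s) *
             (\<Prod>\<gamma>\<leftarrow>\<gamma>s. hconst (1 / of_nat \<gamma>) * hpdiff 1 (hbar_pdiff \<gamma> F))))"
      by (simp only: l sum.cong[OF refl r])
  qed
qed

end
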